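(* Let $d\in\mathbb{N}$, $T>0$, $a,b>0$, and let $\{a_n\}_{n\ge1}$ be a sequence of positive real numbers with $n^{d-1}\sqrt{g_d(n)}\ll a_n\ll n^d$. There exists $\lambda_c>0$ such that for any $\lambda\in[-\lambda_c,\lambda_c]$ (with $\lambda>-a$) the following holds. If $\{r_n\}_{n\ge1}$ is a sequence of positive real numbers with $r_n\gg a_n$, then for any $H\in C^{1,\infty}([0,T]\times\mathbb{T}^d)$ and any $\varepsilon>0$, $$\lim_{n\to\infty}\frac{n^d}{a_n^2}\log\mathbb{P}^n_{\rho_*}\Big(\sup_{0\le t\le T}\Big|\int_0^t\frac1{r_n}\sum_{x\in\mathbb{T}_n^d}\bar\eta_x(s)H_s(\tfrac xn)\,ds\Big|>\varepsilon\Big)=-\infty.$$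
   Context: Notation: $u_n\ll v_n$ (equivalently $v_n\gg u_n$) means $u_n/v_n\to0$ as $n\to\infty$. $g_d(n)=n$ if $d=1$, $g_d(n)=\log n$ if $d=2$, $g_d(n)=1$ if $d\ge3$. $\mathbb{T}^d$ is the $d$-dimensional unit torus, $\mathbb{T}_n^d=\mathbb{Z}^d/(n\mathbb{Z}^d)$ the discrete torus, $e_1,\dots,e_d$ the canonical basis; $x\sim y$ means $\sum_i|x_i-y_i|=1$. $C^{1,\infty}([0,T]\times\mathbb{T}^d)$ is the space of functions continuously differentiable in time and smooth in space; $H_s=H(s,\cdot)$. The process: the state space is $\Omega_n=\{0,1\}^{\mathbb{T}_n^d}$. For parameters $a,b>0$ and $\lambda>-a$, $\eta(t)=\eta^n(t)$ is the continuous-time Markov process on $\Omega_n$ with generator $L_n=n^2L_n^{\rm ex}+L_n^{\rm r}$, where for $f:\Omega_n\to\mathbb{R}$, $$L_n^{\rm ex}f(\eta)=\sum_{x\in\mathbb{T}_n^d}\sum_{i=1}^d[f(\eta^{x,x+e_i})-f(\eta)],\qquad L_n^{\rm r}f(\eta)=\sum_{x\in\mathbb{T}_n^d}c_x(\eta)[f(\eta^x)-f(\eta)],$$ $\eta^{x,y}$ is $\eta$ with the values at $x$ and $y$ swapped, $\eta^x$ is $\eta$ with the value at $x$ replaced by $1-\eta_x$, and $$c_x(\eta)=\Big(a+\frac{\lambda}{2d}\sum_{y\sim x}\eta_y\Big)(1-\eta_x)+b\eta_x.$$ $\rho_*$ is the unique point of $(0,1)$ with $F(\rho_* )=0$, where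 $F(\rho)=(a+\lambda\rho)(1-\rho)-b\rho$. $\nu^n_{\rho_*}$ is the product Bernoulli measure on $\Omega_n$ with constant density $\rho_*$, $\mathbb{P}^n_{\rho_*}$ is the law on $D([0,T],\Omega_n)$ of the process started from $\nu^n_{\rho_*}$, and $\bar\eta_x=\eta_x-\rho_*$. *)

theory Defs
  imports "HOL-Probability.Probability"
begin

definition transition_function :: "'s set \<Rightarrow> (real \<Rightarrow> 's \<Rightarrow> 's \<Rightarrow> real) \<Rightarrow> bool" where
  "transition_function S p \<longleftrightarrow>
     (\<forall>t\<ge>0. \<forall>x\<in>S. (\<forall>y\<in>S. 0 \<le> p t x y) \<and> (\<Sum>y\<in>S. p t x y) = 1) \<and>
     (\<forall>x\<in>S. \<forall>y\<in>S. p 0 x y = of_bool (x = y)) \<and>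
     (\<forall>s\<ge>0. \<forall>t\<ge>0. \<forall>x\<in>S. \<forall>y\<in>S. p (s + t) x y = (\<Sum>z\<in>S. p s x z * p t z y))"

definition has_generator ::
  "'s set \<Rightarrow> (real \<Rightarrow> 's \<Rightarrow> 's \<Rightarrow> real) \<Rightarrow> (('s \<Rightarrow> real) \<Rightarrow> 's \<Rightarrow> real) \<Rightarrow> bool" where
  "has_generator S p L \<longleftrightarrow>
     (\<forall>f. \<forall>x\<in>S. ((\<lambda>t. ((\<Sum>y\<in>S. p t x y * f y) - f x) / t) \<longlongrightarrow> L f x) (at_right 0))"

text \<open>Limits are taken in the discrete topology on \<open>S\<close>, where convergence means being
  eventually constant.\<close>

definition cadlag_paths :: "real \<Rightarrow> 's set \<Rightarrow> (real \<Rightarrow> 's) set" where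
  "cadlag_paths T S = {w \<in> {0..T} \<rightarrow>\<^sub>E S.
     (\<forall>t\<in>{0..<T}. \<forall>\<^sub>F s in at_right t. w s = w t) \<and>
     (\<forall>t\<in>{0<..T}. \<exists>l\<in>S. \<forall>\<^sub>F s in at_left t. w s = l)}"

text \<open>The path space \<open>D([0,T],S)\<close>. Its sigma-algebra is the one generated by the coordinate
  maps, which is the Borel sigma-algebra of the Skorokhod topology.\<close>

definition path_space :: "real \<Rightarrow> 's set \<Rightarrow> (real \<Rightarrow> 's) measure" where
  "path_space T S = restrict_space (Pi\<^sub>M {0..T} (\<lambda>_. count_space S)) (cadlag_paths T S)"

text \<open>\<open>P\<close> is the law on \<open>D([0,T],S)\<close> of the Markov process with generator \<open>L\<close> and initial
  distribution \<open>\<nu>\<close>. For finite \<open>S\<close>, \<open>p\<close> and hence \<open>P\<close> are determined by \<open>L\<close> and \<open>\<nu>\<close>.\<close>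

definition markov_law ::
  "real \<Rightarrow> 's set \<Rightarrow> (('s \<Rightarrow> real) \<Rightarrow> 's \<Rightarrow> real) \<Rightarrow> 's pmf \<Rightarrow> (real \<Rightarrow> 's) measure \<Rightarrow> bool" where
  "markov_law T S L \<nu> P \<longleftrightarrow>
     prob_space P \<and> sets P = sets (path_space T S) \<and>
     (\<exists>p. transition_function S p \<and> has_generator S p L \<and>
       (\<forall>(k::nat) (t::nat \<Rightarrow> real) (x::nat \<Rightarrow> 's).
          t 0 = 0 \<and> (\<forall>i<k. t i < t (Suc i)) \<and> t k \<le> T \<and> (\<forall>i\<le>k. x i \<in> S) \<longrightarrow>
          measure P {w \<in> space P. \<forall>i\<le>k. w (t i) = x i} =
            pmf \<nu> (x 0) * (\<Prod>i<k. p (t (Suc i) - t i) (x i) (x (Suc i)))))"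

text \<open>The discrete torus is represented by coordinates in \<open>{0..<n}\<close>, with arithmetic modulo \<open>n\<close>.
  The dimension \<open>d\<close> is \<open>CARD('d)\<close>.\<close>

type_synonym 'd config = "int ^ 'd \<Rightarrow> nat"

definition dtorus :: "nat \<Rightarrow> (int ^ 'd::finite) set" where
  "dtorus n = {x. \<forall>i. 0 \<le> x $ i \<and> x $ i < int n}"

definition shift :: "nat \<Rightarrow> int ^ 'd \<Rightarrow> 'd::finite \<Rightarrow> int ^ 'd" where
  "shift n x i = (\<chi> j. (x $ j + of_bool (j = i)) mod int n)"

definition circle_dist :: "nat \<Rightarrow> int \<Rightarrow> int \<Rightarrow> int" where
  "circle_dist n u v = min ((u - v) mod int n) ((v - u) mod int n)"

definition nbr :: "nat \<Rightarrow> int ^ 'd::finite \<Rightarrow> int ^ 'd \<Rightarrow> bool" where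
  "nbr n x y \<longleftrightarrow> (\<Sum>i\<in>UNIV. circle_dist n (x $ i) (y $ i)) = 1"

definition configs :: "nat \<Rightarrow> ('d::finite) config set" where
  "configs n = dtorus n \<rightarrow>\<^sub>E {0, 1}"

definition swap_conf :: "'d config \<Rightarrow> int ^ 'd \<Rightarrow> int ^ 'd \<Rightarrow> ('d::finite) config" where
  "swap_conf \<eta> x y = \<eta>(x := \<eta> y, y := \<eta> x)"

definition flip_conf :: "'d config \<Rightarrow> int ^ 'd \<Rightarrow> ('d::finite) config" where
  "flip_conf \<eta> x = \<eta>(x := 1 - \<eta> x)"

definition L_ex :: "nat \<Rightarrow> (('d::finite) config \<Rightarrow> real) \<Rightarrow> 'd config \<Rightarrow> real" where
  "L_ex n f \<eta> = (\<Sum>x\<in>dtorus n. \<Sum>i\<in>UNIV. f (swap_conf \<eta> x (shift n x i)) - f \<eta>)"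

definition rate ::
  "nat \<Rightarrow> real \<Rightarrow> real \<Rightarrow> real \<Rightarrow> int ^ 'd \<Rightarrow> ('d::finite) config \<Rightarrow> real" where
  "rate n a b lam x \<eta> =
     (a + lam / (2 * real CARD('d)) * (\<Sum>y | y \<in> dtorus n \<and> nbr n x y. real (\<eta> y)))
       * (1 - real (\<eta> x)) + b * real (\<eta> x)"

definition L_r ::
  "nat \<Rightarrow> real \<Rightarrow> real \<Rightarrow> real \<Rightarrow> (('d::finite) config \<Rightarrow> real) \<Rightarrow> 'd config \<Rightarrow> real" where
  "L_r n a b lam f \<eta> = (\<Sum>x\<in>dtorus n. rate n a b lam x \<eta> * (f (flip_conf \<eta> x) - f \<eta>))"

definition gen ::
  "nat \<Rightarrow> real \<Rightarrow> real \<Rightarrow> real \<Rightarrow> (('d::finite) config \<Rightarrow> real) \<Rightarrow> 'd config \<Rightarrow> real" where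
  "gen n a b lam f \<eta> = (real n)\<^sup>2 * L_ex n f \<eta> + L_r n a b lam f \<eta>"

definition reaction :: "real \<Rightarrow> real \<Rightarrow> real \<Rightarrow> real \<Rightarrow> real" where
  "reaction a b lam \<rho> = (a + lam * \<rho>) * (1 - \<rho>) - b * \<rho>"

definition rho_star :: "real \<Rightarrow> real \<Rightarrow> real \<Rightarrow> real" where
  "rho_star a b lam = (THE \<rho>. 0 < \<rho> \<and> \<rho> < 1 \<and> reaction a b lam \<rho> = 0)"

text \<open>The default value \<open>undefined\<close> makes the samples extensional, i.e. elements of
  \<^const>\<open>configs\<close>.\<close>

definition bernoulli_product :: "nat \<Rightarrow> real \<Rightarrow> ('d::finite) config pmf" where
  "bernoulli_product n \<rho> = Pi_pmf (dtorus n) undefined (\<lambda>_. map_pmf of_bool (bernoulli_pmf \<rho>))"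

definition much_less :: "(nat \<Rightarrow> real) \<Rightarrow> (nat \<Rightarrow> real) \<Rightarrow> bool" where
  "much_less u v \<longleftrightarrow> (\<lambda>n. u n / v n) \<longlonglongrightarrow> 0"

definition g_dim :: "nat \<Rightarrow> nat \<Rightarrow> real" where
  "g_dim d n = (if d = 1 then real n else if d = 2 then ln (real n) else 1)"

text \<open>Functions on the unit torus are functions on \<open>\<real>\<^sup>d\<close> with period 1 in each coordinate. The class
  \<open>C\<^sup>1\<^sup>,\<^sup>\<infinity>([0,T] \<times> \<T>\<^sup>d)\<close> is read in the usual way: the time derivative and all iterated spatial partial
  derivatives exist and are jointly continuous on \<open>[0,T] \<times> \<T>\<^sup>d\<close>. Here \<open>D is\<close> is the spatial partial
  derivative of \<open>H\<close> along the list of directions \<open>is\<close>.\<close>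

definition C1_infty :: "real \<Rightarrow> (real \<Rightarrow> real ^ 'd::finite \<Rightarrow> real) \<Rightarrow> bool" where
  "C1_infty T H \<longleftrightarrow>
     (\<forall>t\<in>{0..T}. \<forall>x i. H t (x + axis i 1) = H t x) \<and>
     (\<exists>H'. (\<forall>t\<in>{0..T}. \<forall>x. ((\<lambda>s. H s x) has_real_derivative H' t x) (at t within {0..T})) \<and>
           continuous_on ({0..T} \<times> UNIV) (\<lambda>(t, x). H' t x)) \<and>
     (\<exists>D :: 'd list \<Rightarrow> real \<Rightarrow> real ^ 'd \<Rightarrow> real.
           D [] = H \<and>
           (\<forall>is i. \<forall>t\<in>{0..T}. \<forall>x.
              ((\<lambda>s. D is t (x + s *\<^sub>R axis i 1)) has_real_derivative D (i # is) t x) (at 0)) \<and>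
           (\<forall>is. continuous_on ({0..T} \<times> UNIV) (\<lambda>(t, x). D is t x)))"

definition grid_point :: "nat \<Rightarrow> int ^ 'd::finite \<Rightarrow> real ^ 'd" where
  "grid_point n x = (\<chi> i. real_of_int (x $ i) / real n)"

text \<open>The library's \<^const>\<open>ln\<close> has \<open>ln 0 = 0\<close>; probabilities may vanish, so the convention
  \<open>log 0 = -\<infinity>\<close> has to be made explicit.\<close>

definition log_ext :: "real \<Rightarrow> ereal" where
  "log_ext p = (if p = 0 then - \<infinity> else ereal (ln p))"

end

(* The supremum over t is at most the time integral of the absolute value, so by Riemann sums and
   Jensen it suffices to bound exponential moments at a fixed time t. If nu is the Bernoulli product
   measure and <g, L g> <= E <g, g> in L^2(nu), then P_t has norm at most exp (E t) there, and
   E_nu[F(eta_t)] <= exp (E t) (E_nu F^2)^(1/2); Hoeffding's lemma bounds the last factor for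
   F = exp |linear statistic|. Since E only has to be o(a_n^2 / n^d), the theorem reduces to
   E = O(n^(d-2) g_d(n)).

   As nu is not reversible for the reaction part, <g, L g> is minus the Dirichlet form plus
   lam / (2 d rho) times the integral of W g^2, where W is the sum of the products of centred
   occupation variables over nearest neighbours. With the Green's function of the torus, W is
   written as a sum over bonds of (eta_y - eta_x) times a function that does not change under the swap
   of x and y. Integrating by parts with respect to swaps costs a part of the exclusion Dirichlet
   form and leaves the quadratic form of the Green's function, which has operator norm O(1) and trace
   O(n^(d-2) g_d(n)). Integrating that form by parts with respect to flips bounds it by its trace plus
   a constant times the flip Dirichlet form, which is absorbed because lam is small. *)
theory Submission
  imports Defs
begin

section \<open>Growth of a finite Markov semigroup in weighted \<open>L\<^sup>2\<close>\<close>

text \<open>After multiplication by \<open>n^d / a_n^2\<close>, an exponential Chebyshev bound with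
  parameter \<open>a_n r_n / n^d\<close> gains \<open>epsilon r_n / a_n\<close>, which diverges. The
  Hoeffding term stays bounded, and the growth term is of order \<open>n^d E / a_n^2\<close>. With
  \<open>E\<close> of order \<open>n^(d-2) g_d(n)\<close> this is the square of
  \<open>n^(d-1) sqrt(g_d(n)) / a_n\<close>, so the assumed lower bound on \<open>a_n\<close> is
  what this value of \<open>E\<close> requires.

  The obstacle is that \<open>W\<close> has of the order of \<open>n^d\<close> terms. Bounding each
  by 1, or integrating by parts with flips alone, leaves \<open>E\<close> of order
  \<open>n^d\<close>, which is too large when \<open>a_n << n^d\<close>. Only the exclusion part
  carries a factor \<open>n^2\<close>, so \<open>W\<close> has to be transported through bonds. The
  energy of the resulting flow is again a quadratic form in the configuration, but with the smoother
  Green kernel. Its multiplier lies in [0,1], so integrating by parts with flips bounds the form by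
  a fraction of itself plus its trace and the flip energy, and the argument closes.\<close>

definition semi :: "'s set \<Rightarrow> (real \<Rightarrow> 's \<Rightarrow> 's \<Rightarrow> real) \<Rightarrow> real \<Rightarrow> ('s \<Rightarrow> real) \<Rightarrow> 's \<Rightarrow> real" where
  "semi S p t f x = (\<Sum>y\<in>S. p t x y * f y)"

context
  fixes S :: "'s set" and p :: "real \<Rightarrow> 's \<Rightarrow> 's \<Rightarrow> real" and L :: "('s \<Rightarrow> real) \<Rightarrow> 's \<Rightarrow> real"
  assumes fin: "finite S" and tf: "transition_function S p" and gn: "has_generator S p L"
begin

lemma tf_nonneg: "t \<ge> 0 \<Longrightarrow> x \<in> S \<Longrightarrow> y \<in> S \<Longrightarrow> 0 \<le> p t x y"
  using tf by (auto simp: transition_function_def)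

lemma tf_sum: "t \<ge> 0 \<Longrightarrow> x \<in> S \<Longrightarrow> (\<Sum>y\<in>S. p t x y) = 1"
  using tf by (auto simp: transition_function_def)

lemma tf_le_1: "t \<ge> 0 \<Longrightarrow> x \<in> S \<Longrightarrow> y \<in> S \<Longrightarrow> p t x y \<le> 1"
  using member_le_sum[of y S "p t x"] tf_nonneg[of t x] tf_sum[of t x] fin by auto

lemma semi_0: "x \<in> S \<Longrightarrow> semi S p 0 f x = f x"
proof -
  assume x: "x \<in> S"
  have "semi S p 0 f x = (\<Sum>y\<in>S. if x = y then f y else 0)"
    unfolding semi_def using tf x by (intro sum.cong) (auto simp: transition_function_def)
  then show ?thesis using x fin by simp
qed

lemma semi_add:
  assumes "s \<ge> 0" "t \<ge> 0" "x \<in> S"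
  shows "semi S p (s + t) f x = semi S p s (semi S p t f) x"
proof -
  have "semi S p (s + t) f x = (\<Sum>y\<in>S. (\<Sum>z\<in>S. p s x z * p t z y) * f y)"
    unfolding semi_def using tf assms by (intro sum.cong) (auto simp: transition_function_def)
  also have "\<dots> = (\<Sum>z\<in>S. \<Sum>y\<in>S. p s x z * p t z y * f y)"
    by (subst sum.swap) (simp add: sum_distrib_right)
  finally show ?thesis by (simp add: semi_def sum_distrib_left mult.assoc)
qed

lemma semi_diff: "semi S p t (\<lambda>y. f y - g y) x = semi S p t f x - semi S p t g x"
  by (simp add: semi_def algebra_simps sum_subtractf)

lemma semi_scale: "semi S p t (\<lambda>y. f y / c) x = semi S p t f x / c"
  by (simp add: semi_def sum_divide_distrib)

lemma semi_bound:
  assumes "t \<ge> 0" "x \<in> S" shows "\<bar>semi S p t f x\<bar> \<le> (\<Sum>y\<in>S. \<bar>f y\<bar>)"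
proof -
  have "\<bar>semi S p t f x\<bar> \<le> (\<Sum>y\<in>S. \<bar>p t x y * f y\<bar>)" unfolding semi_def by (rule sum_abs)
  also have "\<dots> \<le> (\<Sum>y\<in>S. \<bar>f y\<bar>)"
    using tf_nonneg tf_le_1 assms by (intro sum_mono) (auto simp: abs_mult intro!: mult_left_le_one_le)
  finally show ?thesis .
qed

lemma gen_limit: "x \<in> S \<Longrightarrow> ((\<lambda>t. (semi S p t f x - f x) / t) \<longlongrightarrow> L f x) (at_right 0)"
  using gn by (auto simp: has_generator_def semi_def)

lemma semi_tendsto_0: 
  assumes "x \<in> S" shows "((\<lambda>t. semi S p t f x) \<longlongrightarrow> f x) (at_right 0)"
proof -
  have "((\<lambda>t. (semi S p t f x - f x) / t * t + f x) \<longlongrightarrow> L f x * 0 + f x) (at_right 0)"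
    by (intro tendsto_intros gen_limit assms)
  moreover have "\<forall>\<^sub>F t in at_right 0. (semi S p t f x - f x) / t * t + f x = semi S p t f x"
    by (auto simp: eventually_at_filter)
  ultimately show ?thesis by (simp add: tendsto_cong)
qed

text \<open>The generator is given only as a right derivative at time 0, so left limits have to come
  from the semigroup identity: \<open>P_t f - P_(t-h) f = P_(t-h) (P_h f - f)\<close>, and
  \<open>P_(t-h)\<close> is bounded uniformly in \<open>h\<close>.\<close>

lemma semi_left_tendsto:
  assumes "t > 0" "x \<in> S" shows "((\<lambda>h. semi S p (t - h) f x) \<longlongrightarrow> semi S p t f x) (at_right 0)"
proof (rule Lim_transform2)
  have "((\<lambda>h. \<Sum>y\<in>S. \<bar>semi S p h f y - f y\<bar>) \<longlongrightarrow> (\<Sum>y\<in>S. \<bar>f y - f y\<bar>)) (at_right 0)"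
    by (intro tendsto_intros semi_tendsto_0)
  then have lim: "((\<lambda>h. \<Sum>y\<in>S. \<bar>semi S p h f y - f y\<bar>) \<longlongrightarrow> 0) (at_right 0)" by simp
  have "\<forall>\<^sub>F h in at_right 0. h < t" "\<forall>\<^sub>F h::real in at_right 0. h > 0"
    using assms by (auto simp: eventually_at_right_less eventually_at_right[of 0 t] intro: exI[of _ t])
  then have "\<forall>\<^sub>F h in at_right 0. norm (semi S p t f x - semi S p (t - h) f x)
     \<le> (\<Sum>y\<in>S. \<bar>semi S p h f y - f y\<bar>)"
  proof eventually_elim
    case (elim h)
    then have "semi S p t f x - semi S p (t - h) f x = semi S p (t - h) (\<lambda>y. semi S p h f y - f y) x"
      using semi_add[of "t - h" h x f] assms by (simp add: semi_diff[of _ "semi S p h f"])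
    then show ?case using semi_bound[of "t - h" x] elim assms by simp
  qed
  then show "((\<lambda>h. semi S p t f x - semi S p (t - h) f x) \<longlongrightarrow> 0) (at_right 0)"
    by (rule Lim_null_comparison[OF _ lim])
qed simp

lemma semi_right_quotient:
  assumes "t \<ge> 0" "x \<in> S"
  shows "((\<lambda>h. (semi S p (t + h) f x - semi S p t f x) / h) \<longlongrightarrow> semi S p t (L f) x) (at_right 0)"
proof (rule Lim_transform_eventually)
  show "((\<lambda>h. semi S p t (\<lambda>y. (semi S p h f y - f y) / h) x) \<longlongrightarrow> semi S p t (L f) x) (at_right 0)"
    unfolding semi_def[of S p t] by (intro tendsto_intros gen_limit)
  have "\<forall>\<^sub>F h::real in at_right 0. h > 0" by (simp add: eventually_at_right_less)
  then show "\<forall>\<^sub>F h in at_right 0. semi S p t (\<lambda>y. (semi S p h f y - f y) / h) x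
      = (semi S p (t + h) f x - semi S p t f x) / h"
    by eventually_elim (simp add: semi_scale semi_diff[of _ "semi S p _ f"] semi_add assms)
qed

text \<open>Since \<open>P_h P_t = P_t P_h\<close>, both sides are limits of the same difference
  quotient.\<close>

lemma gen_semi_commute:
  assumes "t \<ge> 0" "x \<in> S"
  shows "L (semi S p t f) x = semi S p t (L f) x"
proof (rule tendsto_unique[OF _ _ semi_right_quotient[OF assms]])
  have "\<forall>\<^sub>F h::real in at_right 0. h > 0" by (simp add: eventually_at_right_less)
  then have "\<forall>\<^sub>F h in at_right 0. (semi S p h (semi S p t f) x - semi S p t f x) / h
      = (semi S p (t + h) f x - semi S p t f x) / h"
    by eventually_elim (use assms semi_add[of _ t x f] in \<open>simp add: add.commute\<close>)
  then show "((\<lambda>h. (semi S p (t + h) f x - semi S p t f x) / h) \<longlongrightarrow> L (semi S p t f) x) (at_right 0)"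
    by (rule Lim_transform_eventually[OF gen_limit[OF assms(2)]])
qed simp

text \<open>Kolmogorov's equation as a two-sided derivative. The left quotient at \<open>t\<close>
  is \<open>P_(t-h)\<close> applied to \<open>(P_h f - f) / h\<close>, and both the kernel and its
  argument converge as \<open>h\<close> tends to 0.\<close>

lemma semi_has_derivative:
  assumes t: "t > 0" and x: "x \<in> S"
  shows "((\<lambda>t. semi S p t f x) has_real_derivative L (semi S p t f) x) (at t)"
proof -
  define D where "D = semi S p t (L f) x"
  have "((\<lambda>h. (semi S p (t + h) f x - semi S p t f x) / h) \<longlongrightarrow> D) (at_right 0)"
    unfolding D_def using t x by (intro semi_right_quotient) auto
  moreover have "((\<lambda>h. (semi S p (t + - h) f x - semi S p t f x) / - h) \<longlongrightarrow> D) (at_right 0)"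
  proof (rule Lim_transform_eventually)
    \<comment> \<open>A kernel entry is the semigroup applied to an indicator, which transfers left
      continuity from \<open>semi\<close> to \<open>p\<close>; the limit can then be taken inside
      the finite sum.\<close>
    have eq: "p s x y = semi S p s (\<lambda>z. of_bool (z = y)) x" if "y \<in> S" for s y
    proof -
      have "semi S p s (\<lambda>z. of_bool (z = y)) x = (\<Sum>z\<in>S. if z = y then p s x z else 0)"
        unfolding semi_def by (intro sum.cong) auto
      then show ?thesis using that fin by simp
    qed
    have pl: "((\<lambda>h. p (t - h) x y) \<longlongrightarrow> p t x y) (at_right 0)" if "y \<in> S" for y
      using semi_left_tendsto[OF t x] by (simp add: eq[OF that])
    show "((\<lambda>h. semi S p (t - h) (\<lambda>y. (semi S p h f y - f y) / h) x) \<longlongrightarrow> D) (at_right 0)"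
      unfolding D_def semi_def[of S p t] semi_def[of S p "t - _"]
      by (intro tendsto_intros gen_limit pl)
    have "\<forall>\<^sub>F h in at_right 0. h < t" "\<forall>\<^sub>F h::real in at_right 0. h > 0"
      using assms by (auto simp: eventually_at_right_less eventually_at_right[of 0 t] intro: exI[of _ t])
    then show "\<forall>\<^sub>F h in at_right 0. semi S p (t - h) (\<lambda>y. (semi S p h f y - f y) / h) x
      = (semi S p (t + - h) f x - semi S p t f x) / - h"
    proof eventually_elim
      case (elim h)
      have "semi S p t f x = semi S p (t - h) (semi S p h f) x"
        using semi_add[of "t - h" h x f] elim x by simp
      then show ?case using elim by (simp add: semi_scale semi_diff[of _ "semi S p h f"] field_simps)
    qed
  qed
  ultimately have "((\<lambda>h. (semi S p (t + h) f x - semi S p t f x) / h) \<longlongrightarrow> D) (at 0)"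
    by (intro filterlim_split_at) (simp_all add: filterlim_at_left_to_right)
  then show ?thesis using gen_semi_commute[of t x f] t x by (simp add: DERIV_def D_def)
qed

text \<open>Gronwall's argument: \<open>exp (- 2 E s)\<close> times the squared norm is
  nonincreasing, because the norm has derivative \<open>2 <P_s f, L P_s f>\<close>. The weight
  \<open>\<nu>\<close> of the application is not invariant, so the exponential factor takes the
  place of contraction.\<close>

lemma semi_L2_growth:
  fixes \<nu> :: "'s \<Rightarrow> real"
  assumes form: "\<And>g. (\<Sum>x\<in>S. \<nu> x * (g x * L g x)) \<le> E * (\<Sum>x\<in>S. \<nu> x * (g x)\<^sup>2)"
    and t: "t \<ge> 0"
  shows "(\<Sum>x\<in>S. \<nu> x * (semi S p t f x)\<^sup>2) \<le> exp (2 * E * t) * (\<Sum>x\<in>S. \<nu> x * (f x)\<^sup>2)"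
proof (cases "t = 0")
  case True then show ?thesis by (simp add: semi_0 cong: sum.cong)
next
  case False
  define N where "N s = (\<Sum>x\<in>S. \<nu> x * (semi S p s f x)\<^sup>2)" for s
  define G where "G s = exp (- 2 * E * s) * N s" for s
  have dN: "(N has_real_derivative (\<Sum>x\<in>S. \<nu> x * (2 * (semi S p s f x * L (semi S p s f) x)))) (at s)"
    if "s > 0" for s unfolding N_def
    by (auto intro!: derivative_eq_intros sum.cong semi_has_derivative that)
  \<comment> \<open>The derivative is available at positive times only; continuity at 0 comes from
    the right limit of the semigroup.\<close>
  have cN: "((\<lambda>s. N s) \<longlongrightarrow> N 0) (at 0 within {0..t})"
  proof -
    have "((\<lambda>s. N s) \<longlongrightarrow> (\<Sum>x\<in>S. \<nu> x * (f x)\<^sup>2)) (at_right 0)"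
      unfolding N_def by (intro tendsto_intros semi_tendsto_0)
    moreover have "N 0 = (\<Sum>x\<in>S. \<nu> x * (f x)\<^sup>2)" by (simp add: N_def semi_0 cong: sum.cong)
    moreover have "at 0 within {0..t} = at_right 0"
      using False t by (intro at_within_Icc_at_right) auto
    ultimately show ?thesis by metis
  qed
  have contN: "continuous_on {0..t} N"
    unfolding continuous_on_def
  proof
    fix s assume "s \<in> {0..t}"
    show "(N \<longlongrightarrow> N s) (at s within {0..t})"
    proof (cases "s = 0")
      case True then show ?thesis using cN by simp
    next
      case False
      then have "isCont N s" using DERIV_isCont[OF dN] \<open>s \<in> {0..t}\<close> by auto
      then show ?thesis by (simp add: isCont_def tendsto_within_subset[where S = UNIV])
    qed
  qed
  have "G t \<le> G 0"
  proof (rule DERIV_nonpos_imp_decreasing_open[where f = G and a = 0 and b = t])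
    show "0 \<le> t" using t by simp
    show "continuous_on {0..t} G" unfolding G_def by (intro continuous_intros contN)
    fix s assume s: "0 < s" "s < t"
    let ?I = "\<Sum>x\<in>S. \<nu> x * (2 * (semi S p s f x * L (semi S p s f) x))"
    have "?I = 2 * (\<Sum>x\<in>S. \<nu> x * (semi S p s f x * L (semi S p s f) x))"
      by (simp add: sum_distrib_left mult_ac)
    then have "?I \<le> 2 * E * N s" using form[of "semi S p s f"] by (simp add: N_def)
    moreover have "(G has_real_derivative exp (- 2 * E * s) * (?I - 2 * E * N s)) (at s)"
      unfolding G_def by (rule derivative_eq_intros refl dN s)+ (simp add: algebra_simps)
    ultimately show "\<exists>y. (G has_real_derivative y) (at s) \<and> y \<le> 0"
      by (intro exI[of _ "exp (- 2 * E * s) * (?I - 2 * E * N s)"]) (simp add: mult_nonneg_nonpos)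
  qed
  then have "exp (2 * E * t) * (exp (- 2 * E * t) * N t) \<le> exp (2 * E * t) * N 0"
    by (simp add: G_def)
  moreover have "exp (2 * E * t) * (exp (- 2 * E * t) * N t) = N t"
    by (simp add: mult.assoc[symmetric] exp_add[symmetric])
  ultimately have "N t \<le> exp (2 * E * t) * N 0" by metis
  then show ?thesis by (simp add: N_def semi_0 cong: sum.cong)
qed

end

section \<open>Exponential tails of additive functionals\<close>

lemma space_path_space: "space (path_space T S) = cadlag_paths T S"
  by (auto simp: path_space_def space_restrict_space space_PiM cadlag_paths_def)

lemma measurable_path_eval:
  assumes "sets P = sets (path_space T S)" "t \<in> {0..T}"
  shows "(\<lambda>w. w t) \<in> P \<rightarrow>\<^sub>M count_space S"
proof -
  have "(\<lambda>w. w t) \<in> path_space T S \<rightarrow>\<^sub>M count_space S"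
    unfolding path_space_def
    by (intro measurable_restrict_space1 measurable_component_singleton assms)
  then show ?thesis using measurable_cong_sets[OF assms(1) refl] by blast
qed

text \<open>The finite-dimensional law at the two times 0 and \<open>t\<close>, summed over the
  state at time 0. The times in \<open>markov_law\<close> increase strictly, which is why
  \<open>t\<close> is positive here.\<close>

lemma markov_law_marginal:
  assumes ml: "markov_law T S L \<nu> P" and fin: "finite S" and T: "T > 0"
  obtains p where "transition_function S p" "has_generator S p L"
    "\<And>t y. 0 < t \<Longrightarrow> t \<le> T \<Longrightarrow> y \<in> S \<Longrightarrow>
       measure P {w \<in> space P. w t = y} = (\<Sum>x\<in>S. pmf \<nu> x * p t x y)"
proof -
  from ml obtain p where p: "transition_function S p" "has_generator S p L" and fdd:
     "\<And>(k::nat) (t::nat \<Rightarrow> real) (x::nat \<Rightarrow> _).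
          t 0 = 0 \<and> (\<forall>i<k. t i < t (Suc i)) \<and> t k \<le> T \<and> (\<forall>i\<le>k. x i \<in> S) \<longrightarrow>
          measure P {w \<in> space P. \<forall>i\<le>k. w (t i) = x i} =
            pmf \<nu> (x 0) * (\<Prod>i<k. p (t (Suc i) - t i) (x i) (x (Suc i)))"
    unfolding markov_law_def by blast
  have "prob_space P" and sets: "sets P = sets (path_space T S)"
    using ml by (auto simp: markov_law_def)
  interpret prob_space P by fact
  have sp: "space P = cadlag_paths T S"
    using sets_eq_imp_space_eq[OF sets] by (simp add: space_path_space)
  show ?thesis
  proof (rule that[OF p])
    fix t y assume t: "0 < t" "t \<le> T" and y: "y \<in> S"
    have joint: "measure P {w \<in> space P. w 0 = x \<and> w t = y} = pmf \<nu> x * p t x y" if "x \<in> S" for x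
    proof -
      have "{w \<in> space P. \<forall>i\<le>1. w ((\<lambda>i. if i = (0::nat) then 0 else t) i) = (\<lambda>i. if i = (0::nat) then x else y) i}
        = {w \<in> space P. w 0 = x \<and> w t = y}"
        by (auto simp: le_Suc_eq)
      then show ?thesis
        using fdd[of "\<lambda>i. if i = (0::nat) then 0 else t" 1 "\<lambda>i. if i = (0::nat) then x else y"] t y that
        by simp
    qed
    have me: "{w \<in> space P. w 0 = x \<and> w t = y} \<in> events" if "x \<in> S" for x
    proof -
      have "{w \<in> space P. w s = z} \<in> events" if "s \<in> {0..T}" "z \<in> S" for s z
      proof -
        have "(\<lambda>w. w s) -` {z} \<inter> space P \<in> events"
          by (rule measurable_sets[OF measurable_path_eval[OF sets that(1)]]) (use that in auto)
        moreover have "(\<lambda>w. w s) -` {z} \<inter> space P = {w \<in> space P. w s = z}" by auto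
        ultimately show ?thesis by simp
      qed
      from this[of 0 x] this[of t y] show ?thesis using t y that
        by (simp add: Collect_conj_eq[symmetric] sets.sets_Collect_conj)
    qed
    have "{w \<in> space P. w t = y} = (\<Union>x\<in>S. {w \<in> space P. w 0 = x \<and> w t = y})"
      using T by (auto simp: sp cadlag_paths_def PiE_def Pi_def)
    also have "measure P \<dots> = (\<Sum>x\<in>S. measure P {w \<in> space P. w 0 = x \<and> w t = y})"
      by (rule finite_measure_finite_Union[OF fin]) (use me in \<open>auto simp: disjoint_family_on_def\<close>)
    finally show "measure P {w \<in> space P. w t = y} = (\<Sum>x\<in>S. pmf \<nu> x * p t x y)"
      by (simp add: joint)
  qed
qed

text \<open>The time-\<open>t\<close> law has density \<open>P\<^sub>t\<^sup>* 1\<close> with respect to \<open>\<nu>\<close>, so exponential moments at time \<open>t\<close>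
  are controlled by those under \<open>\<nu>\<close> as soon as the \<open>L\<^sup>2(\<nu>)\<close>-norm of the semigroup is.\<close>

lemma markov_law_expectation_le:
  assumes ml: "markov_law T S L \<nu> P" and fin: "finite S" and T: "T > 0"
    and form: "\<And>g. (\<Sum>x\<in>S. pmf \<nu> x * (g x * L g x)) \<le> E * (\<Sum>x\<in>S. pmf \<nu> x * (g x)\<^sup>2)"
    and E: "E \<ge> 0"
    and t: "0 < t" "t \<le> T"
  shows "(\<integral>w. f (w t) \<partial>P) \<le> exp (E * T) * sqrt (\<Sum>x\<in>S. pmf \<nu> x * (f x)\<^sup>2)"
proof -
  obtain p where p: "transition_function S p" "has_generator S p L"
    "\<And>t y. 0 < t \<Longrightarrow> t \<le> T \<Longrightarrow> y \<in> S \<Longrightarrow>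
       measure P {w \<in> space P. w t = y} = (\<Sum>x\<in>S. pmf \<nu> x * p t x y)"
    using markov_law_marginal[OF ml fin T] by blast
  have "prob_space P" and sets: "sets P = sets (path_space T S)"
    using ml by (auto simp: markov_law_def)
  interpret prob_space P by fact
  have sp: "space P = cadlag_paths T S"
    using sets_eq_imp_space_eq[OF sets] by (simp add: space_path_space)
  have inS: "w t \<in> S" if "w \<in> space P" for w
    using that t by (auto simp: sp cadlag_paths_def PiE_def Pi_def)
  have meas: "{w \<in> space P. w t = y} \<in> events" if "y \<in> S" for y
  proof -
    have "(\<lambda>w. w t) -` {y} \<inter> space P \<in> events"
      by (rule measurable_sets[OF measurable_path_eval[OF sets]]) (use that t in auto)
    moreover have "(\<lambda>w. w t) -` {y} \<inter> space P = {w \<in> space P. w t = y}" by auto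
    ultimately show ?thesis by simp
  qed
  have "(\<integral>w. f (w t) \<partial>P) = (\<integral>w. (\<Sum>y\<in>S. f y * indicator {w \<in> space P. w t = y} w) \<partial>P)"
  proof (rule Bochner_Integration.integral_cong[OF refl])
    fix w assume w: "w \<in> space P"
    have "(\<Sum>y\<in>S. f y * indicator {w \<in> space P. w t = y} w) = (\<Sum>y\<in>S. if w t = y then f y else 0)"
      using w by (intro sum.cong) (auto simp: indicator_def)
    then show "f (w t) = (\<Sum>y\<in>S. f y * indicator {w \<in> space P. w t = y} w)"
      using fin inS[OF w] by simp
  qed
  also have "\<dots> = (\<Sum>y\<in>S. f y * measure P {w \<in> space P. w t = y})"
    using meas by (subst Bochner_Integration.integral_sum) (auto simp: Int_absorb1 less_top[symmetric])
  also have "\<dots> = (\<Sum>y\<in>S. \<Sum>x\<in>S. pmf \<nu> x * (p t x y * f y))"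
    using p(3) t by (intro sum.cong) (auto simp: sum_distrib_left mult_ac)
  also have "\<dots> = (\<Sum>x\<in>S. pmf \<nu> x * semi S p t f x)"
    by (subst sum.swap) (simp add: semi_def sum_distrib_left)
  finally have eq: "(\<integral>w. f (w t) \<partial>P) = (\<Sum>x\<in>S. pmf \<nu> x * semi S p t f x)" .
  also have "\<dots> = (\<Sum>x\<in>S. sqrt (pmf \<nu> x) * (sqrt (pmf \<nu> x) * semi S p t f x))"
    by (simp add: mult.assoc[symmetric])
  also have "\<dots> \<le> sqrt ((\<Sum>x\<in>S. (sqrt (pmf \<nu> x))\<^sup>2) * (\<Sum>x\<in>S. (sqrt (pmf \<nu> x) * semi S p t f x)\<^sup>2))"
    by (rule real_le_rsqrt[OF Cauchy_Schwarz_ineq_sum])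
  also have "\<dots> = sqrt ((\<Sum>x\<in>S. pmf \<nu> x) * (\<Sum>x\<in>S. pmf \<nu> x * (semi S p t f x)\<^sup>2))"
    by (simp add: power_mult_distrib)
  also have "\<dots> \<le> sqrt (1 * (exp (2 * E * t) * (\<Sum>x\<in>S. pmf \<nu> x * (f x)\<^sup>2)))"
  proof (intro real_sqrt_le_mono mult_mono)
    show "(\<Sum>x\<in>S. pmf \<nu> x) \<le> 1"
      using measure_measure_pmf_finite[OF fin, of \<nu>] measure_pmf.prob_le_1[of \<nu> S] by simp
    show "(\<Sum>x\<in>S. pmf \<nu> x * (semi S p t f x)\<^sup>2) \<le> exp (2 * E * t) * (\<Sum>x\<in>S. pmf \<nu> x * (f x)\<^sup>2)"
      using t by (intro semi_L2_growth[OF fin p(1,2) form]) auto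
  qed (auto intro!: sum_nonneg)
  also have "\<dots> = exp (E * t) * sqrt (\<Sum>x\<in>S. pmf \<nu> x * (f x)\<^sup>2)"
  proof -
    have "exp (2 * E * t) = (exp (E * t))\<^sup>2" by (simp add: exp_double[symmetric] mult.assoc)
    then show ?thesis by (simp add: real_sqrt_mult)
  qed
  also have "\<dots> \<le> exp (E * T) * sqrt (\<Sum>x\<in>S. pmf \<nu> x * (f x)\<^sup>2)"
    using t E by (intro mult_right_mono) (auto intro!: mult_left_mono sum_nonneg)
  finally show ?thesis .
qed

text \<open>Paths are only right continuous, so the sums use right end points: the node belonging to
  \<open>s\<close> lies strictly to the right of \<open>s\<close> and tends to \<open>s\<close>,
  which gives pointwise convergence of the step functions, and they are dominated. Right end points
  also avoid time 0, where the estimate of the expectation is not stated.\<close>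

lemma right_riemann_sums:
  fixes f :: "real \<Rightarrow> real"
  assumes T: "T > 0" and rc: "\<And>t. 0 \<le> t \<Longrightarrow> t < T \<Longrightarrow> (f \<longlongrightarrow> f t) (at_right t)"
    and bd: "\<And>t. t \<in> {0..T} \<Longrightarrow> \<bar>f t\<bar> \<le> C"
  shows "set_integrable lborel {0..T} f"
    and "(\<lambda>m. T / real (Suc m) * (\<Sum>i<Suc m. f (T * real (Suc i) / real (Suc m))))
           \<longlonglongrightarrow> (LINT s:{0..T}|lborel. f s)"
proof -
  define I where "I m i = {T * real i / real (Suc m)..<T * real (Suc i) / real (Suc m)}" for m i
  define g where "g m s = (\<Sum>i<Suc m. f (T * real (Suc i) / real (Suc m)) * indicator (I m i) s)" for m s
  \<comment> \<open>Right continuity is assumed only before \<open>T\<close>, so the end point is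
    cut off; \<open>split\<close> puts it back as a null set.\<close>
  define F where "F s = indicator {0..<T} s * f s" for s
  have Isub: "s \<in> {0..<T}" if "s \<in> I m i" "i < Suc m" for s m i
  proof -
    have "0 \<le> T * real i / real (Suc m)" using T by simp
    moreover have "T * real (Suc i) / real (Suc m) \<le> T"
      using that T by (simp add: divide_le_eq)
    ultimately show ?thesis using that by (auto simp: I_def)
  qed
  have Iiff: "s \<in> I m i \<longleftrightarrow> real i \<le> s * real (Suc m) / T \<and> s * real (Suc m) / T < real i + 1" for s m i
  proof -
    define N where "N = real (Suc m)"
    have N: "N > 0" by (simp add: N_def)
    have "T * real i / N \<le> s \<longleftrightarrow> real i \<le> s * N / T" "s < T * real (Suc i) / N \<longleftrightarrow> s * N / T < real (Suc i)"
      using T N by (simp_all add: pos_divide_le_eq pos_le_divide_eq pos_divide_less_eq pos_less_divide_eq mult.commute)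
    then show ?thesis by (simp add: I_def N_def[symmetric] add.commute del: of_nat_Suc) (simp add: add.commute)
  qed
  have gval: "\<exists>\<sigma>. s < \<sigma> \<and> \<sigma> \<le> T \<and> \<sigma> \<le> s + T / real (Suc m) \<and> g m s = f \<sigma>" if s: "0 \<le> s" "s < T" for s m
  proof -
    define k where "k = nat \<lfloor>s * real (Suc m) / T\<rfloor>"
    have nn: "0 \<le> s * real (Suc m) / T" using s T by simp
    then have k1: "real k \<le> s * real (Suc m) / T" and k2: "s * real (Suc m) / T < real k + 1"
      unfolding k_def by linarith+
    have "s * real (Suc m) < T * real (Suc m)" using s by simp
    then have "s * real (Suc m) / T < real (Suc m)" using T by (simp only: pos_divide_less_eq mult.commute)
    then have km: "k < Suc m" using k1 by linarith
    have kI: "s \<in> I m k" unfolding Iiff using k1 k2 by (rule conjI)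
    have uniq: "i = k" if "s \<in> I m i" for i
    proof -
      have "real i \<le> s * real (Suc m) / T" "s * real (Suc m) / T < real i + 1"
        using that unfolding Iiff by blast+
      then have "real i < real (Suc k)" "real k < real (Suc i)" using k1 k2 by linarith+
      then show ?thesis by (simp only: of_nat_less_iff)
    qed
    have ind: "indicator (I m i) s = (of_bool (i = k) :: real)" for i
      using kI uniq[of i] by (cases "i = k") (auto simp: indicator_def)
    have "g m s = (\<Sum>i<Suc m. if i = k then f (T * real (Suc i) / real (Suc m)) else 0)"
      unfolding g_def ind by (intro sum.cong) auto
    also have "\<dots> = f (T * real (Suc k) / real (Suc m))" using km by simp
    finally have "g m s = f (T * real (Suc k) / real (Suc m))" .
    moreover have "T * real (Suc k) / real (Suc m) \<le> T" using km T by (simp add: divide_le_eq)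
    moreover have "T * real (Suc k) / real (Suc m) \<le> s + T / real (Suc m)"
    proof -
      have "T * real (Suc k) / real (Suc m) = T * real k / real (Suc m) + T / real (Suc m)"
        by (simp add: add_divide_distrib[symmetric] algebra_simps)
      then show ?thesis using kI by (auto simp: I_def)
    qed
    ultimately show ?thesis using kI by (auto simp: I_def)
  qed
  have gout: "g m s = 0" if "s \<notin> {0..<T}" for m s
    unfolding g_def using Isub that by (intro sum.neutral) (auto simp: indicator_def)
  have C0: "0 \<le> C" using bd[of 0] T by auto
  have lim: "(\<lambda>m. g m s) \<longlonglongrightarrow> F s" for s
  proof (cases "s \<in> {0..<T}")
    case False then show ?thesis using gout by (simp add: F_def)
  next
    case True
    then have "\<exists>\<sigma>. \<forall>m. s < \<sigma> m \<and> \<sigma> m \<le> T \<and> \<sigma> m \<le> s + T / real (Suc m) \<and> g m s = f (\<sigma> m)"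
      using gval[of s] by (intro choice) auto
    then obtain \<sigma> where \<sigma>: "\<And>m. s < \<sigma> m" "\<And>m. \<sigma> m \<le> s + T / real (Suc m)" "\<And>m. g m s = f (\<sigma> m)"
      by blast
    have "(\<lambda>m. T * inverse (real (Suc m))) \<longlonglongrightarrow> T * 0"
      by (intro tendsto_intros LIMSEQ_inverse_real_of_nat)
    then have "(\<lambda>m. s + T / real (Suc m)) \<longlonglongrightarrow> s + 0"
      by (intro tendsto_intros) (simp add: divide_inverse)
    then have "\<sigma> \<longlonglongrightarrow> s"
      using \<sigma>(1,2) by (intro tendsto_sandwich[of "\<lambda>_. s" \<sigma> sequentially "\<lambda>m. s + T / real (Suc m)"])
        (auto simp: less_imp_le)
    then have \<sigma>_lim: "filterlim \<sigma> (at_right s) sequentially"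
      by (rule tendsto_imp_filterlim_at_right) (intro always_eventually allI \<sigma>(1))
    have "(f \<longlongrightarrow> f s) (at_right s)" using True by (intro rc) simp_all
    then have "(\<lambda>m. f (\<sigma> m)) \<longlonglongrightarrow> f s" by (rule filterlim_compose[OF _ \<sigma>_lim])
    then have "(\<lambda>m. g m s) \<longlonglongrightarrow> f s" by (simp only: \<sigma>(3))
    then show ?thesis using True by (simp add: F_def)
  qed
  have gm: "g m \<in> borel_measurable lborel" for m
    unfolding g_def I_def by measurable
  have Fm: "F \<in> borel_measurable lborel"
    by (rule borel_measurable_LIMSEQ_real[OF lim gm])
  have dom: "norm (g m s) \<le> C * indicator {0..<T} s" for m s
  proof (cases "s \<in> {0..<T}")
    case False then show ?thesis using gout by simp
  next
    case True
    then show ?thesis using gval[of s m] bd by auto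
  qed
  have wint: "integrable lborel (\<lambda>s. C * indicator {0..<T} s :: real)"
    by (intro integrable_mult_right integrable_real_indicator) (use T in \<open>auto simp: emeasure_lborel_Ico\<close>)
  have Fint: "integrable lborel F"
    by (rule integrable_dominated_convergence[where s = g, OF Fm gm wint]) (use lim dom in auto)
  have conv: "(\<lambda>m. integral\<^sup>L lborel (g m)) \<longlonglongrightarrow> integral\<^sup>L lborel F"
    by (rule integral_dominated_convergence[where s = g, OF Fm gm wint]) (use lim dom in auto)
  have gint: "integral\<^sup>L lborel (g m) = T / real (Suc m) * (\<Sum>i<Suc m. f (T * real (Suc i) / real (Suc m)))" for m
  proof -
    have le: "T * real i / real (Suc m) \<le> T * real (Suc i) / real (Suc m)" for i
      using T by (intro divide_right_mono mult_left_mono) auto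
    have "integral\<^sup>L lborel (g m) = (\<Sum>i<Suc m. f (T * real (Suc i) / real (Suc m)) * measure lborel (I m i))"
      unfolding g_def using le
      by (subst Bochner_Integration.integral_sum)
         (auto simp: I_def intro!: integrable_mult_right integrable_real_indicator)
    also have "\<dots> = (\<Sum>i<Suc m. f (T * real (Suc i) / real (Suc m)) * (T / real (Suc m)))"
    proof (intro sum.cong refl arg_cong2[of _ _ _ _ "(*)"])
      fix i
      have "measure lborel (I m i) = T * real (Suc i) / real (Suc m) - T * real i / real (Suc m)"
        using le[of i] unfolding I_def by simp
      also have "\<dots> = T / real (Suc m)"
        unfolding diff_divide_distrib[symmetric] by (simp add: algebra_simps)
      finally show "measure lborel (I m i) = T / real (Suc m)" .
    qed
    finally show ?thesis by (simp only: sum_distrib_left mult.commute)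
  qed
  have split: "indicator {0..T} s * f s = F s + f T * indicator {T} s" for s
    using T by (auto simp: F_def indicator_def)
  have int1: "integrable lborel (\<lambda>s. f T * indicator {T} s)"
    by (intro integrable_mult_right integrable_real_indicator) auto
  show "set_integrable lborel {0..T} f"
    unfolding set_integrable_def real_scaleR_def split by (intro Bochner_Integration.integrable_add Fint int1)
  have "(LINT s:{0..T}|lborel. f s) = integral\<^sup>L lborel F"
    unfolding set_lebesgue_integral_def real_scaleR_def split
    by (subst Bochner_Integration.integral_add[OF Fint int1]) simp
  then show "(\<lambda>m. T / real (Suc m) * (\<Sum>i<Suc m. f (T * real (Suc i) / real (Suc m))))
           \<longlonglongrightarrow> (LINT s:{0..T}|lborel. f s)"
    using conv gint by simp
qed

lemma exp_average_le:
  fixes c :: "nat \<Rightarrow> real"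
  shows "exp ((\<Sum>i<Suc m. c i) / real (Suc m)) \<le> (\<Sum>i<Suc m. exp (c i)) / real (Suc m)"
proof -
  have "exp (\<Sum>i<Suc m. (1 / real (Suc m)) *\<^sub>R c i) \<le> (\<Sum>i<Suc m. (1 / real (Suc m)) * exp (c i))"
    by (rule convex_on_sum[OF _ _ exp_convex]) auto
  then show ?thesis by (simp add: sum_divide_distrib del: sum.lessThan_Suc of_nat_Suc)
qed

text \<open>If the limit exceeds the level strictly, then so do all late approximations; the events
  \<open>D N\<close> increase and exhaust. The claim is made for an arbitrary subset
  \<open>A\<close>, so that measurability of the event with the supremum never has to be
  shown.\<close>

lemma (in prob_space) measure_limit_gt_le:
  assumes R: "\<And>m. random_variable borel (R m)"
    and lim: "\<And>w. w \<in> space M \<Longrightarrow> (\<lambda>m. R m w) \<longlonglongrightarrow> Z w"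
    and bd: "\<And>m. prob {w \<in> space M. R m w > \<epsilon>} \<le> B"
    and A: "A \<subseteq> {w \<in> space M. Z w > (\<epsilon>::real)}"
  shows "prob A \<le> B"
proof -
  define D where "D N = {w \<in> space M. \<forall>m\<ge>N. R m w > \<epsilon>}" for N
  note [measurable] = R
  have D: "D N \<in> events" for N
    unfolding D_def by measurable
  have "A \<subseteq> (\<Union>N. D N)"
  proof
    fix w assume "w \<in> A"
    then have w: "w \<in> space M" "Z w > \<epsilon>" using A by auto
    have "\<forall>\<^sub>F m in sequentially. R m w > \<epsilon>" using order_tendstoD(1)[OF lim[OF w(1)] w(2)] .
    then show "w \<in> (\<Union>N. D N)" using w by (auto simp: D_def eventually_sequentially)
  qed
  then have "prob A \<le> prob (\<Union>N. D N)" using D by (intro finite_measure_mono) auto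
  also have "\<dots> \<le> B"
  proof (rule LIMSEQ_le_const2)
    show "(\<lambda>N. prob (D N)) \<longlonglongrightarrow> prob (\<Union>N. D N)"
      using D by (intro finite_Lim_measure_incseq) (auto simp: incseq_def D_def)
    have "prob (D N) \<le> B" for N
    proof -
      have "prob (D N) \<le> prob {w \<in> space M. R N w > \<epsilon>}"
        using R by (intro finite_measure_mono) (auto simp: D_def)
      then show ?thesis using bd[of N] by simp
    qed
    then show "\<exists>N. \<forall>n\<ge>N. prob (D n) \<le> B" by blast
  qed
  finally show ?thesis .
qed

text \<open>The factor \<open>T\<close> in \<open>mom\<close> comes from the Riemann weights:
  \<open>\<theta>\<close> times the sum \<open>R m\<close> is the average over the nodes of
  \<open>\<theta> * T * \<bar>X\<bar>\<close>, to which Jensen's inequality applies. The square in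
  \<open>mom\<close> and the root in the conclusion come from the weighted \<open>L2\<close> norm in
  the bound of the expectation.\<close>

lemma markov_law_time_integral_tail:
  fixes X :: "real \<Rightarrow> 's \<Rightarrow> real"
  assumes ml: "markov_law T S L \<nu> P" and fin: "finite S" and T: "T > 0"
    and form: "\<And>g. (\<Sum>x\<in>S. pmf \<nu> x * (g x * L g x)) \<le> E * (\<Sum>x\<in>S. pmf \<nu> x * (g x)\<^sup>2)"
    and E: "E \<ge> 0"
    and cont: "\<And>y. y \<in> S \<Longrightarrow> continuous_on {0..T} (\<lambda>s. X s y)"
    and \<theta>: "\<theta> > 0"
    and mom: "\<And>t. 0 < t \<Longrightarrow> t \<le> T \<Longrightarrow> (\<Sum>x\<in>S. pmf \<nu> x * (exp (\<theta> * T * \<bar>X t x\<bar>))\<^sup>2) \<le> B"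
  shows "measure P {w \<in> space P. (SUP t\<in>{0..T}. \<bar>LINT s:{0..t}|lborel. X s (w s)\<bar>) > \<epsilon>}
    \<le> exp (- (\<theta> * \<epsilon>)) * (exp (E * T) * sqrt B)"
proof -
  have "prob_space P" and sets: "sets P = sets (path_space T S)"
    using ml by (auto simp: markov_law_def)
  interpret prob_space P by fact
  have sp: "space P = cadlag_paths T S"
    using sets_eq_imp_space_eq[OF sets] by (simp add: space_path_space)
  have inS: "w t \<in> S" if "w \<in> space P" "t \<in> {0..T}" for w t
    using that by (auto simp: sp cadlag_paths_def PiE_def Pi_def)
  define tm where "tm m i = T * real (Suc i) / real (Suc m)" for m i
  have tm: "0 < tm m i" "tm m i \<le> T" if "i < Suc m" for m i
    using that T by (auto simp: tm_def divide_le_eq)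
  define R where "R m w = T / real (Suc m) * (\<Sum>i<Suc m. \<bar>X (tm m i) (w (tm m i))\<bar>)" for m w
  define Z where "Z w = (LINT s:{0..T}|lborel. \<bar>X s (w s)\<bar>)" for w
  have "\<exists>C. \<forall>s\<in>{0..T}. \<bar>X s y\<bar> \<le> C" if "y \<in> S" for y
  proof -
    have "compact ((\<lambda>s. X s y) ` {0..T})" by (intro compact_continuous_image cont that) auto
    then have "bounded ((\<lambda>s. X s y) ` {0..T})" by (rule compact_imp_bounded)
    then show ?thesis by (simp add: bounded_iff)
  qed
  then obtain C where C: "\<And>y s. y \<in> S \<Longrightarrow> s \<in> {0..T} \<Longrightarrow> \<bar>X s y\<bar> \<le> C y" by metis
  have bd: "\<bar>\<bar>X s (w s)\<bar>\<bar> \<le> (\<Sum>y\<in>S. C y)" if "w \<in> space P" "s \<in> {0..T}" for w s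
  proof -
    have "\<bar>X s (w s)\<bar> \<le> C (w s)" by (rule C[OF inS[OF that] that(2)])
    also have "\<dots> \<le> (\<Sum>y\<in>S. C y)"
    proof (rule member_le_sum[OF _ _ fin])
      have "0 \<in> {0..T}" using T by simp
      then show "0 \<le> C y" if "y \<in> S - {w s}" for y
        using order_trans[OF abs_ge_zero C[of y 0]] that by blast
    qed (rule inS[OF that])
    finally show ?thesis by simp
  qed
  \<comment> \<open>The path is constant on a right neighbourhood of \<open>t\<close>, so
    \<open>X s (w s)\<close> may be replaced there by \<open>X s (w t)\<close>, which is continuous
    in \<open>s\<close>.\<close>
  have rc: "((\<lambda>s. \<bar>X s (w s)\<bar>) \<longlongrightarrow> \<bar>X t (w t)\<bar>) (at_right t)"
    if w: "w \<in> space P" and t: "0 \<le> t" "t < T" for w t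
  proof -
    have "((\<lambda>s. X s (w t)) \<longlongrightarrow> X t (w t)) (at t within {0..T})"
      using cont[OF inS[OF w, of t]] t by (auto simp: continuous_on_def)
    moreover have "at t within {0..T} = at_right t" if "t = 0"
      using that T by (auto intro: at_within_Icc_at_right)
    moreover have "at t within {0..T} = at t" if "t \<noteq> 0"
      using that t by (intro at_within_Icc_at) auto
    ultimately have "((\<lambda>s. X s (w t)) \<longlongrightarrow> X t (w t)) (at_right t)"
      using tendsto_within_subset[of _ _ t UNIV "{t<..}"] by (cases "t = 0") auto
    then have "((\<lambda>s. \<bar>X s (w t)\<bar>) \<longlongrightarrow> \<bar>X t (w t)\<bar>) (at_right t)" by (intro tendsto_intros)
    moreover have "\<forall>\<^sub>F s in at_right t. w s = w t"
      using w t by (auto simp: sp cadlag_paths_def)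
    then have "\<forall>\<^sub>F s in at_right t. \<bar>X s (w t)\<bar> = \<bar>X s (w s)\<bar>" by eventually_elim simp
    ultimately show ?thesis by (rule Lim_transform_eventually)
  qed
  have int: "set_integrable lborel {0..T} (\<lambda>s. \<bar>X s (w s)\<bar>)" if "w \<in> space P" for w
    by (rule right_riemann_sums(1)[OF T rc[OF that] bd[OF that]]) auto
  have lim: "(\<lambda>m. R m w) \<longlonglongrightarrow> Z w" if "w \<in> space P" for w
    unfolding R_def Z_def tm_def
    by (rule right_riemann_sums(2)[OF T rc[OF that] bd[OF that]]) auto
  have sub: "{w \<in> space P. (SUP t\<in>{0..T}. \<bar>LINT s:{0..t}|lborel. X s (w s)\<bar>) > \<epsilon>}
      \<subseteq> {w \<in> space P. Z w > \<epsilon>}"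
  proof safe
    fix w assume w: "w \<in> space P" and gt: "(SUP t\<in>{0..T}. \<bar>LINT s:{0..t}|lborel. X s (w s)\<bar>) > \<epsilon>"
    have "(SUP t\<in>{0..T}. \<bar>LINT s:{0..t}|lborel. X s (w s)\<bar>) \<le> Z w"
    proof (rule cSUP_least)
      fix t assume t: "t \<in> {0..T}"
      have "\<bar>LINT s:{0..t}|lborel. X s (w s)\<bar> \<le> (\<integral>s. norm (indicator {0..t} s *\<^sub>R X s (w s)) \<partial>lborel)"
        unfolding set_lebesgue_integral_def real_norm_def[symmetric] by (rule integral_norm_bound)
      also have "\<dots> = (LINT s:{0..t}|lborel. \<bar>X s (w s)\<bar>)"
        by (simp add: set_lebesgue_integral_def abs_mult)
      also have "\<dots> \<le> Z w"
      proof -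
        have "set_integrable lborel {0..t} (\<lambda>s. \<bar>X s (w s)\<bar>)"
          by (rule set_integrable_subset[OF int[OF w]]) (use t in auto)
        then show ?thesis using int[OF w] t
          unfolding Z_def set_lebesgue_integral_def set_integrable_def
          by (intro integral_mono) (auto simp: indicator_def)
      qed
      finally show "\<bar>LINT s:{0..t}|lborel. X s (w s)\<bar> \<le> Z w" .
    qed (use T in auto)
    then show "Z w > \<epsilon>" using gt by simp
  qed
  have ev: "(\<lambda>w. f (w t)) \<in> borel_measurable P" if "t \<in> {0..T}" for t and f :: "'s \<Rightarrow> real"
    using measurable_compose[OF measurable_path_eval[OF sets that], of f borel] by simp
  have Rm: "R m \<in> borel_measurable P" for m
    unfolding R_def using tm T
    by (intro borel_measurable_times borel_measurable_const borel_measurable_sum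
        ev[of _ "\<lambda>y. \<bar>X _ y\<bar>"]) (auto simp: less_imp_le)
  have tail: "prob {w \<in> space P. R m w > \<epsilon>} \<le> exp (- (\<theta> * \<epsilon>)) * (exp (E * T) * sqrt B)" for m
  proof -
    define Q where "Q w = (\<Sum>i<Suc m. exp (\<theta> * T * \<bar>X (tm m i) (w (tm m i))\<bar>)) / real (Suc m)" for w
    have Qi: "integrable P (\<lambda>w. exp (\<theta> * T * \<bar>X (tm m i) (w (tm m i))\<bar>))" if "i < Suc m" for i
    proof (rule integrable_const_bound)
      show "AE w in P. norm (exp (\<theta> * T * \<bar>X (tm m i) (w (tm m i))\<bar>)) \<le> exp (\<theta> * T * (\<Sum>y\<in>S. C y))"
        using bd tm[OF that] \<theta> T by (intro AE_I2) (auto intro!: mult_left_mono)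
      show "(\<lambda>w. exp (\<theta> * T * \<bar>X (tm m i) (w (tm m i))\<bar>)) \<in> borel_measurable P"
        using tm[OF that] by (intro ev[of _ "\<lambda>y. exp (\<theta> * T * \<bar>X _ y\<bar>)"]) auto
    qed
    have QI: "integrable P Q" unfolding Q_def
      by (intro Bochner_Integration.integrable_divide_zero Bochner_Integration.integrable_sum Qi) auto
    have "{w \<in> space P. R m w > \<epsilon>} \<subseteq> {w \<in> space P. Q w \<ge> exp (\<theta> * \<epsilon>)}"
    proof safe
      fix w assume "w \<in> space P" "R m w > \<epsilon>"
      then have "exp (\<theta> * \<epsilon>) \<le> exp (\<theta> * R m w)" using \<theta> by simp
      also have "\<theta> * R m w = (\<Sum>i<Suc m. \<theta> * T * \<bar>X (tm m i) (w (tm m i))\<bar>) / real (Suc m)"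
        by (simp add: R_def sum_distrib_left sum_divide_distrib mult_ac del: sum.lessThan_Suc of_nat_Suc)
      also have "exp \<dots> \<le> Q w" unfolding Q_def by (rule exp_average_le)
      finally show "exp (\<theta> * \<epsilon>) \<le> Q w" .
    qed
    then have "prob {w \<in> space P. R m w > \<epsilon>} \<le> prob {w \<in> space P. Q w \<ge> exp (\<theta> * \<epsilon>)}"
      using QI by (intro finite_measure_mono) auto
    also have "\<dots> \<le> (\<integral>w. Q w \<partial>P) / exp (\<theta> * \<epsilon>)"
    proof (rule integral_Markov_inequality_measure[where A = "{}", OF QI])
      show "AE w in P. 0 \<le> Q w" unfolding Q_def by (intro AE_I2 divide_nonneg_nonneg sum_nonneg) auto
    qed auto
    also have "(\<integral>w. Q w \<partial>P) \<le> exp (E * T) * sqrt B"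
    proof -
      have "(\<integral>w. Q w \<partial>P) = (\<Sum>i<Suc m. \<integral>w. exp (\<theta> * T * \<bar>X (tm m i) (w (tm m i))\<bar>) \<partial>P) / real (Suc m)"
        unfolding Q_def using Qi by (subst integral_divide_zero, subst Bochner_Integration.integral_sum) auto
      also have "\<dots> \<le> (\<Sum>i<Suc m. exp (E * T) * sqrt B) / real (Suc m)"
      proof (intro divide_right_mono sum_mono)
        fix i assume "i \<in> {..<Suc m}"
        then have i: "0 < tm m i" "tm m i \<le> T" using tm by auto
        have "(\<integral>w. exp (\<theta> * T * \<bar>X (tm m i) (w (tm m i))\<bar>) \<partial>P)
          \<le> exp (E * T) * sqrt (\<Sum>x\<in>S. pmf \<nu> x * (exp (\<theta> * T * \<bar>X (tm m i) x\<bar>))\<^sup>2)"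
          by (rule markov_law_expectation_le[OF ml fin T form E i, where f = "\<lambda>x. exp (\<theta> * T * \<bar>X (tm m i) x\<bar>)"])
        also have "\<dots> \<le> exp (E * T) * sqrt B"
          using mom[OF i] by (intro mult_left_mono real_sqrt_le_mono) auto
        finally show "(\<integral>w. exp (\<theta> * T * \<bar>X (tm m i) (w (tm m i))\<bar>) \<partial>P) \<le> exp (E * T) * sqrt B" .
      qed simp
      also have "\<dots> = exp (E * T) * sqrt B" by simp
      finally show ?thesis .
    qed
    finally show ?thesis by (simp add: exp_minus field_simps divide_right_mono)
  qed
  show ?thesis
    by (rule measure_limit_gt_le[OF Rm lim tail sub])
qed

section \<open>Fourier analysis on the discrete torus\<close>

lemma vec_box_eq: "{k :: 'a ^ 'd::finite. \<forall>j. k $ j \<in> A j} = vec_lambda ` (PiE UNIV A)"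
proof safe
  fix k :: "'a ^ 'd" assume "\<forall>j. k $ j \<in> A j"
  then have "k = vec_lambda (\<lambda>j. k $ j)" "(\<lambda>j. k $ j) \<in> PiE UNIV A" by auto
  then show "k \<in> vec_lambda ` (PiE UNIV A)" by blast
qed auto

lemma finite_vec_box: "(\<And>j. finite (A j)) \<Longrightarrow> finite {k :: 'a ^ 'd::finite. \<forall>j. k $ j \<in> A j}"
  unfolding vec_box_eq by (intro finite_imageI finite_PiE) auto

lemma card_vec_box: "card {k :: 'a ^ 'd::finite. \<forall>j. k $ j \<in> A j} = (\<Prod>j\<in>UNIV. card (A j))"
proof -
  have "inj_on (vec_lambda :: ('d \<Rightarrow> 'a) \<Rightarrow> _) (PiE UNIV A)"
    by (rule inj_onI) (metis vec_lambda_inverse UNIV_I)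
  then show ?thesis by (simp add: vec_box_eq card_image card_PiE)
qed

lemma dtorus_box: "dtorus n = {x. \<forall>i. x $ i \<in> {0..<int n}}"
  by (auto simp: dtorus_def)

lemma finite_dtorus [simp]: "finite (dtorus n :: (int ^ 'd::finite) set)"
  unfolding dtorus_box by (rule finite_vec_box) simp

lemma card_dtorus: "card (dtorus n :: (int ^ 'd::finite) set) = n ^ CARD('d)"
  using card_vec_box[of "\<lambda>_::'d. {0..<int n}"] unfolding dtorus_box by simp

lemma shift_in_dtorus [simp]: "n \<ge> 1 \<Longrightarrow> shift n x i \<in> dtorus n"
  by (simp add: shift_def dtorus_def)

lemma bij_betw_shift:
  assumes "n \<ge> 1" shows "bij_betw (\<lambda>x. shift n x i) (dtorus n) (dtorus n :: (int ^ 'd::finite) set)"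
proof (rule bij_betw_byWitness[where f' = "\<lambda>x. \<chi> j. (x $ j - of_bool (j = i)) mod int n"])
  show "\<forall>a\<in>dtorus n. (\<chi> j. (shift n a i $ j - of_bool (j = i)) mod int n) = a"
    using assms by (auto simp: shift_def dtorus_def vec_eq_iff mod_simps)
  show "\<forall>a\<in>dtorus n. shift n (\<chi> j. (a $ j - of_bool (j = i)) mod int n) i = a"
    using assms by (auto simp: shift_def dtorus_def vec_eq_iff mod_simps)
qed (use assms in \<open>auto simp: shift_def dtorus_def\<close>)

lemma sum_shift:
  "n \<ge> 1 \<Longrightarrow> (\<Sum>x\<in>dtorus n. f (shift n x i)) = (\<Sum>x\<in>dtorus n. f x)"
  by (rule sum.reindex_bij_betw[OF bij_betw_shift])

text \<open>Defined on all integer vectors rather than on representatives: differences and unit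
  steps can then be formed without reduction modulo \<open>n\<close>, and periodicity becomes a
  separate congruence lemma.\<close>

definition torus_char :: "nat \<Rightarrow> int ^ 'd::finite \<Rightarrow> int ^ 'd \<Rightarrow> complex" where
  "torus_char n k x = cis (2 * pi * (real_of_int (\<Sum>i\<in>UNIV. k $ i * x $ i) / real n))"

lemma torus_char_commute: "torus_char n k x = torus_char n x k"
  by (simp add: torus_char_def mult.commute)

lemma torus_char_add: "torus_char n k (x + y) = torus_char n k x * torus_char n k y"
  by (simp add: torus_char_def cis_mult algebra_simps sum.distrib add_divide_distrib)

lemma torus_char_minus: "torus_char n k (- x) = cnj (torus_char n k x)"
  by (simp add: torus_char_def cis_cnj sum_negf)

lemma torus_char_diff: "torus_char n k (x - y) = torus_char n k x * cnj (torus_char n k y)"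
  using torus_char_add[of n k x "- y"] by (simp add: torus_char_minus)

lemma torus_char_diff_left: "torus_char n (k - l) x = torus_char n k x * cnj (torus_char n l x)"
  using torus_char_diff[of n x k l] by (simp only: torus_char_commute)

lemma torus_char_0 [simp]: "torus_char n 0 x = 1" "torus_char n k 0 = 1"
  by (simp_all add: torus_char_def)

lemma torus_char_axis: "torus_char n k (axis i 1) = cis (2 * pi * real_of_int (k $ i) / real n)"
proof -
  have "(\<Sum>j\<in>UNIV. k $ j * axis i 1 $ j) = (\<Sum>j\<in>UNIV. if j = i then k $ j else 0)"
    by (intro sum.cong) (auto simp: axis_def)
  then show ?thesis by (simp add: torus_char_def)
qed

lemma torus_char_eq_1:
  assumes "n \<ge> 1" "\<And>j. int n dvd x $ j" shows "torus_char n k x = 1"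
proof -
  have "int n dvd (\<Sum>i\<in>UNIV. k $ i * x $ i)"
    using assms by (intro dvd_sum) auto
  then obtain q where q: "(\<Sum>i\<in>UNIV. k $ i * x $ i) = int n * q" by blast
  have "real_of_int (\<Sum>i\<in>UNIV. k $ i * x $ i) / real n = real_of_int q"
    unfolding q using assms by simp
  then show ?thesis by (simp add: torus_char_def cis_multiple_2pi)
qed

lemma torus_char_cong:
  assumes n: "n \<ge> 1" and c: "\<And>j. int n dvd x $ j - y $ j" shows "torus_char n k x = torus_char n k y"
proof -
  have "torus_char n k x = torus_char n k ((x - y) + y)" by simp
  also have "\<dots> = torus_char n k y" using torus_char_eq_1[of n "x - y" k] assms by (simp only: torus_char_add) simp
  finally show ?thesis .
qed

lemma torus_char_shift:
  assumes "n \<ge> 1" shows "torus_char n k (shift n x i) = torus_char n k (x + axis i 1)"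
proof (rule torus_char_cong[OF assms])
  fix j
  have "int n dvd (x $ j + of_bool (j = i)) mod int n - (x $ j + of_bool (j = i))"
    by (simp add: mod_eq_dvd_iff[symmetric])
  then show "int n dvd shift n x i $ j - (x + axis i 1) $ j"
    by (simp add: shift_def axis_def of_bool_def)
qed

text \<open>If \<open>n\<close> does not divide the coordinate \<open>x $ i\<close>, translating the
  frequency in direction \<open>i\<close> reproduces the sum multiplied by a root of unity different
  from 1, so the sum vanishes.\<close>

lemma sum_torus_char:
  assumes n: "n \<ge> 1"
  shows "(\<Sum>k\<in>dtorus n. torus_char n k (x :: int ^ 'd::finite)) = (if \<forall>j. int n dvd x $ j then of_nat n ^ CARD('d) else 0)"
proof (cases "\<forall>j. int n dvd x $ j")
  case True then show ?thesis using n by (simp add: torus_char_eq_1 card_dtorus)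
next
  case False
  then obtain i where i: "\<not> int n dvd x $ i" by blast
  let ?Z = "\<Sum>k\<in>dtorus n. torus_char n k x"
  have "?Z = (\<Sum>k\<in>dtorus n. torus_char n (shift n k i) x)" by (rule sum_shift[OF n, symmetric])
  also have "\<dots> = (\<Sum>k\<in>dtorus n. torus_char n k x * torus_char n x (axis i 1))"
    by (simp add: torus_char_commute[of n _ x] torus_char_shift[OF n] torus_char_add)
  also have "\<dots> = ?Z * torus_char n x (axis i 1)" by (rule sum_distrib_right[symmetric])
  finally have "?Z * (1 - torus_char n x (axis i 1)) = 0" by (simp only: right_diff_distrib mult_1_right) simp
  moreover have "torus_char n x (axis i 1) \<noteq> 1"
  proof
    assume "torus_char n x (axis i 1) = 1"
    then have "cos (2 * pi * real_of_int (x $ i) / real n) = 1"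
      by (simp add: torus_char_axis complex_eq_iff)
    then obtain q where "2 * pi * real_of_int (x $ i) / real n = real_of_int q * 2 * pi"
      by (auto simp: cos_one_2pi_int)
    then have "real_of_int (x $ i) = real_of_int (q * int n)" using n by (simp add: field_simps)
    then have "x $ i = q * int n" by (simp only: of_int_eq_iff)
    then show False using i by simp
  qed
  ultimately show ?thesis using False by auto
qed

lemma dtorus_cong_iff:
  assumes "x \<in> dtorus n" "y \<in> dtorus n"
  shows "(\<forall>j. int n dvd x $ j - y $ j) \<longleftrightarrow> x = y"
proof
  assume *: "\<forall>j. int n dvd x $ j - y $ j"
  have "x $ j = y $ j" for j
  proof -
    have "x $ j mod int n = y $ j mod int n" using * by (simp add: mod_eq_dvd_iff)
    then show ?thesis using assms by (simp add: dtorus_def)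
  qed
  then show "x = y" by (simp add: vec_eq_iff)
qed simp

text \<open>The convolution kernel of the Fourier multiplier \<open>m\<close>. Taking the real part
  makes it real and even for every real \<open>m\<close>.\<close>

definition fker :: "nat \<Rightarrow> (int ^ 'd::finite \<Rightarrow> real) \<Rightarrow> int ^ 'd \<Rightarrow> real" where
  "fker n m x = (\<Sum>k\<in>dtorus n. m k * Re (torus_char n k x)) / real n ^ CARD('d)"

definition fourier :: "nat \<Rightarrow> (int ^ 'd::finite \<Rightarrow> real) \<Rightarrow> int ^ 'd \<Rightarrow> complex" where
  "fourier n u k = (\<Sum>y\<in>dtorus n. of_real (u y) * torus_char n k y)"

lemma fker_even: "fker n m (- x) = fker n m x"
  by (simp add: fker_def torus_char_minus)

lemma fker_cong: "n \<ge> 1 \<Longrightarrow> (\<And>j. int n dvd x $ j - y $ j) \<Longrightarrow> fker n m x = fker n m y"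
  using torus_char_cong[of n x y] by (simp add: fker_def)

lemma fker_quadratic_form:
  fixes u :: "int ^ 'd::finite \<Rightarrow> real"
  shows "(\<Sum>x\<in>dtorus n. \<Sum>y\<in>dtorus n. fker n m (x - y) * u x * u y)
    = (\<Sum>k\<in>dtorus n. m k * (cmod (fourier n u k))\<^sup>2) / real n ^ CARD('d)"
proof -
  have *: "(cmod (fourier n u k))\<^sup>2 = (\<Sum>x\<in>dtorus n. \<Sum>y\<in>dtorus n. Re (torus_char n k (x - y)) * u x * u y)" for k
  proof -
    have "complex_of_real ((cmod (fourier n u k))\<^sup>2) = fourier n u k * cnj (fourier n u k)"
      by (rule complex_norm_square)
    also have "\<dots> = (\<Sum>x\<in>dtorus n. \<Sum>y\<in>dtorus n. torus_char n k (x - y) * of_real (u x * u y))"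
      by (simp add: fourier_def cnj_sum sum_product torus_char_diff mult_ac)
    finally have "Re (complex_of_real ((cmod (fourier n u k))\<^sup>2)) = Re (\<Sum>x\<in>dtorus n. \<Sum>y\<in>dtorus n. torus_char n k (x - y) * of_real (u x * u y))"
      by (rule arg_cong)
    then show ?thesis by (simp add: Re_sum mult.assoc del: of_real_mult)
  qed
  have "(\<Sum>k\<in>dtorus n. m k * (cmod (fourier n u k))\<^sup>2)
      = (\<Sum>k\<in>dtorus n. \<Sum>x\<in>dtorus n. \<Sum>y\<in>dtorus n. m k * (Re (torus_char n k (x - y)) * u x * u y))"
    by (simp add: * sum_distrib_left)
  also have "\<dots> = (\<Sum>x\<in>dtorus n. \<Sum>k\<in>dtorus n. \<Sum>y\<in>dtorus n. m k * (Re (torus_char n k (x - y)) * u x * u y))"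
    by (rule sum.swap)
  also have "\<dots> = (\<Sum>x\<in>dtorus n. \<Sum>y\<in>dtorus n. \<Sum>k\<in>dtorus n. m k * (Re (torus_char n k (x - y)) * u x * u y))"
    by (intro sum.cong refl sum.swap)
  finally show ?thesis
    by (simp add: fker_def sum_divide_distrib sum_distrib_right mult.assoc)
qed

text \<open>Plancherel. The convolution is only the real part of the synthesised function
  \<open>\<omega>\<close>, and discarding the imaginary part turns the identity into an
  inequality.\<close>

lemma fker_convolution_sq:
  fixes u :: "int ^ 'd::finite \<Rightarrow> real"
  assumes n: "n \<ge> 1"
  shows "(\<Sum>z\<in>dtorus n. (\<Sum>y\<in>dtorus n. fker n m (z - y) * u y)\<^sup>2)
    \<le> (\<Sum>k\<in>dtorus n. (m k)\<^sup>2 * (cmod (fourier n u k))\<^sup>2) / real n ^ CARD('d)"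
proof -
  let ?N = "real n ^ CARD('d)" and ?T = "dtorus n :: (int ^ 'd) set"
  have N: "?N > 0" using n by simp
  define c where "c k = of_real (m k) * cnj (fourier n u k)" for k
  define \<omega> where "\<omega> z = (\<Sum>k\<in>?T. c k * torus_char n k z)" for z
  have w: "(\<Sum>y\<in>?T. fker n m (z - y) * u y) = Re (\<omega> z) / ?N" for z
  proof -
    have "\<omega> z = (\<Sum>k\<in>?T. \<Sum>y\<in>?T. of_real (m k * u y) * torus_char n k (z - y))"
      by (simp add: \<omega>_def c_def fourier_def cnj_sum sum_distrib_left sum_distrib_right torus_char_diff mult_ac)
    also have "\<dots> = (\<Sum>y\<in>?T. \<Sum>k\<in>?T. of_real (m k * u y) * torus_char n k (z - y))"
      by (rule sum.swap)
    finally have "Re (\<omega> z) = (\<Sum>y\<in>?T. \<Sum>k\<in>?T. (m k * u y) * Re (torus_char n k (z - y)))"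
      by (simp add: Re_sum del: of_real_mult)
    then show ?thesis by (simp add: fker_def sum_divide_distrib sum_distrib_right sum_distrib_left mult_ac)
  qed
  have "complex_of_real (\<Sum>z\<in>?T. (cmod (\<omega> z))\<^sup>2) = (\<Sum>z\<in>?T. \<omega> z * cnj (\<omega> z))"
    by (simp only: of_real_sum complex_norm_square)
  also have "\<dots> = (\<Sum>z\<in>?T. \<Sum>k\<in>?T. \<Sum>l\<in>?T. c k * cnj (c l) * torus_char n (k - l) z)"
    by (simp add: \<omega>_def cnj_sum sum_product mult_ac torus_char_diff_left)
  also have "\<dots> = (\<Sum>k\<in>?T. \<Sum>z\<in>?T. \<Sum>l\<in>?T. c k * cnj (c l) * torus_char n (k - l) z)"
    by (rule sum.swap)
  also have "\<dots> = (\<Sum>k\<in>?T. \<Sum>l\<in>?T. \<Sum>z\<in>?T. c k * cnj (c l) * torus_char n (k - l) z)"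
    by (intro sum.cong refl sum.swap)
  also have "\<dots> = (\<Sum>k\<in>?T. \<Sum>l\<in>?T. if k = l then c k * cnj (c l) * of_nat n ^ CARD('d) else 0)"
  proof (intro sum.cong refl)
    fix k l assume kl: "k \<in> ?T" "l \<in> ?T"
    have "(\<Sum>z\<in>?T. c k * cnj (c l) * torus_char n (k - l) z) = c k * cnj (c l) * (\<Sum>z\<in>?T. torus_char n z (k - l))"
      by (simp only: sum_distrib_left torus_char_commute[of n "k - l"])
    then show "(\<Sum>z\<in>?T. c k * cnj (c l) * torus_char n (k - l) z) = (if k = l then c k * cnj (c l) * of_nat n ^ CARD('d) else 0)"
      using dtorus_cong_iff[OF kl] by (simp add: sum_torus_char[OF n])
  qed
  also have "\<dots> = (\<Sum>k\<in>?T. of_real ((cmod (c k))\<^sup>2 * ?N))"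
    by (simp add: sum.delta complex_norm_square del: of_real_power) simp
  also have "\<dots> = complex_of_real (\<Sum>k\<in>?T. (cmod (c k))\<^sup>2 * ?N)" by (simp only: of_real_sum)
  finally have P: "(\<Sum>z\<in>?T. (cmod (\<omega> z))\<^sup>2) = (\<Sum>k\<in>?T. (cmod (c k))\<^sup>2 * ?N)"
    by (simp only: of_real_eq_iff)
  have "(\<Sum>z\<in>?T. (Re (\<omega> z) / ?N)\<^sup>2) \<le> (\<Sum>z\<in>?T. (cmod (\<omega> z))\<^sup>2 / ?N\<^sup>2)"
  proof (rule sum_mono)
    fix z
    have "\<bar>Re (\<omega> z)\<bar> \<le> cmod (\<omega> z)" by (rule abs_Re_le_cmod)
    then have "(Re (\<omega> z))\<^sup>2 \<le> (cmod (\<omega> z))\<^sup>2" by (rule power2_le_iff_abs_le[THEN iffD2, rotated]) simp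
    then show "(Re (\<omega> z) / ?N)\<^sup>2 \<le> (cmod (\<omega> z))\<^sup>2 / ?N\<^sup>2"
      by (simp add: power_divide divide_right_mono)
  qed
  also have "\<dots> = (\<Sum>k\<in>?T. (cmod (c k))\<^sup>2 * ?N) / ?N\<^sup>2"
    by (simp only: P[symmetric] sum_divide_distrib)
  also have "\<dots> = (\<Sum>k\<in>?T. (m k)\<^sup>2 * (cmod (fourier n u k))\<^sup>2) / ?N"
    using N by (simp add: c_def norm_mult power_mult_distrib sum_distrib_right[symmetric] power2_eq_square[of "real n ^ _"])
  finally show ?thesis by (simp only: w)
qed

section \<open>Green's function of the discrete torus\<close>

text \<open>The eigenvalue of minus the discrete Laplacian on the character of frequency
  \<open>k\<close>.\<close>

definition lap_symbol :: "nat \<Rightarrow> int ^ 'd::finite \<Rightarrow> real" where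
  "lap_symbol n k = (\<Sum>j\<in>UNIV. 2 * (1 - cos (2 * pi * real_of_int (k $ j) / real n)))"

text \<open>The constant mode gets the multiplier 1: then \<open>green\<close> is Green's function of
  \<open>- n\<^sup>2 \<Delta>\<close> up to an additive constant, and its quadratic form dominates the square of the mean.\<close>

definition green_mult :: "nat \<Rightarrow> int ^ 'd::finite \<Rightarrow> real" where
  "green_mult n k = (if k = 0 then 1 else 1 / ((real n)\<^sup>2 * lap_symbol n k))"

definition green :: "nat \<Rightarrow> int ^ 'd::finite \<Rightarrow> real" where
  "green n = fker n (green_mult n)"

text \<open>From \<open>1 - cos t = 2 (sin (t/2))^2\<close> and the crude bound
  \<open>sin s >= s / 2\<close>, which gives \<open>t^2 / 8\<close>; then
  \<open>pi^2 >= 8\<close>.\<close>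

lemma one_minus_cos_ge:
  fixes t :: real
  assumes "0 \<le> t" "t \<le> pi" shows "1 - cos t \<ge> t\<^sup>2 / pi\<^sup>2"
proof -
  define s where "s = t / 2"
  \<comment> \<open>The number 1.6 lies just above \<open>pi / 2\<close>, and its square is below 3,
    which keeps the cubic remainder of the sine below \<open>s / 2\<close>.\<close>
  have s: "0 \<le> s" "s \<le> 1.6" using assms pi_less_4 pi_approx by (auto simp: s_def)
  have "\<bar>sin s - (\<Sum>m<3. sin_coeff m * s ^ m)\<bar> \<le> inverse (fact 3) * \<bar>s\<bar> ^ 3"
    by (rule Maclaurin_sin_bound)
  also have "(\<Sum>m<3. sin_coeff m * s ^ m) = s"
    by (simp add: eval_nat_numeral sin_coeff_def)
  also have "inverse (fact 3) * \<bar>s\<bar> ^ 3 = s * s\<^sup>2 / 6"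
    using s by (simp add: eval_nat_numeral)
  also have "\<dots> \<le> s * 3 / 6"
    using s mult_mono[OF s(2) s(2)] by (intro divide_right_mono mult_left_mono) (auto simp: power2_eq_square)
  finally have "sin s \<ge> s / 2" by linarith
  then have "(s / 2)\<^sup>2 \<le> (sin s)\<^sup>2" using s by (intro power_mono) auto
  moreover have "cos t = 1 - 2 * (sin s)\<^sup>2" using cos_double_sin[of s] by (simp add: s_def)
  ultimately have "1 - cos t \<ge> t\<^sup>2 / 8" by (simp add: s_def power2_eq_square)
  moreover have "t\<^sup>2 / pi\<^sup>2 \<le> t\<^sup>2 / 8"
  proof (rule divide_left_mono)
    have "3 * 3 \<le> pi * pi" using pi_gt3 by (intro mult_mono) auto
    then show "8 \<le> pi\<^sup>2" by (simp add: power2_eq_square)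
  qed auto
  ultimately show ?thesis by linarith
qed

text \<open>Replacing \<open>k $ j\<close> by its distance to 0 on the circle keeps the cosine and
  moves the angle into \<open>[0, pi]\<close>, where the quadratic bound holds. One coordinate is
  enough because all terms of the symbol are nonnegative.\<close>

lemma lap_symbol_ge:
  assumes n: "n \<ge> 1" and k: "k \<in> dtorus n"
  shows "lap_symbol n k \<ge> 8 * (real_of_int (circle_dist n (k $ j) 0))\<^sup>2 / (real n)\<^sup>2"
proof -
  let ?c = "circle_dist n (k $ j) 0"
  have kj: "0 \<le> k $ j" "k $ j < int n" using k by (auto simp: dtorus_def)
  have c: "?c = min (k $ j) ((- (k $ j)) mod int n)" using kj by (simp add: circle_dist_def)
  have c2: "?c = min (k $ j) (int n - k $ j)"
  proof (cases "k $ j = 0")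
    case False
    then show ?thesis using kj c by (simp add: zmod_zminus1_eq_if)
  qed (use c in simp)
  let ?t = "2 * pi * real_of_int ?c / real n"
  have t0: "0 \<le> ?t" using kj c2 by simp
  have "real_of_int (2 * ?c) \<le> real n" using c2 by linarith
  then have tpi: "?t \<le> pi" using n by (simp add: divide_le_eq)
  have cos: "cos (2 * pi * real_of_int (k $ j) / real n) = cos ?t"
  proof (cases "k $ j \<le> int n - k $ j")
    case True then show ?thesis using c2 by simp
  next
    case False
    then have "?t = 2 * pi - 2 * pi * real_of_int (k $ j) / real n"
    proof -
      have "real_of_int ?c = real n - real_of_int (k $ j)" using c2 False by linarith
      then have "?t = 2 * pi * (real n - real_of_int (k $ j)) / real n" by (simp only:)
      also have "\<dots> = 2 * pi - 2 * pi * real_of_int (k $ j) / real n"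
        using n by (simp add: right_diff_distrib diff_divide_distrib)
      finally show ?thesis .
    qed
    then show ?thesis by (simp add: cos_diff)
  qed
  have "8 * (real_of_int ?c)\<^sup>2 / (real n)\<^sup>2 = 2 * (?t\<^sup>2 / pi\<^sup>2)"
    by (simp add: power2_eq_square field_simps)
  also have "\<dots> \<le> 2 * (1 - cos (2 * pi * real_of_int (k $ j) / real n))"
    using one_minus_cos_ge[OF t0 tpi] by (simp add: cos)
  also have "\<dots> \<le> lap_symbol n k"
    unfolding lap_symbol_def by (rule member_le_sum) (auto simp: cos_le_one)
  finally show ?thesis .
qed

lemma circle_dist_pos:
  assumes "n \<ge> 1" "k \<in> dtorus n" "k $ j \<noteq> 0" shows "1 \<le> circle_dist n (k $ j) 0"
proof -
  have "0 < k $ j" "k $ j < int n" using assms by (auto simp: dtorus_def less_le)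
  then have "k $ j mod int n = k $ j" "(- (k $ j)) mod int n = int n - k $ j"
    by (simp_all add: zmod_zminus1_eq_if)
  then show ?thesis using \<open>0 < k $ j\<close> \<open>k $ j < int n\<close> by (simp add: circle_dist_def)
qed

text \<open>The spectral gap. It makes the Green multiplier at most 1 on every nonconstant
  mode.\<close>

lemma lap_symbol_pos:
  assumes n: "n \<ge> 1" and k: "k \<in> dtorus n" "k \<noteq> 0"
  shows "(real n)\<^sup>2 * lap_symbol n k \<ge> 8"
proof -
  obtain j where j: "k $ j \<noteq> 0" using k(2) by (auto simp: vec_eq_iff)
  have "1 \<le> real_of_int (circle_dist n (k $ j) 0)" using circle_dist_pos[OF n k(1) j] by simp
  then have "1 \<le> (real_of_int (circle_dist n (k $ j) 0))\<^sup>2" by (simp add: one_le_power)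
  then have "8 / (real n)\<^sup>2 \<le> 8 * (real_of_int (circle_dist n (k $ j) 0))\<^sup>2 / (real n)\<^sup>2"
    by (intro divide_right_mono) auto
  also have "\<dots> \<le> lap_symbol n k" by (rule lap_symbol_ge[OF n k(1)])
  finally show ?thesis using n by (simp add: field_simps)
qed

lemma green_mult_bounds:
  assumes "n \<ge> 1" "k \<in> dtorus n" shows "0 \<le> green_mult n k" "green_mult n k \<le> 1"
proof -
  have "0 \<le> green_mult n k \<and> green_mult n k \<le> 1"
  proof (cases "k = 0")
    case False
    then have "(real n)\<^sup>2 * lap_symbol n k \<ge> 8" by (rule lap_symbol_pos[OF assms])
    then show ?thesis using False by (simp add: green_mult_def)
  qed (simp add: green_mult_def)
  then show "0 \<le> green_mult n k" "green_mult n k \<le> 1" by auto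
qed

lemma zero_in_dtorus [simp]: "n \<ge> 1 \<Longrightarrow> 0 \<in> dtorus n"
  by (simp add: dtorus_def)

text \<open>The Laplacian annihilates the constant mode, whatever multiplier that mode carries; the
  missing mode is the correction \<open>1 / n^d\<close> to the point mass.\<close>

lemma green_laplacian:
  fixes x :: "int ^ 'd::finite"
  assumes n: "n \<ge> 1"
  shows "(real n)\<^sup>2 * (\<Sum>j\<in>UNIV. 2 * green n x - green n (x + axis j 1) - green n (x - axis j 1))
    = of_bool (\<forall>j. int n dvd x $ j) - 1 / real n ^ CARD('d)"
proof -
  let ?N = "real n ^ CARD('d)" and ?T = "dtorus n :: (int ^ 'd) set" and ?m = "green_mult n"
  have N: "?N > 0" using n by simp
  have sym: "(\<Sum>j\<in>UNIV. 2 * Re (torus_char n k x) - Re (torus_char n k (x + axis j 1)) - Re (torus_char n k (x - axis j 1)))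
      = lap_symbol n k * Re (torus_char n k x)" for k
    unfolding lap_symbol_def sum_distrib_right
    by (intro sum.cong refl) (simp add: torus_char_add torus_char_diff torus_char_axis algebra_simps)
  have "(\<Sum>j\<in>UNIV. 2 * green n x - green n (x + axis j 1) - green n (x - axis j 1))
     = (\<Sum>j\<in>UNIV. \<Sum>k\<in>?T. ?m k * (2 * Re (torus_char n k x) - Re (torus_char n k (x + axis j 1)) - Re (torus_char n k (x - axis j 1))) / ?N)"
    by (simp add: green_def fker_def sum_divide_distrib sum_distrib_left sum_subtractf[symmetric] diff_divide_distrib[symmetric] algebra_simps)
  also have "\<dots> = (\<Sum>k\<in>?T. \<Sum>j\<in>UNIV. ?m k * (2 * Re (torus_char n k x) - Re (torus_char n k (x + axis j 1)) - Re (torus_char n k (x - axis j 1))) / ?N)"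
    by (rule sum.swap)
  also have "\<dots> = (\<Sum>k\<in>?T. ?m k * (lap_symbol n k * Re (torus_char n k x)) / ?N)"
    by (simp only: sum_divide_distrib[symmetric] sum_distrib_left[symmetric] sym)
  finally have "(real n)\<^sup>2 * (\<Sum>j\<in>UNIV. 2 * green n x - green n (x + axis j 1) - green n (x - axis j 1))
     = (\<Sum>k\<in>?T. (real n)\<^sup>2 * (?m k * (lap_symbol n k * Re (torus_char n k x)) / ?N))"
    by (simp only: sum_distrib_left)
  \<comment> \<open>The product of \<open>(real n)\<^sup>2\<close>, multiplier and symbol is 1 off
    the constant mode and 0 on it.\<close>
  also have "\<dots> = (\<Sum>k\<in>?T. (Re (torus_char n k x) - of_bool (k = 0)) / ?N)"
  proof (intro sum.cong refl)
    fix k assume k: "k \<in> ?T"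
    show "(real n)\<^sup>2 * (?m k * (lap_symbol n k * Re (torus_char n k x)) / ?N) = (Re (torus_char n k x) - of_bool (k = 0)) / ?N"
    proof (cases "k = 0")
      case True then show ?thesis by (simp add: lap_symbol_def)
    next
      case False
      then have "(real n)\<^sup>2 * lap_symbol n k \<ge> 8" by (rule lap_symbol_pos[OF n k])
      then have "lap_symbol n k \<noteq> 0" by auto
      then show ?thesis using False N n by (simp add: green_mult_def)
    qed
  qed
  also have "\<dots> = (Re (\<Sum>k\<in>?T. torus_char n k x) - (\<Sum>k\<in>?T. of_bool (k = 0))) / ?N"
    by (simp add: sum_divide_distrib[symmetric] sum_subtractf Re_sum)
  also have "(\<Sum>k\<in>?T. of_bool (k = 0)) = (\<Sum>k\<in>?T. if k = 0 then 1 else 0 :: real)"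
    by (intro sum.cong) auto
  also have "\<dots> = 1" using n by simp
  also have "Re (\<Sum>k\<in>?T. torus_char n k x) = of_bool (\<forall>j. int n dvd x $ j) * ?N"
    unfolding sum_torus_char[OF n] using N by (simp add: Re_power_real flip: of_nat_power)
  finally show ?thesis using N by (simp add: diff_divide_distrib)
qed

lemma green_even: "green n (- x) = green n x"
  by (simp add: green_def fker_even)

text \<open>Exchanging two coordinates of the frequency permutes the torus and preserves the symbol.
  This isotropy is what lets the end point terms of the bond flow be described by a single
  constant.\<close>

lemma green_axis_eq:
  "green n (axis i 1 :: int ^ 'd::finite) = green n (axis j 1 :: int ^ 'd)"
proof -
  let ?T = "dtorus n :: (int ^ 'd) set"
  define \<pi> where "\<pi> k = (\<chi> l. k $ Transposition.transpose i j l)" for k :: "int ^ 'd"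
  have inv: "\<pi> (\<pi> k) = k" for k by (simp add: \<pi>_def vec_eq_iff)
  have bij: "bij_betw \<pi> ?T ?T"
    by (rule bij_betw_byWitness[where f' = \<pi>]) (auto simp: inv, auto simp: \<pi>_def dtorus_def)
  have lap: "lap_symbol n (\<pi> k) = lap_symbol n k" for k
  proof -
    have "bij (Transposition.transpose i j)" by simp
    then show ?thesis unfolding lap_symbol_def \<pi>_def
      using sum.reindex_bij_betw[of "Transposition.transpose i j" UNIV UNIV
          "\<lambda>l. 2 * (1 - cos (2 * pi * real_of_int (k $ l) / real n))"] by simp
  qed
  have zero: "\<pi> k = 0 \<longleftrightarrow> k = 0" for k
  proof -
    have "\<pi> 0 = 0" by (simp add: \<pi>_def vec_eq_iff)
    then show ?thesis using inv[of k] by auto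
  qed
  have gm: "green_mult n (\<pi> k) = green_mult n k" for k
    by (simp add: green_mult_def lap zero)
  have "(\<Sum>k\<in>?T. green_mult n k * Re (torus_char n k (axis i 1))) = (\<Sum>k\<in>?T. green_mult n (\<pi> k) * Re (torus_char n (\<pi> k) (axis i 1)))"
    by (rule sum.reindex_bij_betw[OF bij, symmetric])
  also have "\<dots> = (\<Sum>k\<in>?T. green_mult n k * Re (torus_char n k (axis j 1)))"
    by (simp add: gm torus_char_axis) (simp add: \<pi>_def)
  finally show ?thesis by (simp add: green_def fker_def)
qed

text \<open>The trace of the Green form computed twice: all diagonal entries equal
  \<open>green n 0\<close>, and the multipliers are the eigenvalues.\<close>

lemma green_trace: "real n ^ CARD('d) * green n (0 :: int ^ 'd::finite) = (\<Sum>k\<in>(dtorus n :: (int ^ 'd) set). green_mult n k)"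
  if "n \<ge> 1"
  using that by (simp add: green_def fker_def)

text \<open>The Laplacian identity at the origin, where all \<open>2 d\<close> neighbours contribute
  equally by isotropy and evenness.\<close>

lemma green_gap:
  assumes n: "n \<ge> 1"
  shows "2 * real CARD('d) * ((real n)\<^sup>2 * (green n (0 :: int ^ 'd::finite) - green n (axis i 1 :: int ^ 'd))) = 1 - 1 / real n ^ CARD('d)"
proof -
  have "green n (axis j 1 :: int ^ 'd) = green n (axis i 1)" for j by (rule green_axis_eq)
  then have "(\<Sum>j\<in>UNIV. 2 * green n (0 :: int ^ 'd) - green n (0 + axis j 1) - green n (0 - axis j 1 :: int ^ 'd))
     = (\<Sum>j\<in>(UNIV::'d set). 2 * (green n (0 :: int ^ 'd) - green n (axis i 1 :: int ^ 'd)))"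
  proof (intro sum.cong refl)
    fix j assume "\<And>j. green n (axis j 1 :: int ^ 'd) = green n (axis i 1)"
    from this[of j] show "2 * green n (0 :: int ^ 'd) - green n (0 + axis j 1) - green n (0 - axis j 1 :: int ^ 'd)
        = 2 * (green n (0 :: int ^ 'd) - green n (axis i 1 :: int ^ 'd))"
      by (simp add: green_even)
  qed
  then show ?thesis using green_laplacian[OF n, of "0 :: int ^ 'd"] by (simp add: mult_ac)
qed

section \<open>Growth of the trace of the Green form\<close>

lemma card_circle_ball:
  assumes "n \<ge> 1"
  shows "card {z \<in> {0..<int n}. circle_dist n z 0 \<le> int r} \<le> 2 * r + 1"
    and "card {z \<in> {0..<int n}. circle_dist n z 0 = int r} \<le> 2"
proof -
  have cd: "circle_dist n z 0 = min z (if z = 0 then 0 else int n - z)" if "z \<in> {0..<int n}" for z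
    using that by (auto simp: circle_dist_def zmod_zminus1_eq_if)
  have "{z \<in> {0..<int n}. circle_dist n z 0 \<le> int r} \<subseteq> {0..int r} \<union> {int n - int r..<int n}"
    using cd by (auto simp: min_def split: if_splits)
  then have "card {z \<in> {0..<int n}. circle_dist n z 0 \<le> int r} \<le> card ({0..int r} \<union> {int n - int r..<int n})"
    by (intro card_mono) auto
  also have "\<dots> \<le> card {0..int r} + card {int n - int r..<int n}" by (rule card_Un_le)
  finally show "card {z \<in> {0..<int n}. circle_dist n z 0 \<le> int r} \<le> 2 * r + 1" by simp
  have "{z \<in> {0..<int n}. circle_dist n z 0 = int r} \<subseteq> {int r, int n - int r}"
    using cd by (auto simp: min_def split: if_splits)
  then have "card {z \<in> {0..<int n}. circle_dist n z 0 = int r} \<le> card {int r, int n - int r}"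
    by (intro card_mono) auto
  also have "\<dots> \<le> 2" by (simp add: card_insert_if)
  finally show "card {z \<in> {0..<int n}. circle_dist n z 0 = int r} \<le> 2" .
qed

text \<open>Nonzero frequencies are sorted by their largest circular distance \<open>r\<close> to 0
  and a coordinate \<open>i\<close> attaining it. Such a class has at most
  \<open>2 (2 r + 1)^(d-1) <= 2 (3 r)^(d-1)\<close> members, each with multiplier at most
  \<open>1 / (8 r^2)\<close>; summing over \<open>i\<close> gives the constant
  \<open>d 3^(d-1) / 4\<close>.\<close>

lemma sum_green_mult_le:
  assumes n: "n \<ge> 1"
  shows "(\<Sum>k\<in>(dtorus n :: (int ^ 'd::finite) set). green_mult n k)
    \<le> 1 + real CARD('d) * 3 ^ (CARD('d) - 1) / 4 * (\<Sum>r=1..n. real r ^ (CARD('d) - 1) / (real r)\<^sup>2)"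
proof -
  let ?T = "dtorus n :: (int ^ 'd) set" and ?D = "CARD('d) - 1"
  \<comment> \<open>Ties put a frequency into several of these classes, which is harmless for an
    upper bound.\<close>
  define S where "S i r = {k \<in> ?T. circle_dist n (k $ i) 0 = int r \<and> (\<forall>j. circle_dist n (k $ j) 0 \<le> int r)}"
    for i :: 'd and r :: nat
  have cardS: "real (card (S i r)) \<le> 2 * 3 ^ ?D * real r ^ ?D" if r: "r \<ge> 1" for i r
  proof -
    define A where "A j = (if j = i then {z \<in> {0..<int n}. circle_dist n z 0 = int r}
       else {z \<in> {0..<int n}. circle_dist n z 0 \<le> int r})" for j
    have finA: "finite (A j)" for j
      by (rule finite_subset[of _ "{0..<int n}"]) (auto simp: A_def)
    have "S i r \<subseteq> {k. \<forall>j. k $ j \<in> A j}" by (auto simp: S_def A_def dtorus_def)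
    then have "card (S i r) \<le> card {k :: int ^ 'd. \<forall>j. k $ j \<in> A j}"
      by (intro card_mono finite_vec_box finA)
    also have "\<dots> = (\<Prod>j\<in>UNIV. card (A j))" by (rule card_vec_box)
    also have "\<dots> = card (A i) * (\<Prod>j\<in>UNIV - {i}. card (A j))" by (simp add: prod.remove)
    also have "\<dots> \<le> 2 * (\<Prod>j\<in>UNIV - {i}. 2 * r + 1)"
      using card_circle_ball[OF n] by (intro mult_mono prod_mono) (auto simp: A_def)
    also have "\<dots> = 2 * (2 * r + 1) ^ ?D" by (simp add: card_Diff_singleton)
    also have "\<dots> \<le> 2 * (3 * r) ^ ?D" using r by (intro mult_left_mono power_mono) auto
    finally have "real (card (S i r)) \<le> real (2 * (3 * r) ^ ?D)" by (simp only: of_nat_le_iff)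
    then show ?thesis by (simp add: power_mult_distrib)
  qed
  have pt: "green_mult n k \<le> of_bool (k = 0) + (\<Sum>i\<in>UNIV. \<Sum>r=1..n. of_bool (k \<in> S i r) / (8 * (real r)\<^sup>2))"
    if k: "k \<in> ?T" for k
  proof (cases "k = 0")
    case True
    then show ?thesis by (simp add: green_mult_def sum_nonneg)
  next
    case False
    define R where "R = Max (range (\<lambda>j. circle_dist n (k $ j) 0))"
    have "R \<in> range (\<lambda>j. circle_dist n (k $ j) 0)" unfolding R_def by (rule Max_in) auto
    then obtain i where i: "circle_dist n (k $ i) 0 = R" by auto
    have le: "circle_dist n (k $ j) 0 \<le> R" for j unfolding R_def by (rule Max_ge) auto
    obtain j where "k $ j \<noteq> 0" using False by (auto simp: vec_eq_iff)
    then have "1 \<le> circle_dist n (k $ j) 0" by (rule circle_dist_pos[OF n k])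
    then have R1: "1 \<le> R" using le[of j] by linarith
    have "R \<le> k $ i mod int n" using i by (simp add: circle_dist_def)
    also have "\<dots> < int n" using n by simp
    finally have Rn: "nat R \<in> {1..n}" using R1 by auto
    have kS: "k \<in> S i (nat R)" using k i le R1 by (simp add: S_def)
    have "8 * (real_of_int R)\<^sup>2 / (real n)\<^sup>2 \<le> lap_symbol n k"
      using lap_symbol_ge[OF n k, of i] i by simp
    then have "8 * (real (nat R))\<^sup>2 \<le> (real n)\<^sup>2 * lap_symbol n k"
      using n R1 by (simp add: divide_le_eq mult.commute)
    moreover have "(real n)\<^sup>2 * lap_symbol n k > 0" using lap_symbol_pos[OF n k False] by linarith
    ultimately have "green_mult n k \<le> 1 / (8 * (real (nat R))\<^sup>2)"
      using False R1 unfolding green_mult_def by (simp only: if_False) (intro divide_left_mono, auto)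
    also have "\<dots> = of_bool (k \<in> S i (nat R)) / (8 * (real (nat R))\<^sup>2)" using kS by simp
    also have "\<dots> \<le> (\<Sum>r=1..n. of_bool (k \<in> S i r) / (8 * (real r)\<^sup>2))"
      by (rule member_le_sum[OF Rn]) auto
    also have "\<dots> \<le> (\<Sum>i\<in>UNIV. \<Sum>r=1..n. of_bool (k \<in> S i r) / (8 * (real r)\<^sup>2))"
      by (rule member_le_sum) (auto intro!: sum_nonneg)
    finally show ?thesis using False by simp
  qed
  have "(\<Sum>k\<in>?T. green_mult n k) \<le>
      (\<Sum>k\<in>?T. of_bool (k = 0) + (\<Sum>i\<in>UNIV. \<Sum>r=1..n. of_bool (k \<in> S i r) / (8 * (real r)\<^sup>2)))"
    by (rule sum_mono[OF pt])
  also have "\<dots> = (\<Sum>k\<in>?T. of_bool (k = 0)) + (\<Sum>k\<in>?T. \<Sum>i\<in>UNIV. \<Sum>r=1..n. of_bool (k \<in> S i r) / (8 * (real r)\<^sup>2))"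
    by (rule sum.distrib)
  also have "(\<Sum>k\<in>?T. of_bool (k = 0)) = (\<Sum>k\<in>?T. if k = 0 then 1 else 0 :: real)"
    by (intro sum.cong) auto
  also have "\<dots> = 1" using n by simp
  also have "(\<Sum>k\<in>?T. \<Sum>i\<in>UNIV. \<Sum>r=1..n. of_bool (k \<in> S i r) / (8 * (real r)\<^sup>2))
     = (\<Sum>i\<in>UNIV. \<Sum>k\<in>?T. \<Sum>r=1..n. of_bool (k \<in> S i r) / (8 * (real r)\<^sup>2))"
    by (rule sum.swap)
  also have "\<dots> = (\<Sum>i\<in>UNIV. \<Sum>r=1..n. \<Sum>k\<in>?T. of_bool (k \<in> S i r) / (8 * (real r)\<^sup>2))"
    by (intro sum.cong refl sum.swap)
  also have "\<dots> \<le> (\<Sum>i\<in>(UNIV::'d set). \<Sum>r=1..n. 3 ^ ?D / 4 * (real r ^ ?D / (real r)\<^sup>2))"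
  proof (intro sum_mono)
    fix i r assume r: "r \<in> {1..n}"
    have "(\<Sum>k\<in>?T. of_bool (k \<in> S i r) / (8 * (real r)\<^sup>2)) = real (card (S i r)) / (8 * (real r)\<^sup>2)"
    proof -
      have "?T \<inter> {k. k \<in> S i r} = S i r" by (auto simp: S_def)
      then show ?thesis by (simp add: sum_divide_distrib[symmetric] sum_of_bool_eq)
    qed
    also have "\<dots> \<le> 2 * 3 ^ ?D * real r ^ ?D / (8 * (real r)\<^sup>2)"
      using cardS[of r i] r by (intro divide_right_mono) auto
    finally show "(\<Sum>k\<in>?T. of_bool (k \<in> S i r) / (8 * (real r)\<^sup>2)) \<le> 3 ^ ?D / 4 * (real r ^ ?D / (real r)\<^sup>2)"
      by (simp add: mult.commute)
  qed
  also have "\<dots> = real CARD('d) * 3 ^ ?D / 4 * (\<Sum>r=1..n. real r ^ ?D / (real r)\<^sup>2)"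
    by (simp add: sum_distrib_left mult.assoc)
  finally show ?thesis by simp
qed

lemma sum_inverse_squares_le: "(\<Sum>r=1..n. 1 / (real r)\<^sup>2) \<le> 2"
proof -
  have "(\<Sum>r=1..n. 1 / (real r)\<^sup>2) \<le> 2 - 1 / real n" if "n \<ge> 1"
    using that
  proof (induction n rule: dec_induct)
    case (step m)
    have "1 / (real (Suc m))\<^sup>2 \<le> 1 / real m - 1 / real (Suc m)"
    proof -
      have "1 / (real (Suc m))\<^sup>2 \<le> 1 / (real m * real (Suc m))"
        using step(1) by (intro divide_left_mono) (auto simp: power2_eq_square)
      also have "\<dots> = 1 / real m - 1 / real (Suc m)" using step(1) by (simp add: field_simps)
      finally show ?thesis .
    qed
    then show ?case using step by simp
  qed simp
  moreover have "1 / real n \<ge> 0" by simp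
  ultimately have "(\<Sum>r=1..n. 1 / (real r)\<^sup>2) \<le> 2" if "n \<ge> 1" using that by linarith
  then show ?thesis by (cases "n = 0") simp_all
qed

lemma sum_inverse_le_ln: "n \<ge> 1 \<Longrightarrow> (\<Sum>r=1..n. 1 / real r) \<le> 1 + ln (real n)"
proof (induction n rule: dec_induct)
  case (step m)
  have "ln (real m / real (Suc m)) \<le> real m / real (Suc m) - 1"
    using step(1) by (intro ln_le_minus_one) auto
  then have "ln (real m) - ln (real (Suc m)) \<le> - (1 / real (Suc m))"
    using step(1) by (simp add: ln_div field_simps)
  then show ?case using step by simp
qed simp

lemma ln_ge_1: "n \<ge> 3 \<Longrightarrow> 1 \<le> ln (real n)"
  using exp_le ln_mono[of "exp 1" "real n"] by simp

text \<open>The three cases of \<open>g_dim\<close> are the three growth regimes of the sum of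
  \<open>r^(d-3)\<close>: bounded, logarithmic, and of order \<open>n^(d-2)\<close>. From
  \<open>n = 3\<close> on, \<open>ln n\<close> is at least 1.\<close>

lemma g_dim_scale_bounds:
  assumes n: "n \<ge> 3" and d: "d \<ge> 1" shows "1 \<le> real n ^ d / (real n)\<^sup>2 * g_dim d n"
    and "(\<Sum>r=1..n. real r ^ (d - 1) / (real r)\<^sup>2) \<le> 2 * (real n ^ d / (real n)\<^sup>2 * g_dim d n)"
proof -
  consider "d = 1" | "d = 2" | "d \<ge> 3" using d by linarith
  then have "1 \<le> real n ^ d / (real n)\<^sup>2 * g_dim d n \<and>
     (\<Sum>r=1..n. real r ^ (d - 1) / (real r)\<^sup>2) \<le> 2 * (real n ^ d / (real n)\<^sup>2 * g_dim d n)"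
  proof cases
    case 1
    have "real n * real n / (real n)\<^sup>2 = 1" using n by (simp add: power2_eq_square)
    then show ?thesis using 1 sum_inverse_squares_le[of n] by (simp add: g_dim_def)
  next
    case 2
    have "(\<Sum>r=1..n. real r / (real r)\<^sup>2) = (\<Sum>r=1..n. 1 / real r)"
      by (intro sum.cong) (auto simp: power2_eq_square)
    also have "\<dots> \<le> 2 * ln (real n)" using sum_inverse_le_ln[of n] ln_ge_1[OF n] n by simp
    finally show ?thesis using 2 ln_ge_1[OF n] n by (simp add: g_dim_def)
  next
    case 3
    then have d2: "d = d - 2 + 2" "d - 1 = d - 3 + 2" by simp_all
    have p: "real r ^ d = real r ^ (d - 2) * (real r)\<^sup>2" for r
      by (subst d2(1)) (rule power_add)
    have q: "real r ^ (d - 1) = real r ^ (d - 3) * (real r)\<^sup>2" for r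
      by (subst d2(2)) (rule power_add)
    have eq: "real n ^ d / (real n)\<^sup>2 * g_dim d n = real n ^ (d - 2)"
      using 3 n by (simp add: p g_dim_def)
    have "(\<Sum>r=1..n. real r ^ (d - 1) / (real r)\<^sup>2) \<le> (\<Sum>r=1..n. real n ^ (d - 3))"
    proof (rule sum_mono)
      fix r assume r: "r \<in> {1..n}"
      then have "real r ^ (d - 1) / (real r)\<^sup>2 = real r ^ (d - 3)" unfolding q by simp
      also have "\<dots> \<le> real n ^ (d - 3)" using r by (intro power_mono) auto
      finally show "real r ^ (d - 1) / (real r)\<^sup>2 \<le> real n ^ (d - 3)" .
    qed
    also have "\<dots> = real n ^ Suc (d - 3)" by simp
    also have "\<dots> = real n ^ (d - 2)" using 3 by (intro arg_cong[where f = "power (real n)"]) simp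
    also have "\<dots> \<le> 2 * real n ^ (d - 2)" by simp
    finally show ?thesis unfolding eq using n by (simp add: one_le_power)
  qed
  then show "1 \<le> real n ^ d / (real n)\<^sup>2 * g_dim d n"
    "(\<Sum>r=1..n. real r ^ (d - 1) / (real r)\<^sup>2) \<le> 2 * (real n ^ d / (real n)\<^sup>2 * g_dim d n)" by auto
qed

lemma sum_green_mult_le_g_dim:
  assumes n: "n \<ge> 3"
  shows "(\<Sum>k\<in>(dtorus n :: (int ^ 'd::finite) set). green_mult n k)
    \<le> (1 + real CARD('d) * 3 ^ (CARD('d) - 1) / 2) * (real n ^ CARD('d) / (real n)\<^sup>2 * g_dim CARD('d) n)"
proof -
  let ?c = "real CARD('d) * 3 ^ (CARD('d) - 1) / 4" and ?G = "real n ^ CARD('d) / (real n)\<^sup>2 * g_dim CARD('d) n"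
  have d: "CARD('d) \<ge> 1" using zero_less_card_finite[where 'a = 'd] by linarith
  have "(\<Sum>k\<in>(dtorus n :: (int ^ 'd::finite) set). green_mult n k)
     \<le> 1 + ?c * (\<Sum>r=1..n. real r ^ (CARD('d) - 1) / (real r)\<^sup>2)"
    using n by (intro sum_green_mult_le) auto
  also have "\<dots> \<le> ?G + ?c * (2 * ?G)"
    by (intro add_mono mult_left_mono g_dim_scale_bounds n d) auto
  also have "\<dots> = (1 + real CARD('d) * 3 ^ (CARD('d) - 1) / 2) * ?G"
    unfolding distrib_right by (simp add: mult.assoc)
  finally show ?thesis .
qed

section \<open>Nearest neighbour sums as bond sums\<close>

text \<open>In electrostatic terms \<open>gpot n u\<close> is the potential of the charge
  \<open>u\<close>, and \<open>gform n u\<close> below is its energy.\<close>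

definition gpot :: "nat \<Rightarrow> (int ^ 'd::finite \<Rightarrow> real) \<Rightarrow> int ^ 'd \<Rightarrow> real" where
  "gpot n u z = (\<Sum>y\<in>dtorus n. green n (z - y) * u y)"

definition gform :: "nat \<Rightarrow> (int ^ 'd::finite \<Rightarrow> real) \<Rightarrow> real" where
  "gform n u = (\<Sum>x\<in>dtorus n. u x * gpot n u x)"

definition bond_sum :: "nat \<Rightarrow> (int ^ 'd::finite \<Rightarrow> 'd \<Rightarrow> real) \<Rightarrow> real" where
  "bond_sum n f = (\<Sum>z\<in>dtorus n. \<Sum>j\<in>UNIV. f z j)"

text \<open>The two end points are left out of the gradient of \<open>gpot n u\<close> so that the flow through a bond does
  not change when \<open>u\<close> is swapped across that bond.\<close>

definition bond_flow :: "nat \<Rightarrow> (int ^ 'd::finite \<Rightarrow> real) \<Rightarrow> int ^ 'd \<Rightarrow> 'd \<Rightarrow> real" where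
  "bond_flow n u z j =
     (\<Sum>y\<in>dtorus n - {z, shift n z j}. (green n (z + axis j 1 - y) - green n (z - y)) * u y)"

definition nn_sum :: "nat \<Rightarrow> (int ^ 'd::finite \<Rightarrow> real) \<Rightarrow> real" where
  "nn_sum n u = bond_sum n (\<lambda>z j. u z * u (shift n z j))"

context
  fixes n :: nat and u :: "int ^ 'd::finite \<Rightarrow> real"
  assumes n: "n \<ge> 2"
begin

private lemma n1: "n \<ge> 1" using n by simp

lemma gform_fourier:
  "gform n u = (\<Sum>k\<in>dtorus n. green_mult n k * (cmod (fourier n u k))\<^sup>2) / real n ^ CARD('d)"
  unfolding gform_def gpot_def green_def fker_quadratic_form[symmetric]
  by (simp add: sum_distrib_left mult_ac)

text \<open>A multiplier in [0,1] dominates its own square. This operator norm bound is what later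
  allows the Green form to be estimated by a fraction of itself.\<close>

lemma gpot_sq_le: "(\<Sum>z\<in>dtorus n. (gpot n u z)\<^sup>2) \<le> gform n u"
proof -
  have "(\<Sum>z\<in>dtorus n. (gpot n u z)\<^sup>2) \<le> (\<Sum>k\<in>dtorus n. (green_mult n k)\<^sup>2 * (cmod (fourier n u k))\<^sup>2) / real n ^ CARD('d)"
    unfolding gpot_def green_def by (rule fker_convolution_sq[OF n1])
  also have "\<dots> \<le> (\<Sum>k\<in>dtorus n. green_mult n k * (cmod (fourier n u k))\<^sup>2) / real n ^ CARD('d)"
    using green_mult_bounds[OF n1]
    by (intro divide_right_mono sum_mono mult_right_mono) (auto simp: power2_eq_square intro!: mult_left_le)
  finally show ?thesis by (simp only: gform_fourier)
qed

lemma sum_sq_le_gform: "(\<Sum>x\<in>dtorus n. u x)\<^sup>2 / real n ^ CARD('d) \<le> gform n u"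
proof -
  have "fourier n u 0 = of_real (\<Sum>x\<in>dtorus n. u x)" by (simp add: fourier_def)
  then have "(\<Sum>x\<in>dtorus n. u x)\<^sup>2 = green_mult n (0 :: int ^ 'd) * (cmod (fourier n u (0 :: int ^ 'd)))\<^sup>2"
    by (simp add: green_mult_def del: of_real_sum)
  also have "\<dots> \<le> (\<Sum>k\<in>dtorus n. green_mult n k * (cmod (fourier n u k))\<^sup>2)"
    using green_mult_bounds(1)[OF n1] n1 by (intro member_le_sum mult_nonneg_nonneg) auto
  finally show ?thesis unfolding gform_fourier by (intro divide_right_mono) auto
qed

lemma green_cong: "(\<And>j. int n dvd x $ j - y $ j) \<Longrightarrow> green n x = green n y"
  unfolding green_def by (rule fker_cong[OF n1])

lemma shift_dvd: "int n dvd shift n z j $ i - (z + axis j 1) $ i"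
proof -
  have "int n dvd (z $ i + of_bool (i = j)) mod int n - (z $ i + of_bool (i = j))"
    by (simp add: mod_eq_dvd_iff[symmetric])
  then show ?thesis by (simp add: shift_def axis_def of_bool_def)
qed

lemma green_shift: "green n (shift n z j - y) = green n (z + axis j 1 - y)"
  by (rule green_cong) (use shift_dvd[of z j] in \<open>simp add: algebra_simps\<close>)

lemma green_shift': "green n (shift n z j - axis j 1 - y) = green n (z - y)"
  by (rule green_cong) (use shift_dvd[of z j] in \<open>simp add: algebra_simps\<close>)

lemma gpot_shift: "gpot n v (shift n z j) = gpot n v (z + axis j 1)"
  by (simp add: gpot_def green_shift)

lemma gpot_shift': "gpot n v (shift n z j - axis j 1) = gpot n v z"
  by (simp add: gpot_def green_shift')

lemma shift_neq: "z \<in> dtorus n \<Longrightarrow> shift n z j \<noteq> z"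
proof
  assume z: "z \<in> dtorus n" and eq: "shift n z j = z"
  have "int n dvd 1" using shift_dvd[of z j j] eq by (simp add: axis_def)
  then show False using n by simp
qed

lemma gpot_laplacian:
  "(real n)\<^sup>2 * (\<Sum>j\<in>UNIV. 2 * gpot n u z - gpot n u (z + axis j 1) - gpot n u (z - axis j 1))
    = u z - (\<Sum>y\<in>dtorus n. u y) / real n ^ CARD('d)" if z: "z \<in> dtorus n"
proof -
  have "(real n)\<^sup>2 * (\<Sum>j\<in>UNIV. 2 * gpot n u z - gpot n u (z + axis j 1) - gpot n u (z - axis j 1))
    = (real n)\<^sup>2 * (\<Sum>j\<in>UNIV. \<Sum>y\<in>dtorus n. (2 * green n (z - y) - green n (z - y + axis j 1) - green n (z - y - axis j 1)) * u y)"
    by (simp add: gpot_def sum_distrib_left sum_subtractf[symmetric] algebra_simps)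
  also have "\<dots> = (real n)\<^sup>2 * (\<Sum>y\<in>dtorus n. (\<Sum>j\<in>UNIV. 2 * green n (z - y) - green n (z - y + axis j 1) - green n (z - y - axis j 1)) * u y)"
    by (subst sum.swap) (simp only: sum_distrib_right)
  also have "\<dots> = (\<Sum>y\<in>dtorus n. (of_bool (\<forall>j. int n dvd (z - y) $ j) - 1 / real n ^ CARD('d)) * u y)"
    unfolding green_laplacian[OF n1, symmetric] by (subst sum_distrib_left) (simp only: mult.assoc)
  also have "\<dots> = (\<Sum>y\<in>dtorus n. (if z = y then u y else 0) - u y / real n ^ CARD('d))"
  proof (intro sum.cong refl)
    fix y :: "int ^ 'd" assume "y \<in> dtorus n"
    then show "(of_bool (\<forall>j. int n dvd (z - y) $ j) - 1 / real n ^ CARD('d)) * u y = (if z = y then u y else 0) - u y / real n ^ CARD('d)"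
      using dtorus_cong_iff[OF z, of y] by (simp add: algebra_simps)
  qed
  also have "\<dots> = u z - (\<Sum>y\<in>dtorus n. u y) / real n ^ CARD('d)"
    using z by (simp add: sum_subtractf sum_divide_distrib)
  finally show ?thesis .
qed

text \<open>Summation by parts on the torus. The assumptions on \<open>w\<close> express
  periodicity: \<open>shift\<close> reduces modulo \<open>n\<close>, whereas adding
  \<open>axis j 1\<close> does not.\<close>

lemma bond_sum_by_parts:
  fixes v w :: "int ^ 'd \<Rightarrow> real"
  assumes w: "\<And>z j. w (shift n z j) = w (z + axis j 1)" "\<And>z j. w (shift n z j - axis j 1) = w z"
  shows "bond_sum n (\<lambda>z j. (v (shift n z j) - v z) * (w (shift n z j) - w z))
    = (\<Sum>z\<in>dtorus n. v z * (\<Sum>j\<in>UNIV. 2 * w z - w (z + axis j 1) - w (z - axis j 1)))"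
proof -
  have "(\<Sum>z\<in>dtorus n. (v (shift n z j) - v z) * (w (shift n z j) - w z))
     = (\<Sum>z\<in>dtorus n. v z * (2 * w z - w (z + axis j 1) - w (z - axis j 1)))" for j
  proof -
    have "(\<Sum>z\<in>dtorus n. (v (shift n z j) - v z) * (w (shift n z j) - w z))
      = (\<Sum>z\<in>dtorus n. v (shift n z j) * (w (shift n z j) - w (shift n z j - axis j 1)))
        + (\<Sum>z\<in>dtorus n. v z * (w z - w (z + axis j 1)))"
      by (simp add: w sum.distrib[symmetric] algebra_simps)
    also have "(\<Sum>z\<in>dtorus n. v (shift n z j) * (w (shift n z j) - w (shift n z j - axis j 1)))
      = (\<Sum>z\<in>dtorus n. v z * (w z - w (z - axis j 1)))"
      by (rule sum_shift[OF n1, of "\<lambda>z. v z * (w z - w (z - axis j 1))"])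
    finally show ?thesis by (simp add: sum.distrib[symmetric] algebra_simps)
  qed
  then show ?thesis unfolding bond_sum_def
    by (subst sum.swap) (simp add: sum_distrib_left sum.swap[of _ UNIV])
qed

text \<open>Summation by parts leaves the Laplacian of the potential, which is the charge minus its
  mean; the mean produces the product of sums.\<close>

lemma bond_sum_gpot:
  "(real n)\<^sup>2 * bond_sum n (\<lambda>z j. (v (shift n z j) - v z) * (gpot n u (shift n z j) - gpot n u z))
    = (\<Sum>z\<in>dtorus n. v z * u z) - (\<Sum>z\<in>dtorus n. v z) * (\<Sum>z\<in>dtorus n. u z) / real n ^ CARD('d)"
proof -
  have "(real n)\<^sup>2 * bond_sum n (\<lambda>z j. (v (shift n z j) - v z) * (gpot n u (shift n z j) - gpot n u z))
    = (\<Sum>z\<in>dtorus n. v z * ((real n)\<^sup>2 * (\<Sum>j\<in>UNIV. 2 * gpot n u z - gpot n u (z + axis j 1) - gpot n u (z - axis j 1))))"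
    by (subst bond_sum_by_parts) (simp_all add: gpot_shift gpot_shift' sum_distrib_left mult_ac)
  also have "\<dots> = (\<Sum>z\<in>dtorus n. v z * (u z - (\<Sum>y\<in>dtorus n. u y) / real n ^ CARD('d)))"
    by (intro sum.cong) (simp_all add: gpot_laplacian)
  finally show ?thesis by (simp add: right_diff_distrib sum_subtractf sum_distrib_right sum_divide_distrib[symmetric])
qed

lemma green_axis:
  "green n (axis j 1 :: int ^ 'd)
    = green n (0 :: int ^ 'd) - (1 - 1 / real n ^ CARD('d)) / (2 * real CARD('d) * (real n)\<^sup>2)"
proof -
  have "2 * real CARD('d) * (real n)\<^sup>2 * (green n (0 :: int ^ 'd) - green n (axis j 1)) = 1 - 1 / real n ^ CARD('d)"
    using green_gap[OF n1, where i = j] by (simp only: mult.assoc)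
  moreover have "2 * real CARD('d) * (real n)\<^sup>2 \<noteq> 0" using n by simp
  ultimately have "green n (0 :: int ^ 'd) - green n (axis j 1) = (1 - 1 / real n ^ CARD('d)) / (2 * real CARD('d) * (real n)\<^sup>2)"
    by (metis nonzero_mult_div_cancel_left)
  then show ?thesis by simp
qed

text \<open>The two end point terms of the gradient are split off. By isotropy and evenness of
  \<open>green\<close> they have the same coefficient \<open>gap\<close> with opposite signs, hence
  combine to a multiple of the gradient of \<open>u\<close>.\<close>

lemma bond_flow_eq:
  assumes z: "z \<in> dtorus n"
  defines "gap \<equiv> (1 - 1 / real n ^ CARD('d)) / (2 * real CARD('d) * (real n)\<^sup>2)"
  shows "bond_flow n u z j = (gpot n u (shift n z j) - gpot n u z) - gap * (u (shift n z j) - u z)"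
proof -
  have green_axis: "green n (axis j 1 :: int ^ 'd) = green n (0 :: int ^ 'd) - gap"
    unfolding gap_def by (rule green_axis)
  let ?s = "shift n z j"
  let ?f = "\<lambda>y. (green n (z + axis j 1 - y) - green n (z - y)) * u y"
  have "gpot n u ?s - gpot n u z = (\<Sum>y\<in>dtorus n. ?f y)"
    by (simp add: gpot_def green_shift sum_subtractf left_diff_distrib)
  also have "\<dots> = ?f z + (?f ?s + (\<Sum>y\<in>dtorus n - {z} - {?s}. ?f y))"
    using z shift_neq[OF z] n1 by (simp add: sum.remove[of _ z] sum.remove[of _ ?s])
  also have "dtorus n - {z} - {?s} = dtorus n - {z, ?s}" by blast
  also have "?f z = - gap * u z" by (simp add: green_axis)
  also have "?f ?s = gap * u ?s"
  proof -
    have "green n (z + axis j 1 - ?s) = green n (0 :: int ^ 'd)"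
      using green_shift[of z j ?s] by simp
    moreover have "green n (z - ?s) = green n (- axis j 1)"
      using green_shift'[of z j ?s] by simp
    ultimately show ?thesis by (simp add: green_even green_axis)
  qed
  finally show ?thesis by (simp add: bond_flow_def algebra_simps)
qed

lemma bond_sum_diff_sq:
  "bond_sum n (\<lambda>z j. (u (shift n z j) - u z)\<^sup>2) = 2 * real CARD('d) * (\<Sum>z\<in>dtorus n. (u z)\<^sup>2) - 2 * nn_sum n u"
proof -
  have s: "(\<Sum>z\<in>dtorus n. \<Sum>j\<in>UNIV. (u (shift n z j))\<^sup>2) = (\<Sum>z\<in>dtorus n. \<Sum>j\<in>(UNIV :: 'd set). (u z)\<^sup>2)"
    by (subst (1 2) sum.swap) (intro sum.cong refl sum_shift[OF n1, of "\<lambda>z. (u z)\<^sup>2"])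
  have "bond_sum n (\<lambda>z j. (u (shift n z j) - u z)\<^sup>2)
     = (\<Sum>z\<in>dtorus n. \<Sum>j\<in>UNIV. (u (shift n z j))\<^sup>2) + (\<Sum>z\<in>dtorus n. \<Sum>j\<in>(UNIV :: 'd set). (u z)\<^sup>2) - 2 * nn_sum n u"
    unfolding nn_sum_def bond_sum_def sum_distrib_left sum.distrib[symmetric] sum_subtractf[symmetric]
    by (simp add: power2_eq_square algebra_simps)
  then show ?thesis unfolding s by (simp add: sum_distrib_left mult.assoc)
qed

text \<open>The difference \<open>green n 0 - green n (axis j 1)\<close> is the same in all directions \<open>j\<close>; therefore the
  end point terms removed in \<open>bond_flow\<close> recombine into the nearest neighbour sum itself.\<close>

lemma nn_sum_flow:
  "(1 - 1 / real n ^ CARD('d)) / real CARD('d) * nn_sum n u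
    = (real n)\<^sup>2 * bond_sum n (\<lambda>z j. (u (shift n z j) - u z) * bond_flow n u z j)
      + (\<Sum>z\<in>dtorus n. u z)\<^sup>2 / real n ^ CARD('d) - (\<Sum>z\<in>dtorus n. (u z)\<^sup>2) / real n ^ CARD('d)"
proof -
  let ?U = "\<Sum>z\<in>dtorus n. (u z)\<^sup>2" and ?d = "real CARD('d)"
  have d: "?d > 0" by simp
  define gap where "gap = (1 - 1 / real n ^ CARD('d)) / (2 * ?d * (real n)\<^sup>2)"
  have flow: "bond_flow n u z j = (gpot n u (shift n z j) - gpot n u z) - gap * (u (shift n z j) - u z)"
    if "z \<in> dtorus n" for z j
    unfolding gap_def by (rule bond_flow_eq[OF that])
  have "bond_sum n (\<lambda>z j. (u (shift n z j) - u z) * bond_flow n u z j)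
     = bond_sum n (\<lambda>z j. (u (shift n z j) - u z) * (gpot n u (shift n z j) - gpot n u z))
       - gap * bond_sum n (\<lambda>z j. (u (shift n z j) - u z)\<^sup>2)"
    unfolding bond_sum_def sum_distrib_left sum_subtractf[symmetric]
    by (intro sum.cong refl) (simp add: flow power2_eq_square algebra_simps)
  \<comment> \<open>The decisive cancellation: the gradient of the potential yields the full sum of
    squares, and the end point terms remove the fraction \<open>1 - 1 / n^d\<close> of it. What
    remains of this sum of order \<open>n^d\<close> is only of order 1.\<close>
  then have "(real n)\<^sup>2 * bond_sum n (\<lambda>z j. (u (shift n z j) - u z) * bond_flow n u z j)
     = (?U - (\<Sum>z\<in>dtorus n. u z)\<^sup>2 / real n ^ CARD('d)) - (real n)\<^sup>2 * gap * (2 * ?d * ?U - 2 * nn_sum n u)"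
    using bond_sum_gpot[of u] by (simp add: bond_sum_diff_sq right_diff_distrib power2_eq_square[of "u _"] power2_eq_square[of "sum u _"])
  moreover have "(real n)\<^sup>2 * gap = (1 - 1 / real n ^ CARD('d)) / (2 * ?d)"
    using n by (simp add: gap_def)
  moreover have "(1 - 1 / real n ^ CARD('d)) / (2 * ?d) * (2 * ?d * ?U - 2 * nn_sum n u) = (1 - 1 / real n ^ CARD('d)) * ?U - (1 - 1 / real n ^ CARD('d)) / ?d * nn_sum n u"
    using d by (simp add: field_simps)
  ultimately show ?thesis by (simp add: left_diff_distrib)
qed

text \<open>The gradient of the potential has energy \<open>gform\<close> minus a product of means.
  The end point part is at most \<open>gap\<close>, of order \<open>n^(-2)\<close>, on each of the
  \<open>d n^d\<close> bonds, which yields the term \<open>n^d / n^2\<close>.\<close>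

lemma bond_flow_sq_le:
  assumes u1: "\<And>z j. z \<in> dtorus n \<Longrightarrow> \<bar>u (shift n z j) - u z\<bar> \<le> 1"
  shows "(real n)\<^sup>2 * bond_sum n (\<lambda>z j. (bond_flow n u z j)\<^sup>2) \<le> 4 * gform n u + real n ^ CARD('d) / (real n)\<^sup>2"
proof -
  let ?w = "gpot n u" and ?d = "real CARD('d)"
  have d: "?d \<ge> 1" using zero_less_card_finite[where 'a = 'd] by linarith
  have N: "real n ^ CARD('d) > 0" using n by simp
  define gap where "gap = (1 - 1 / real n ^ CARD('d)) / (2 * ?d * (real n)\<^sup>2)"
  have flow: "bond_flow n u z j = (gpot n u (shift n z j) - gpot n u z) - gap * (u (shift n z j) - u z)"
    if "z \<in> dtorus n" for z j
    unfolding gap_def by (rule bond_flow_eq[OF that])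
  have "bond_sum n (\<lambda>z j. (bond_flow n u z j)\<^sup>2)
     \<le> bond_sum n (\<lambda>z j. 2 * ((?w (shift n z j) - ?w z) * (?w (shift n z j) - ?w z)) + 2 * gap\<^sup>2)"
    unfolding bond_sum_def
  proof (intro sum_mono)
    fix z :: "int ^ 'd" and j assume z: "z \<in> dtorus n"
    let ?p = "?w (shift n z j) - ?w z" and ?q = "u (shift n z j) - u z"
    have "(?p - gap * ?q)\<^sup>2 \<le> 2 * ?p\<^sup>2 + 2 * (gap * ?q)\<^sup>2"
    proof -
      have "(x - y)\<^sup>2 \<le> 2 * x\<^sup>2 + 2 * y\<^sup>2" for x y :: real
        using zero_le_power2[of "x + y"] by (simp add: power2_sum power2_diff)
      then show ?thesis .
    qed
    also have "(gap * ?q)\<^sup>2 \<le> gap\<^sup>2"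
      using u1[OF z, of j] by (auto simp: power_mult_distrib abs_square_le_1 intro: mult_left_le)
    finally show "(bond_flow n u z j)\<^sup>2 \<le> 2 * (?p * ?p) + 2 * gap\<^sup>2"
      by (simp add: flow[OF z] power2_eq_square[of ?p])
  qed
  also have "\<dots> = 2 * bond_sum n (\<lambda>z j. (?w (shift n z j) - ?w z) * (?w (shift n z j) - ?w z)) + 2 * gap\<^sup>2 * (?d * real n ^ CARD('d))"
    by (simp add: bond_sum_def sum.distrib card_dtorus sum_distrib_left)
  finally have "(real n)\<^sup>2 * bond_sum n (\<lambda>z j. (bond_flow n u z j)\<^sup>2)
     \<le> 2 * ((real n)\<^sup>2 * bond_sum n (\<lambda>z j. (?w (shift n z j) - ?w z) * (?w (shift n z j) - ?w z))) + (real n)\<^sup>2 * (2 * gap\<^sup>2 * (?d * real n ^ CARD('d)))"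
    using mult_left_mono[of _ _ "(real n)\<^sup>2"] by (fastforce simp: algebra_simps)
  also have "(real n)\<^sup>2 * bond_sum n (\<lambda>z j. (?w (shift n z j) - ?w z) * (?w (shift n z j) - ?w z))
     = gform n u - (\<Sum>z\<in>dtorus n. ?w z) * (\<Sum>z\<in>dtorus n. u z) / real n ^ CARD('d)"
    unfolding bond_sum_gpot by (simp add: gform_def mult.commute)
  \<comment> \<open>The product of sums has no sign. It is bounded by half the sum of the two
    squares, and each square divided by \<open>n^d\<close> is at most
    \<open>gform n u\<close>.\<close>
  also have "\<dots> \<le> 2 * gform n u"
  proof -
    let ?a = "\<Sum>z\<in>dtorus n. ?w z" and ?b = "\<Sum>z\<in>dtorus n. u z"
    have "?a\<^sup>2 \<le> real n ^ CARD('d) * (\<Sum>z\<in>dtorus n. (?w z)\<^sup>2)"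
      using sum_squared_le_sum_of_squares[of ?w "dtorus n"] by (simp add: card_dtorus mult.commute)
    then have "?a\<^sup>2 / real n ^ CARD('d) \<le> (\<Sum>z\<in>dtorus n. (?w z)\<^sup>2)" using N by (simp add: divide_le_eq mult.commute)
    then have "?a\<^sup>2 / real n ^ CARD('d) + ?b\<^sup>2 / real n ^ CARD('d) \<le> 2 * gform n u" using gpot_sq_le sum_sq_le_gform by linarith
    moreover have "- (2 * (?a * ?b / real n ^ CARD('d))) \<le> ?a\<^sup>2 / real n ^ CARD('d) + ?b\<^sup>2 / real n ^ CARD('d)"
    proof -
      have "0 \<le> (?a + ?b)\<^sup>2 / real n ^ CARD('d)" using N by simp
      then show ?thesis by (simp add: power2_sum add_divide_distrib)
    qed
    ultimately show ?thesis by linarith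
  qed
  also have "(real n)\<^sup>2 * (2 * gap\<^sup>2 * (?d * real n ^ CARD('d))) \<le> real n ^ CARD('d) / (real n)\<^sup>2"
  proof -
    let ?k = "(real n)\<^sup>2 * gap"
    have k: "2 * ?d * ?k = 1 - 1 / real n ^ CARD('d)"
      using n by (simp add: gap_def)
    have "real n ^ CARD('d) \<ge> 1" using n by simp
    then have "1 / real n ^ CARD('d) \<le> 1" using N by (simp add: divide_le_eq)
    then have "0 \<le> 2 * ?d * ?k" "2 * ?d * ?k \<le> 1" unfolding k by auto
    then have "(2 * ?d * ?k)\<^sup>2 \<le> 1" by (simp add: power_le_one)
    then have "4 * ?d * (?d * ?k\<^sup>2) \<le> 1" by (simp add: power2_eq_square mult_ac)
    moreover have "2 * (?d * ?k\<^sup>2) \<le> 4 * ?d * (?d * ?k\<^sup>2)"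
    proof (rule mult_right_mono)
      show "2 \<le> 4 * ?d" using d by linarith
    qed simp
    ultimately have "2 * (?d * ?k\<^sup>2) \<le> 1" by linarith
    then have "2 * (?d * ?k\<^sup>2) * (real n ^ CARD('d) / (real n)\<^sup>2) \<le> 1 * (real n ^ CARD('d) / (real n)\<^sup>2)" by (intro mult_right_mono) auto
    moreover have "(real n)\<^sup>2 * (2 * gap\<^sup>2 * (?d * real n ^ CARD('d))) = 2 * (?d * ?k\<^sup>2) * (real n ^ CARD('d) / (real n)\<^sup>2)"
      using n by (simp add: power2_eq_square field_simps)
    ultimately show ?thesis by simp
  qed
  finally show ?thesis by simp
qed

end

section \<open>Integration by parts under the Bernoulli measure\<close>

text \<open>Applying the involution to an odd weight \<open>\<omega>\<close> and an even
  \<open>\<Phi>\<close> replaces \<open>g^2\<close> by half of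
  \<open>g^2 - (g o \<sigma>)^2\<close>. This difference factorises, and Young's inequality
  separates the gradient of \<open>g\<close> from the rest. Oddness is required of the signed weight
  only: under flips \<open>\<nu>\<close> itself is not invariant, yet \<open>\<nu>\<close> times the
  centred variable is odd. One statement thus serves flips and swaps.\<close>

lemma involution_ibp:
  fixes \<nu> \<omega> \<Phi> g :: "'s \<Rightarrow> real"
  assumes \<sigma>: "\<And>x. x \<in> S \<Longrightarrow> \<sigma> x \<in> S" "\<And>x. x \<in> S \<Longrightarrow> \<sigma> (\<sigma> x) = x"
    and \<omega>: "\<And>x. x \<in> S \<Longrightarrow> \<omega> (\<sigma> x) = - \<omega> x" "\<And>x. x \<in> S \<Longrightarrow> \<bar>\<omega> x\<bar> \<le> \<nu> x"
    and \<Phi>: "\<And>x. x \<in> S \<Longrightarrow> \<Phi> (\<sigma> x) = \<Phi> x"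
    and \<tau>: "\<tau> > 0"
  shows "(\<Sum>x\<in>S. \<omega> x * \<Phi> x * (g x)\<^sup>2)
    \<le> \<tau> / 4 * (\<Sum>x\<in>S. \<nu> x * (g (\<sigma> x) - g x)\<^sup>2) + 1 / \<tau> * (\<Sum>x\<in>S. \<nu> x * ((\<Phi> x)\<^sup>2 * (g x)\<^sup>2))"
proof -
  have bij: "bij_betw \<sigma> S S" by (rule bij_betw_byWitness[where f' = \<sigma>]) (use \<sigma> in auto)
  have re: "(\<Sum>x\<in>S. f (\<sigma> x)) = (\<Sum>x\<in>S. f x)" for f :: "'s \<Rightarrow> real"
    by (rule sum.reindex_bij_betw[OF bij])
  let ?I = "\<Sum>x\<in>S. \<omega> x * \<Phi> x * (g x)\<^sup>2"
  have "?I = (\<Sum>x\<in>S. \<omega> (\<sigma> x) * \<Phi> (\<sigma> x) * (g (\<sigma> x))\<^sup>2)" by (rule re[symmetric])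
  also have "\<dots> = - (\<Sum>x\<in>S. \<omega> x * \<Phi> x * (g (\<sigma> x))\<^sup>2)"
    using \<omega> \<Phi> by (simp add: sum_negf)
  finally have "2 * ?I = (\<Sum>x\<in>S. \<omega> x * \<Phi> x * ((g x)\<^sup>2 - (g (\<sigma> x))\<^sup>2))"
    by (simp add: right_diff_distrib sum_subtractf)
  \<comment> \<open>The last summand is written at \<open>\<sigma> x\<close> so that reindexing
    merges it with the one before it.\<close>
  also have "\<dots> \<le> (\<Sum>x\<in>S. \<tau> / 2 * (\<nu> x * (g (\<sigma> x) - g x)\<^sup>2)
       + 1 / \<tau> * (\<bar>\<omega> x\<bar> * (\<Phi> x)\<^sup>2 * (g x)\<^sup>2) + 1 / \<tau> * (\<bar>\<omega> (\<sigma> x)\<bar> * (\<Phi> (\<sigma> x))\<^sup>2 * (g (\<sigma> x))\<^sup>2))"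
  proof (rule sum_mono)
    fix x assume x: "x \<in> S"
    define p where "p = g x - g (\<sigma> x)"
    define q where "q = g x + g (\<sigma> x)"
    have young: "\<bar>\<Phi> x * p * q\<bar> \<le> \<tau> / 2 * p\<^sup>2 + 1 / (2 * \<tau>) * ((\<Phi> x)\<^sup>2 * q\<^sup>2)"
    proof -
      have "0 \<le> (\<tau> * \<bar>p\<bar> - \<bar>\<Phi> x * q\<bar>)\<^sup>2" by simp
      also have "\<dots> = \<tau>\<^sup>2 * p\<^sup>2 - 2 * \<tau> * (\<bar>p\<bar> * \<bar>\<Phi> x * q\<bar>) + (\<Phi> x * q)\<^sup>2"
        by (simp only: power2_diff power_mult_distrib power2_abs mult.assoc mult.left_commute)
      finally have "2 * \<tau> * (\<bar>p\<bar> * \<bar>\<Phi> x * q\<bar>) \<le> \<tau>\<^sup>2 * p\<^sup>2 + (\<Phi> x * q)\<^sup>2" by simp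
      then have "\<bar>p\<bar> * \<bar>\<Phi> x * q\<bar> \<le> (\<tau>\<^sup>2 * p\<^sup>2 + (\<Phi> x * q)\<^sup>2) / (2 * \<tau>)"
        using \<tau> by (simp add: pos_le_divide_eq mult.commute)
      also have "\<dots> = \<tau> / 2 * p\<^sup>2 + 1 / (2 * \<tau>) * ((\<Phi> x)\<^sup>2 * q\<^sup>2)"
        using \<tau> by (simp add: add_divide_distrib power2_eq_square)
      finally show ?thesis by (simp add: abs_mult mult_ac)
    qed
    have q2: "q\<^sup>2 \<le> 2 * (g x)\<^sup>2 + 2 * (g (\<sigma> x))\<^sup>2"
      using sum_squares_ge_zero[of "g x - g (\<sigma> x)" 0] by (simp add: q_def power2_eq_square algebra_simps)
    have "\<omega> x * \<Phi> x * ((g x)\<^sup>2 - (g (\<sigma> x))\<^sup>2) = \<omega> x * (\<Phi> x * p * q)"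
      by (simp add: p_def q_def power2_eq_square algebra_simps)
    also have "\<dots> \<le> \<bar>\<omega> x\<bar> * \<bar>\<Phi> x * p * q\<bar>" by (simp only: abs_mult[symmetric] abs_ge_self)
    also have "\<dots> \<le> \<bar>\<omega> x\<bar> * (\<tau> / 2 * p\<^sup>2 + 1 / (2 * \<tau>) * ((\<Phi> x)\<^sup>2 * (2 * (g x)\<^sup>2 + 2 * (g (\<sigma> x))\<^sup>2)))"
      using \<tau> by (intro mult_left_mono order_trans[OF young] add_left_mono q2) auto
    also have "\<dots> = \<tau> / 2 * (\<bar>\<omega> x\<bar> * p\<^sup>2) + 1 / \<tau> * (\<bar>\<omega> x\<bar> * (\<Phi> x)\<^sup>2 * (g x)\<^sup>2) + 1 / \<tau> * (\<bar>\<omega> x\<bar> * (\<Phi> x)\<^sup>2 * (g (\<sigma> x))\<^sup>2)"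
      using \<tau> by (simp add: field_simps)
    also have "\<tau> / 2 * (\<bar>\<omega> x\<bar> * p\<^sup>2) \<le> \<tau> / 2 * (\<nu> x * p\<^sup>2)"
      using \<tau> \<omega>(2)[OF x] by (intro mult_left_mono mult_right_mono) auto
    finally show "\<omega> x * \<Phi> x * ((g x)\<^sup>2 - (g (\<sigma> x))\<^sup>2) \<le> \<tau> / 2 * (\<nu> x * (g (\<sigma> x) - g x)\<^sup>2)
       + 1 / \<tau> * (\<bar>\<omega> x\<bar> * (\<Phi> x)\<^sup>2 * (g x)\<^sup>2) + 1 / \<tau> * (\<bar>\<omega> (\<sigma> x)\<bar> * (\<Phi> (\<sigma> x))\<^sup>2 * (g (\<sigma> x))\<^sup>2)"
      using \<omega>(1)[OF x] \<Phi>[OF x] by (simp add: p_def power2_commute)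
  qed
  also have "\<dots> = \<tau> / 2 * (\<Sum>x\<in>S. \<nu> x * (g (\<sigma> x) - g x)\<^sup>2) + 2 / \<tau> * (\<Sum>x\<in>S. \<bar>\<omega> x\<bar> * (\<Phi> x)\<^sup>2 * (g x)\<^sup>2)"
    unfolding sum.distrib sum_distrib_left[symmetric] re[of "\<lambda>x. \<bar>\<omega> x\<bar> * (\<Phi> x)\<^sup>2 * (g x)\<^sup>2"] by simp
  also have "\<dots> \<le> \<tau> / 2 * (\<Sum>x\<in>S. \<nu> x * (g (\<sigma> x) - g x)\<^sup>2) + 2 / \<tau> * (\<Sum>x\<in>S. \<nu> x * ((\<Phi> x)\<^sup>2 * (g x)\<^sup>2))"
    unfolding mult.assoc using \<omega>(2) \<tau> by (intro add_left_mono mult_left_mono sum_mono mult_right_mono) auto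
  finally have "2 * ?I \<le> \<tau> / 2 * (\<Sum>x\<in>S. \<nu> x * (g (\<sigma> x) - g x)\<^sup>2) + 2 / \<tau> * (\<Sum>x\<in>S. \<nu> x * ((\<Phi> x)\<^sup>2 * (g x)\<^sup>2))" .
  then show ?thesis by simp
qed

definition bexp :: "nat \<Rightarrow> real \<Rightarrow> (('d::finite) config \<Rightarrow> real) \<Rightarrow> real" where
  "bexp n \<rho> f = (\<Sum>\<eta>\<in>configs n. pmf (bernoulli_product n \<rho>) \<eta> * f \<eta>)"

definition ctr :: "real \<Rightarrow> ('d::finite) config \<Rightarrow> int ^ 'd \<Rightarrow> real" where
  "ctr \<rho> \<eta> x = real (\<eta> x) - \<rho>"

lemma finite_configs [simp]: "finite (configs n)"
  by (auto simp: configs_def intro!: finite_PiE)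

lemma configs_values: "\<eta> \<in> configs n \<Longrightarrow> x \<in> dtorus n \<Longrightarrow> \<eta> x = 0 \<or> \<eta> x = 1"
  by (auto simp: configs_def PiE_def Pi_def)

lemma flip_in_configs [simp]: "\<eta> \<in> configs n \<Longrightarrow> x \<in> dtorus n \<Longrightarrow> flip_conf \<eta> x \<in> configs n"
  by (auto simp: configs_def flip_conf_def PiE_def Pi_def extensional_def)

lemma flip_flip: "\<eta> \<in> configs n \<Longrightarrow> x \<in> dtorus n \<Longrightarrow> flip_conf (flip_conf \<eta> x) x = \<eta>"
  using configs_values[of \<eta> n x] by (auto simp: flip_conf_def fun_eq_iff)

lemma swap_in_configs [simp]:
  "\<eta> \<in> configs n \<Longrightarrow> x \<in> dtorus n \<Longrightarrow> y \<in> dtorus n \<Longrightarrow> swap_conf \<eta> x y \<in> configs n"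
  by (auto simp: configs_def swap_conf_def PiE_def Pi_def extensional_def)

lemma swap_swap: "swap_conf (swap_conf \<eta> x y) x y = \<eta>"
  by (auto simp: swap_conf_def fun_eq_iff)

lemma sum_flip:
  "x \<in> dtorus n \<Longrightarrow> (\<Sum>\<eta>\<in>configs n. f (flip_conf \<eta> x)) = (\<Sum>\<eta>\<in>configs n. f \<eta>)"
  by (rule sum.reindex_bij_betw, rule bij_betw_byWitness[where f' = "\<lambda>\<eta>. flip_conf \<eta> x"]) (auto simp: flip_flip)

lemma sum_swap_conf:
  "x \<in> dtorus n \<Longrightarrow> y \<in> dtorus n \<Longrightarrow> (\<Sum>\<eta>\<in>configs n. f (swap_conf \<eta> x y)) = (\<Sum>\<eta>\<in>configs n. f \<eta>)"
  by (rule sum.reindex_bij_betw, rule bij_betw_byWitness[where f' = "\<lambda>\<eta>. swap_conf \<eta> x y"]) (auto simp: swap_swap)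

lemma abs_ctr_le_1:
  "0 \<le> \<rho> \<Longrightarrow> \<rho> \<le> 1 \<Longrightarrow> \<eta> \<in> configs n \<Longrightarrow> x \<in> dtorus n \<Longrightarrow> \<bar>ctr \<rho> \<eta> x\<bar> \<le> 1"
  using configs_values[of \<eta> n x] by (auto simp: ctr_def)

context
  fixes n :: nat and \<rho> :: real
  assumes \<rho>: "0 < \<rho>" "\<rho> < 1"
begin

lemma pmf_bernoulli_product:
  assumes "\<eta> \<in> configs n"
  shows "pmf (bernoulli_product n \<rho>) \<eta> = (\<Prod>x\<in>dtorus n. if \<eta> x = 1 then \<rho> else 1 - \<rho>)"
proof -
  have *: "pmf (map_pmf (of_bool :: bool \<Rightarrow> nat) (bernoulli_pmf \<rho>)) k = (if k = 1 then \<rho> else 1 - \<rho>)" if "k = 0 \<or> k = 1" for k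
  proof -
    have inj: "inj (of_bool :: bool \<Rightarrow> nat)" by (auto simp: inj_def of_bool_def split: if_splits)
    have "k = of_bool (k = 1)" using that by auto
    then have "pmf (map_pmf (of_bool :: bool \<Rightarrow> nat) (bernoulli_pmf \<rho>)) k = pmf (bernoulli_pmf \<rho>) (k = 1)"
      using pmf_map_inj'[OF inj, of "bernoulli_pmf \<rho>" "k = 1"] by simp
    then show ?thesis using \<rho> by auto
  qed
  have "pmf (bernoulli_product n \<rho>) \<eta> = (\<Prod>x\<in>dtorus n. pmf (map_pmf (of_bool :: bool \<Rightarrow> nat) (bernoulli_pmf \<rho>)) (\<eta> x))"
    unfolding bernoulli_product_def
    by (rule pmf_Pi') (use assms in \<open>auto simp: configs_def PiE_def extensional_def\<close>)
  also have "\<dots> = (\<Prod>x\<in>dtorus n. if \<eta> x = 1 then \<rho> else 1 - \<rho>)"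
    by (intro prod.cong refl *) (use configs_values[OF assms] in auto)
  finally show ?thesis .
qed

lemma pmf_swap:
  assumes \<eta>: "\<eta> \<in> configs n" and x: "x \<in> dtorus n" and y: "y \<in> dtorus n"
  shows "pmf (bernoulli_product n \<rho>) (swap_conf \<eta> x y) = pmf (bernoulli_product n \<rho>) \<eta>"
proof -
  let ?t = "Transposition.transpose x y"
  have bij: "bij_betw ?t (dtorus n) (dtorus n)"
    by (rule bij_betw_byWitness[where f' = ?t]) (use x y in \<open>auto simp: Transposition.transpose_def\<close>)
  have "swap_conf \<eta> x y z = \<eta> (?t z)" for z
    by (auto simp: swap_conf_def Transposition.transpose_def)
  then have "pmf (bernoulli_product n \<rho>) (swap_conf \<eta> x y) = (\<Prod>z\<in>dtorus n. if \<eta> (?t z) = 1 then \<rho> else 1 - \<rho>)"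
    using \<eta> x y by (simp add: pmf_bernoulli_product)
  also have "\<dots> = (\<Prod>z\<in>dtorus n. if \<eta> z = 1 then \<rho> else 1 - \<rho>)"
    by (rule prod.reindex_bij_betw[OF bij])
  finally show ?thesis using \<eta> by (simp add: pmf_bernoulli_product)
qed

lemma pmf_flip:
  assumes \<eta>: "\<eta> \<in> configs n" and x: "x \<in> dtorus n"
  shows "pmf (bernoulli_product n \<rho>) (flip_conf \<eta> x) * (if \<eta> x = 1 then \<rho> else 1 - \<rho>)
    = pmf (bernoulli_product n \<rho>) \<eta> * (if \<eta> x = 1 then 1 - \<rho> else \<rho>)"
proof -
  define R where "R = (\<Prod>z\<in>dtorus n - {x}. if \<eta> z = 1 then \<rho> else 1 - \<rho>)"
  have "pmf (bernoulli_product n \<rho>) \<eta> = (if \<eta> x = 1 then \<rho> else 1 - \<rho>) * R"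
    unfolding pmf_bernoulli_product[OF \<eta>] R_def using x by (subst prod.remove[of _ x]) auto
  moreover have "pmf (bernoulli_product n \<rho>) (flip_conf \<eta> x) = (if \<eta> x = 1 then 1 - \<rho> else \<rho>) * R"
  proof -
    have "(\<Prod>z\<in>dtorus n - {x}. if flip_conf \<eta> x z = 1 then \<rho> else 1 - \<rho>) = R"
      unfolding R_def by (intro prod.cong) (auto simp: flip_conf_def)
    moreover have "(flip_conf \<eta> x x = 1) = (\<eta> x \<noteq> 1)"
      using configs_values[OF \<eta> x] by (auto simp: flip_conf_def)
    ultimately show ?thesis
      using \<eta> x by (subst pmf_bernoulli_product) (simp, subst prod.remove[of _ x], auto)
  qed
  ultimately show ?thesis by simp
qed

text \<open>Occupied and empty sites carry the one-site values \<open>\<rho> (1 - \<rho>)\<close>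
  and \<open>(1 - \<rho>) (- \<rho>)\<close> of weight times centred variable: centring at the
  density of the measure makes the product odd.\<close>

lemma ctr_weight_flip:
  assumes \<eta>: "\<eta> \<in> configs n" and x: "x \<in> dtorus n"
  shows "pmf (bernoulli_product n \<rho>) (flip_conf \<eta> x) * ctr \<rho> (flip_conf \<eta> x) x
     = - (pmf (bernoulli_product n \<rho>) \<eta> * ctr \<rho> \<eta> x)"
  using pmf_flip[OF assms] configs_values[OF assms] by (auto simp: ctr_def flip_conf_def algebra_simps)

lemma ctr_flip_other: "y \<noteq> x \<Longrightarrow> ctr \<rho> (flip_conf \<eta> x) y = ctr \<rho> \<eta> y"
  by (simp add: ctr_def flip_conf_def)

lemma flip_ibp:
  fixes x :: "int ^ 'd::finite"
  assumes x: "x \<in> dtorus n" and \<Phi>: "\<And>\<eta>. \<eta> \<in> configs n \<Longrightarrow> \<Phi> (flip_conf \<eta> x) = \<Phi> \<eta>" and \<tau>: "\<tau> > 0"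
  shows "bexp n \<rho> (\<lambda>\<eta>. ctr \<rho> \<eta> x * \<Phi> \<eta> * (g \<eta>)\<^sup>2)
    \<le> \<tau> / 4 * bexp n \<rho> (\<lambda>\<eta>. (g (flip_conf \<eta> x) - g \<eta>)\<^sup>2) + 1 / \<tau> * bexp n \<rho> (\<lambda>\<eta>. (\<Phi> \<eta>)\<^sup>2 * (g \<eta>)\<^sup>2)"
proof -
  have "(\<Sum>\<eta>\<in>configs n. (pmf (bernoulli_product n \<rho>) \<eta> * ctr \<rho> \<eta> x) * \<Phi> \<eta> * (g \<eta>)\<^sup>2)
    \<le> \<tau> / 4 * (\<Sum>\<eta>\<in>configs n. pmf (bernoulli_product n \<rho>) \<eta> * (g (flip_conf \<eta> x) - g \<eta>)\<^sup>2)
     + 1 / \<tau> * (\<Sum>\<eta>\<in>configs n. pmf (bernoulli_product n \<rho>) \<eta> * ((\<Phi> \<eta>)\<^sup>2 * (g \<eta>)\<^sup>2))"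
  proof (rule involution_ibp)
    fix \<eta> :: "'d config" assume \<eta>: "\<eta> \<in> configs n"
    show "\<bar>pmf (bernoulli_product n \<rho>) \<eta> * ctr \<rho> \<eta> x\<bar> \<le> pmf (bernoulli_product n \<rho>) \<eta>"
      using abs_ctr_le_1[OF _ _ \<eta> x, of \<rho>] \<rho> by (auto simp: abs_mult intro!: mult_left_le)
  qed (use x \<Phi> \<tau> in \<open>auto simp: flip_flip ctr_weight_flip\<close>)
  then show ?thesis by (simp add: bexp_def mult.assoc)
qed

lemma swap_ibp:
  fixes x y :: "int ^ 'd::finite"
  assumes x: "x \<in> dtorus n" and y: "y \<in> dtorus n"
    and \<Phi>: "\<And>\<eta>. \<eta> \<in> configs n \<Longrightarrow> \<Phi> (swap_conf \<eta> x y) = \<Phi> \<eta>" and \<tau>: "\<tau> > 0"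
  shows "bexp n \<rho> (\<lambda>\<eta>. (ctr \<rho> \<eta> y - ctr \<rho> \<eta> x) * \<Phi> \<eta> * (g \<eta>)\<^sup>2)
    \<le> \<tau> / 4 * bexp n \<rho> (\<lambda>\<eta>. (g (swap_conf \<eta> x y) - g \<eta>)\<^sup>2) + 1 / \<tau> * bexp n \<rho> (\<lambda>\<eta>. (\<Phi> \<eta>)\<^sup>2 * (g \<eta>)\<^sup>2)"
proof -
  have "(\<Sum>\<eta>\<in>configs n. (pmf (bernoulli_product n \<rho>) \<eta> * (ctr \<rho> \<eta> y - ctr \<rho> \<eta> x)) * \<Phi> \<eta> * (g \<eta>)\<^sup>2)
    \<le> \<tau> / 4 * (\<Sum>\<eta>\<in>configs n. pmf (bernoulli_product n \<rho>) \<eta> * (g (swap_conf \<eta> x y) - g \<eta>)\<^sup>2)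
     + 1 / \<tau> * (\<Sum>\<eta>\<in>configs n. pmf (bernoulli_product n \<rho>) \<eta> * ((\<Phi> \<eta>)\<^sup>2 * (g \<eta>)\<^sup>2))"
  proof (rule involution_ibp)
    fix \<eta> :: "'d config" assume \<eta>: "\<eta> \<in> configs n"
    have "\<bar>ctr \<rho> \<eta> y - ctr \<rho> \<eta> x\<bar> \<le> 1"
      using configs_values[OF \<eta> x] configs_values[OF \<eta> y] by (auto simp: ctr_def)
    then show "\<bar>pmf (bernoulli_product n \<rho>) \<eta> * (ctr \<rho> \<eta> y - ctr \<rho> \<eta> x)\<bar> \<le> pmf (bernoulli_product n \<rho>) \<eta>"
      by (auto simp: abs_mult intro!: mult_left_le)
    have "ctr \<rho> (swap_conf \<eta> x y) y - ctr \<rho> (swap_conf \<eta> x y) x = - (ctr \<rho> \<eta> y - ctr \<rho> \<eta> x)"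
      by (auto simp: ctr_def swap_conf_def)
    note odd = this
    show "pmf (bernoulli_product n \<rho>) (swap_conf \<eta> x y) * (ctr \<rho> (swap_conf \<eta> x y) y - ctr \<rho> (swap_conf \<eta> x y) x)
      = - (pmf (bernoulli_product n \<rho>) \<eta> * (ctr \<rho> \<eta> y - ctr \<rho> \<eta> x))"
      unfolding odd pmf_swap[OF \<eta> x y] by (rule mult_minus_right)
  qed (use x y \<Phi> \<tau> in \<open>auto simp: swap_swap\<close>)
  then show ?thesis by (simp add: bexp_def mult.assoc)
qed

end

section \<open>Expectations, Dirichlet energies and the bound on the nearest neighbour sum\<close>

lemma bexp_add: "bexp n \<rho> (\<lambda>\<eta>. f \<eta> + g \<eta>) = bexp n \<rho> f + bexp n \<rho> g"
  by (simp add: bexp_def distrib_left sum.distrib)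

lemma bexp_diff: "bexp n \<rho> (\<lambda>\<eta>. f \<eta> - g \<eta>) = bexp n \<rho> f - bexp n \<rho> g"
  by (simp add: bexp_def right_diff_distrib sum_subtractf)

lemma bexp_cmult: "bexp n \<rho> (\<lambda>\<eta>. c * f \<eta>) = c * bexp n \<rho> f"
  by (simp add: bexp_def sum_distrib_left mult_ac)

lemma bexp_sum: "bexp n \<rho> (\<lambda>\<eta>. \<Sum>i\<in>I. f i \<eta>) = (\<Sum>i\<in>I. bexp n \<rho> (f i))"
  by (simp add: bexp_def sum_distrib_left sum.swap[of _ I])

lemma bexp_mono: "(\<And>\<eta>. \<eta> \<in> configs n \<Longrightarrow> f \<eta> \<le> g \<eta>) \<Longrightarrow> bexp n \<rho> f \<le> bexp n \<rho> g"
  unfolding bexp_def by (intro sum_mono mult_left_mono) auto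

lemma bexp_cong: "(\<And>\<eta>. \<eta> \<in> configs n \<Longrightarrow> f \<eta> = g \<eta>) \<Longrightarrow> bexp n \<rho> f = bexp n \<rho> g"
  unfolding bexp_def by (intro sum.cong) auto

lemma bexp_nonneg: "(\<And>\<eta>. \<eta> \<in> configs n \<Longrightarrow> 0 \<le> f \<eta>) \<Longrightarrow> 0 \<le> bexp n \<rho> f"
  unfolding bexp_def by (intro sum_nonneg mult_nonneg_nonneg) auto

lemma bexp_bond_sum: "bexp n \<rho> (\<lambda>\<eta>. bond_sum n (\<lambda>z j. f z j \<eta>)) = bond_sum n (\<lambda>z j. bexp n \<rho> (f z j))"
  by (simp add: bond_sum_def bexp_sum)

text \<open>Neither this energy nor \<open>swap_energy\<close> contains jump rates; the factor
  \<open>n^2\<close> of the exclusion and a lower bound on the flip rates are inserted when the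
  generator is estimated.\<close>

definition flip_energy :: "nat \<Rightarrow> real \<Rightarrow> (('d::finite) config \<Rightarrow> real) \<Rightarrow> real" where
  "flip_energy n \<rho> g = (\<Sum>x\<in>dtorus n. bexp n \<rho> (\<lambda>\<eta>. (g (flip_conf \<eta> x) - g \<eta>)\<^sup>2))"

definition swap_energy :: "nat \<Rightarrow> real \<Rightarrow> (('d::finite) config \<Rightarrow> real) \<Rightarrow> real" where
  "swap_energy n \<rho> g = bond_sum n (\<lambda>z j. bexp n \<rho> (\<lambda>\<eta>. (g (swap_conf \<eta> z (shift n z j)) - g \<eta>)\<^sup>2))"

context
  fixes n :: nat and \<rho> :: real and g :: "('d::finite) config \<Rightarrow> real"
  assumes n: "n \<ge> 2" and \<rho>: "0 < \<rho>" "\<rho> < 1"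
begin

lemma green_0_bounds: "0 \<le> green n (0 :: int ^ 'd)" "green n (0 :: int ^ 'd) \<le> 1"
proof -
  have n1: "n \<ge> 1" using n by simp
  have N: "real n ^ CARD('d) > 0" using n by simp
  have eq: "real n ^ CARD('d) * green n (0 :: int ^ 'd) = (\<Sum>k\<in>(dtorus n :: (int ^ 'd) set). green_mult n k)"
    by (rule green_trace[OF n1])
  have "0 \<le> (\<Sum>k\<in>(dtorus n :: (int ^ 'd) set). green_mult n k)"
    using green_mult_bounds(1)[OF n1] by (intro sum_nonneg) auto
  then show "0 \<le> green n (0 :: int ^ 'd)" using N unfolding eq[symmetric] by (simp add: zero_le_mult_iff)
  have "(\<Sum>k\<in>(dtorus n :: (int ^ 'd) set). green_mult n k) \<le> (\<Sum>k\<in>(dtorus n :: (int ^ 'd) set). 1)"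
    using green_mult_bounds(2)[OF n1] by (intro sum_mono) auto
  then have "real n ^ CARD('d) * green n (0 :: int ^ 'd) \<le> real n ^ CARD('d) * 1"
    by (simp add: eq card_dtorus)
  then show "green n (0 :: int ^ 'd) \<le> 1" using N by (simp only: mult_le_cancel_left_pos)
qed

text \<open>Integration by parts with the flip at \<open>x\<close> needs a factor that does not see
  \<open>\<eta> x\<close>, so the diagonal entry \<open>G0\<close> is split off; the diagonal
  contributes the trace. The remaining squared potentials are bounded by the Green form again. With
  Young parameter 4 its expectation returns with coefficient 1/2 and is absorbed on the left, which
  doubles the other terms.\<close>

lemma bexp_gform_le:
  "bexp n \<rho> (\<lambda>\<eta>. gform n (ctr \<rho> \<eta>) * (g \<eta>)\<^sup>2)
    \<le> 2 * flip_energy n \<rho> g + 3 * (\<Sum>k\<in>(dtorus n :: (int ^ 'd) set). green_mult n k) * bexp n \<rho> (\<lambda>\<eta>. (g \<eta>)\<^sup>2)"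
proof -
  have n1: "n \<ge> 1" using n by simp
  let ?T = "dtorus n :: (int ^ 'd) set" and ?N = "real n ^ CARD('d)"
  let ?M = "bexp n \<rho> (\<lambda>\<eta>. (g \<eta>)\<^sup>2)"
  let ?X = "bexp n \<rho> (\<lambda>\<eta>. gform n (ctr \<rho> \<eta>) * (g \<eta>)\<^sup>2)"
  define G0 where "G0 = green n (0 :: int ^ 'd)"
  have G0: "0 \<le> G0" "G0 \<le> 1" using green_0_bounds by (auto simp: G0_def)
  have tr: "(\<Sum>k\<in>?T. green_mult n k) = ?N * G0" unfolding G0_def by (rule green_trace[OF n1, symmetric])
  define \<Phi> where "\<Phi> x \<eta> = (\<Sum>y\<in>?T - {x}. green n (x - y) * ctr \<rho> \<eta> y)" for x \<eta>
  have pot: "gpot n (ctr \<rho> \<eta>) x = \<Phi> x \<eta> + G0 * ctr \<rho> \<eta> x" if "x \<in> ?T" for x \<eta>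
    using that by (simp add: gpot_def \<Phi>_def G0_def sum.remove[of _ x])
  have c1: "(ctr \<rho> \<eta> x)\<^sup>2 \<le> 1" if "\<eta> \<in> configs n" "x \<in> ?T" for \<eta> x
    using abs_ctr_le_1[OF _ _ that, of \<rho>] \<rho> by (simp add: abs_square_le_1)
  have "?X = bexp n \<rho> (\<lambda>\<eta>. (\<Sum>x\<in>?T. ctr \<rho> \<eta> x * \<Phi> x \<eta> * (g \<eta>)\<^sup>2) + (\<Sum>x\<in>?T. G0 * (ctr \<rho> \<eta> x)\<^sup>2) * (g \<eta>)\<^sup>2)"
    unfolding gform_def sum_distrib_right sum.distrib[symmetric]
    by (intro bexp_cong sum.cong refl) (simp add: pot power2_eq_square algebra_simps)
  also have "\<dots> \<le> bexp n \<rho> (\<lambda>\<eta>. (\<Sum>x\<in>?T. ctr \<rho> \<eta> x * \<Phi> x \<eta> * (g \<eta>)\<^sup>2) + (\<Sum>x\<in>?T. G0 * 1) * (g \<eta>)\<^sup>2)"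
    using c1 G0 by (intro bexp_mono add_left_mono mult_right_mono sum_mono mult_left_mono) auto
  also have "\<dots> = (\<Sum>x\<in>?T. bexp n \<rho> (\<lambda>\<eta>. ctr \<rho> \<eta> x * \<Phi> x \<eta> * (g \<eta>)\<^sup>2)) + ?N * G0 * ?M"
    by (simp add: bexp_add bexp_sum bexp_cmult card_dtorus)
  also have "(\<Sum>x\<in>?T. bexp n \<rho> (\<lambda>\<eta>. ctr \<rho> \<eta> x * \<Phi> x \<eta> * (g \<eta>)\<^sup>2))
     \<le> (\<Sum>x\<in>?T. 4 / 4 * bexp n \<rho> (\<lambda>\<eta>. (g (flip_conf \<eta> x) - g \<eta>)\<^sup>2) + 1 / 4 * bexp n \<rho> (\<lambda>\<eta>. (\<Phi> x \<eta>)\<^sup>2 * (g \<eta>)\<^sup>2))"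
  proof (intro sum_mono flip_ibp \<rho>)
    fix x and \<eta> :: "'d config" assume "x \<in> ?T"
    show "\<Phi> x (flip_conf \<eta> x) = \<Phi> x \<eta>"
      unfolding \<Phi>_def by (intro sum.cong refl) (simp add: ctr_flip_other[OF \<rho>])
  qed auto
  also have "\<dots> = flip_energy n \<rho> g + 1 / 4 * bexp n \<rho> (\<lambda>\<eta>. (\<Sum>x\<in>?T. (\<Phi> x \<eta>)\<^sup>2) * (g \<eta>)\<^sup>2)"
    by (simp add: sum.distrib flip_energy_def sum_distrib_right bexp_sum sum_divide_distrib)
  also have "bexp n \<rho> (\<lambda>\<eta>. (\<Sum>x\<in>?T. (\<Phi> x \<eta>)\<^sup>2) * (g \<eta>)\<^sup>2)
     \<le> bexp n \<rho> (\<lambda>\<eta>. 2 * (gform n (ctr \<rho> \<eta>) * (g \<eta>)\<^sup>2) + 2 * (?N * G0) * (g \<eta>)\<^sup>2)"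
  proof (rule bexp_mono)
    fix \<eta> :: "'d config" assume \<eta>: "\<eta> \<in> configs n"
    have "(\<Sum>x\<in>?T. (\<Phi> x \<eta>)\<^sup>2) \<le> (\<Sum>x\<in>?T. 2 * (gpot n (ctr \<rho> \<eta>) x)\<^sup>2 + 2 * G0)"
    proof (rule sum_mono)
      fix x assume x: "x \<in> ?T"
      have young: "(x - y)\<^sup>2 \<le> 2 * x\<^sup>2 + 2 * y\<^sup>2" for x y :: real
        using zero_le_power2[of "x + y"] by (simp add: power2_sum power2_diff)
      have "(\<Phi> x \<eta>)\<^sup>2 = (gpot n (ctr \<rho> \<eta>) x - G0 * ctr \<rho> \<eta> x)\<^sup>2" by (simp add: pot[OF x])
      also have "\<dots> \<le> 2 * (gpot n (ctr \<rho> \<eta>) x)\<^sup>2 + 2 * (G0 * ctr \<rho> \<eta> x)\<^sup>2" by (rule young)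
      \<comment> \<open>Since \<open>G0\<close> lies in [0,1], its square is at most
        \<open>G0\<close>; in this way the error too is a multiple of the trace.\<close>
      also have "(G0 * ctr \<rho> \<eta> x)\<^sup>2 \<le> G0 * 1"
        unfolding power_mult_distrib using G0 c1[OF \<eta> x]
        by (intro mult_mono) (auto simp: power2_eq_square intro!: mult_left_le)
      finally show "(\<Phi> x \<eta>)\<^sup>2 \<le> 2 * (gpot n (ctr \<rho> \<eta>) x)\<^sup>2 + 2 * G0" by simp
    qed
    also have "\<dots> = 2 * (\<Sum>x\<in>?T. (gpot n (ctr \<rho> \<eta>) x)\<^sup>2) + 2 * (?N * G0)"
      by (simp add: sum.distrib sum_distrib_left card_dtorus)
    also have "\<dots> \<le> 2 * gform n (ctr \<rho> \<eta>) + 2 * (?N * G0)"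
      using gpot_sq_le[OF n, of "ctr \<rho> \<eta>"] by simp
    finally have "(\<Sum>x\<in>?T. (\<Phi> x \<eta>)\<^sup>2) * (g \<eta>)\<^sup>2 \<le> (2 * gform n (ctr \<rho> \<eta>) + 2 * (?N * G0)) * (g \<eta>)\<^sup>2"
      by (rule mult_right_mono) simp
    then show "(\<Sum>x\<in>?T. (\<Phi> x \<eta>)\<^sup>2) * (g \<eta>)\<^sup>2 \<le> 2 * (gform n (ctr \<rho> \<eta>) * (g \<eta>)\<^sup>2) + 2 * (?N * G0) * (g \<eta>)\<^sup>2"
      by (simp only: distrib_right mult.assoc)
  qed
  also have "\<dots> = 2 * ?X + 2 * (?N * G0) * ?M" by (simp only: bexp_add bexp_cmult)
  finally have "?X \<le> flip_energy n \<rho> g + 1 / 4 * (2 * ?X + 2 * (?N * G0) * ?M) + ?N * G0 * ?M" by simp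
  then have "?X \<le> 2 * flip_energy n \<rho> g + 3 * (?N * G0 * ?M)" by (simp add: algebra_simps)
  then show ?thesis by (simp add: tr mult.assoc)
qed

text \<open>The flow through a bond ignores both end points, so it is invariant under the swap
  across that bond. Young parameter 1 costs a quarter of the swap energy, half of what the exclusion
  part provides. The sign \<open>s\<close> yields both one-sided bounds, hence one on the absolute
  value.\<close>

lemma bond_ibp:
  assumes s: "s = 1 \<or> s = (- 1 :: real)"
  shows "s * bexp n \<rho> (\<lambda>\<eta>. bond_sum n (\<lambda>z j. (ctr \<rho> \<eta> (shift n z j) - ctr \<rho> \<eta> z) * bond_flow n (ctr \<rho> \<eta>) z j) * (g \<eta>)\<^sup>2)
    \<le> 1 / 4 * swap_energy n \<rho> g + bexp n \<rho> (\<lambda>\<eta>. bond_sum n (\<lambda>z j. (bond_flow n (ctr \<rho> \<eta>) z j)\<^sup>2) * (g \<eta>)\<^sup>2)"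
proof -
  let ?h = "\<lambda>z j \<eta>. bond_flow n (ctr \<rho> \<eta>) z j"
  have n1: "n \<ge> 1" using n by simp
  have "s * bexp n \<rho> (\<lambda>\<eta>. bond_sum n (\<lambda>z j. (ctr \<rho> \<eta> (shift n z j) - ctr \<rho> \<eta> z) * ?h z j \<eta>) * (g \<eta>)\<^sup>2)
     = bond_sum n (\<lambda>z j. bexp n \<rho> (\<lambda>\<eta>. (ctr \<rho> \<eta> (shift n z j) - ctr \<rho> \<eta> z) * (s * ?h z j \<eta>) * (g \<eta>)\<^sup>2))"
    unfolding bexp_cmult[symmetric] bexp_bond_sum[symmetric] bond_sum_def
    by (simp add: sum_distrib_left sum_distrib_right mult_ac)
  also have "\<dots> \<le> bond_sum n (\<lambda>z j. 1 / 4 * bexp n \<rho> (\<lambda>\<eta>. (g (swap_conf \<eta> z (shift n z j)) - g \<eta>)\<^sup>2)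
        + 1 / 1 * bexp n \<rho> (\<lambda>\<eta>. (s * ?h z j \<eta>)\<^sup>2 * (g \<eta>)\<^sup>2))"
    unfolding bond_sum_def
  proof (intro sum_mono swap_ibp \<rho>)
    fix z :: "int ^ 'd" and j and \<eta> :: "'d config" assume z: "z \<in> dtorus n"
    then show "z \<in> dtorus n" "shift n z j \<in> dtorus n" using n1 by auto
    have "?h z j (swap_conf \<eta> z (shift n z j)) = ?h z j \<eta>"
      unfolding bond_flow_def by (intro sum.cong refl) (auto simp: ctr_def swap_conf_def)
    then show "s * ?h z j (swap_conf \<eta> z (shift n z j)) = s * ?h z j \<eta>" by simp
  qed auto
  also have "\<dots> = 1 / 4 * swap_energy n \<rho> g + bond_sum n (\<lambda>z j. bexp n \<rho> (\<lambda>\<eta>. (?h z j \<eta>)\<^sup>2 * (g \<eta>)\<^sup>2))"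
    using s unfolding swap_energy_def bond_sum_def
    by (auto simp: sum.distrib sum_distrib_left power_mult_distrib)
  also have "bond_sum n (\<lambda>z j. bexp n \<rho> (\<lambda>\<eta>. (?h z j \<eta>)\<^sup>2 * (g \<eta>)\<^sup>2))
     = bexp n \<rho> (\<lambda>\<eta>. bond_sum n (\<lambda>z j. (?h z j \<eta>)\<^sup>2) * (g \<eta>)\<^sup>2)"
    unfolding bexp_bond_sum[symmetric] by (simp add: bond_sum_def sum_distrib_right)
  finally show ?thesis .
qed

text \<open>The coefficient \<open>c\<close> of the nearest neighbour sum in the flow identity is at
  least \<open>1 / (2 d)\<close>, because \<open>n^d >= 2\<close>; this is the origin of the
  prefactor \<open>2 d\<close>.\<close>

lemma bexp_nn_sum_le:
  "\<bar>bexp n \<rho> (\<lambda>\<eta>. nn_sum n (ctr \<rho> \<eta>) * (g \<eta>)\<^sup>2)\<bar>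
    \<le> 2 * real CARD('d) * ((real n)\<^sup>2 / 4 * swap_energy n \<rho> g + 10 * flip_energy n \<rho> g
       + (15 * (\<Sum>k\<in>(dtorus n :: (int ^ 'd) set). green_mult n k) + real n ^ CARD('d) / (real n)\<^sup>2 + 1)
           * bexp n \<rho> (\<lambda>\<eta>. (g \<eta>)\<^sup>2))"
proof -
  let ?N = "real n ^ CARD('d)" and ?d = "real CARD('d)" and ?T = "dtorus n :: (int ^ 'd) set"
  let ?M = "bexp n \<rho> (\<lambda>\<eta>. (g \<eta>)\<^sup>2)"
  let ?X = "bexp n \<rho> (\<lambda>\<eta>. gform n (ctr \<rho> \<eta>) * (g \<eta>)\<^sup>2)"
  let ?W = "bexp n \<rho> (\<lambda>\<eta>. nn_sum n (ctr \<rho> \<eta>) * (g \<eta>)\<^sup>2)"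
  define B where "B = bexp n \<rho> (\<lambda>\<eta>. bond_sum n (\<lambda>z j. (ctr \<rho> \<eta> (shift n z j) - ctr \<rho> \<eta> z) * bond_flow n (ctr \<rho> \<eta>) z j) * (g \<eta>)\<^sup>2)"
  define A where "A = bexp n \<rho> (\<lambda>\<eta>. (\<Sum>z\<in>?T. ctr \<rho> \<eta> z)\<^sup>2 / ?N * (g \<eta>)\<^sup>2)"
  define U where "U = bexp n \<rho> (\<lambda>\<eta>. (\<Sum>z\<in>?T. (ctr \<rho> \<eta> z)\<^sup>2) / ?N * (g \<eta>)\<^sup>2)"
  define F where "F = bexp n \<rho> (\<lambda>\<eta>. bond_sum n (\<lambda>z j. (bond_flow n (ctr \<rho> \<eta>) z j)\<^sup>2) * (g \<eta>)\<^sup>2)"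
  define c where "c = (1 - 1 / ?N) / ?d"
  have n1: "n \<ge> 1" using n by simp
  have d: "?d \<ge> 1" using zero_less_card_finite[where 'a = 'd] by linarith
  have N2: "?N \<ge> 2"
  proof -
    have "2 \<le> real n ^ 1" using n by simp
    also have "\<dots> \<le> ?N" using n zero_less_card_finite[where 'a = 'd] by (intro power_increasing) auto
    finally show ?thesis .
  qed
  have id: "c * ?W = (real n)\<^sup>2 * B + A - U"
    unfolding B_def A_def U_def bexp_cmult[symmetric] bexp_add[symmetric] bexp_diff[symmetric]
  proof (rule bexp_cong)
    fix \<eta> :: "'d config"
    show "c * (nn_sum n (ctr \<rho> \<eta>) * (g \<eta>)\<^sup>2) = (real n)\<^sup>2 * (bond_sum n (\<lambda>z j. (ctr \<rho> \<eta> (shift n z j) - ctr \<rho> \<eta> z) * bond_flow n (ctr \<rho> \<eta>) z j) * (g \<eta>)\<^sup>2)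
       + (\<Sum>z\<in>?T. ctr \<rho> \<eta> z)\<^sup>2 / ?N * (g \<eta>)\<^sup>2 - (\<Sum>z\<in>?T. (ctr \<rho> \<eta> z)\<^sup>2) / ?N * (g \<eta>)\<^sup>2"
      unfolding mult.assoc[symmetric] left_diff_distrib[symmetric] distrib_right[symmetric]
      unfolding c_def nn_sum_flow[OF n] ..
  qed
  have A: "0 \<le> A" "A \<le> ?X"
  proof -
    show "0 \<le> A" unfolding A_def by (intro bexp_nonneg mult_nonneg_nonneg divide_nonneg_nonneg) auto
    show "A \<le> ?X" unfolding A_def by (intro bexp_mono mult_right_mono sum_sq_le_gform[OF n]) simp
  qed
  have U: "0 \<le> U" "U \<le> ?M"
  proof -
    show "0 \<le> U" unfolding U_def by (intro bexp_nonneg mult_nonneg_nonneg divide_nonneg_nonneg sum_nonneg) auto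
    have "U \<le> bexp n \<rho> (\<lambda>\<eta>. 1 * (g \<eta>)\<^sup>2)"
      unfolding U_def
    proof (intro bexp_mono mult_right_mono)
      fix \<eta> :: "'d config" assume \<eta>: "\<eta> \<in> configs n"
      have "(\<Sum>z\<in>?T. (ctr \<rho> \<eta> z)\<^sup>2) \<le> (\<Sum>z\<in>?T. 1)"
        using abs_ctr_le_1[OF _ _ \<eta>, of \<rho>] \<rho> by (intro sum_mono) (simp add: abs_square_le_1)
      then show "(\<Sum>z\<in>?T. (ctr \<rho> \<eta> z)\<^sup>2) / ?N \<le> 1" using N2 by (simp add: card_dtorus divide_le_eq)
    qed auto
    then show "U \<le> ?M" by simp
  qed
  have F: "(real n)\<^sup>2 * F \<le> 4 * ?X + ?N / (real n)\<^sup>2 * ?M"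
    unfolding F_def bexp_cmult[symmetric] bexp_add[symmetric]
  proof (rule bexp_mono)
    fix \<eta> :: "'d config" assume \<eta>: "\<eta> \<in> configs n"
    have "\<bar>ctr \<rho> \<eta> (shift n z j) - ctr \<rho> \<eta> z\<bar> \<le> 1" if "z \<in> dtorus n" for z j
      using configs_values[OF \<eta> that] configs_values[OF \<eta> shift_in_dtorus[OF n1], of z j]
      by (auto simp: ctr_def)
    then have "(real n)\<^sup>2 * bond_sum n (\<lambda>z j. (bond_flow n (ctr \<rho> \<eta>) z j)\<^sup>2) * (g \<eta>)\<^sup>2
       \<le> (4 * gform n (ctr \<rho> \<eta>) + ?N / (real n)\<^sup>2) * (g \<eta>)\<^sup>2"
      by (intro mult_right_mono bond_flow_sq_le[OF n]) auto
    then show "(real n)\<^sup>2 * (bond_sum n (\<lambda>z j. (bond_flow n (ctr \<rho> \<eta>) z j)\<^sup>2) * (g \<eta>)\<^sup>2)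
       \<le> 4 * (gform n (ctr \<rho> \<eta>) * (g \<eta>)\<^sup>2) + ?N / (real n)\<^sup>2 * (g \<eta>)\<^sup>2"
      by (simp only: distrib_right mult.assoc)
  qed
  have "\<bar>B\<bar> \<le> 1 / 4 * swap_energy n \<rho> g + F"
    using bond_ibp[of 1] bond_ibp[of "- 1"] unfolding B_def F_def by linarith
  then have "(real n)\<^sup>2 * \<bar>B\<bar> \<le> (real n)\<^sup>2 * (1 / 4 * swap_energy n \<rho> g + F)"
    by (rule mult_left_mono) simp
  also have "\<dots> = (real n)\<^sup>2 / 4 * swap_energy n \<rho> g + (real n)\<^sup>2 * F" by (simp add: distrib_left)
  finally have B: "(real n)\<^sup>2 * \<bar>B\<bar> \<le> (real n)\<^sup>2 / 4 * swap_energy n \<rho> g + 4 * ?X + ?N / (real n)\<^sup>2 * ?M"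
    using F by linarith
  have M0: "0 \<le> ?M" by (intro bexp_nonneg) simp
  have c: "1 / (2 * ?d) \<le> c"
  proof -
    have "1 / ?N \<le> 1 / 2" using N2 by (intro frac_le) auto
    then have "1 / 2 \<le> 1 - 1 / ?N" by simp
    then have "1 / 2 / ?d \<le> c" unfolding c_def using d by (intro divide_right_mono) auto
    then show ?thesis by simp
  qed
  have "1 / (2 * ?d) * \<bar>?W\<bar> \<le> c * \<bar>?W\<bar>" using c by (intro mult_right_mono) auto
  also have "\<dots> = \<bar>(real n)\<^sup>2 * B + A - U\<bar>"
    using c d order_trans[of 0 "1 / (2 * ?d)" c] by (simp add: id[symmetric] abs_mult)
  also have "\<dots> \<le> (real n)\<^sup>2 * \<bar>B\<bar> + A + U"
  proof -
    have "\<bar>(real n)\<^sup>2 * B\<bar> = (real n)\<^sup>2 * \<bar>B\<bar>" by (simp add: abs_mult)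
    then show ?thesis using A(1) U(1) by linarith
  qed
  \<comment> \<open>Four copies of the Green form come from the energy of the flow and one from the
    squared mean. Five times the bound \<open>2 flip + 3 trace\<close> then gives the constants 10
    and 15.\<close>
  also have "\<dots> \<le> (real n)\<^sup>2 / 4 * swap_energy n \<rho> g + 5 * ?X + (?N / (real n)\<^sup>2 * ?M + ?M)"
    using B A(2) U(2) by linarith
  also have "\<dots> \<le> (real n)\<^sup>2 / 4 * swap_energy n \<rho> g + 10 * flip_energy n \<rho> g
       + (15 * (\<Sum>k\<in>?T. green_mult n k) + ?N / (real n)\<^sup>2 + 1) * ?M" (is "_ \<le> ?R")
    using bexp_gform_le by (simp add: distrib_right)
  finally have "1 / (2 * ?d) * \<bar>?W\<bar> \<le> ?R" .
  then have "2 * ?d * (1 / (2 * ?d) * \<bar>?W\<bar>) \<le> 2 * ?d * ?R" using d by (intro mult_left_mono) auto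
  moreover have "2 * ?d * (1 / (2 * ?d) * \<bar>?W\<bar>) = \<bar>?W\<bar>" using d by simp
  ultimately show ?thesis by simp
qed

end

section \<open>The quadratic form of the generator\<close>

definition unshift :: "nat \<Rightarrow> int ^ 'd \<Rightarrow> 'd::finite \<Rightarrow> int ^ 'd" where
  "unshift n x i = (\<chi> j. (x $ j - of_bool (j = i)) mod int n)"

lemma unshift_shift: "n \<ge> 1 \<Longrightarrow> x \<in> dtorus n \<Longrightarrow> unshift n (shift n x i) i = x"
  by (auto simp: shift_def unshift_def dtorus_def vec_eq_iff mod_simps)

lemma circle_dist_eq_0:
  assumes "0 \<le> u" "u < int n" "0 \<le> v" "v < int n"
  shows "circle_dist n u v = 0 \<longleftrightarrow> u = v"
proof -
  have "(u - v) mod int n = 0 \<longleftrightarrow> u = v" "(v - u) mod int n = 0 \<longleftrightarrow> u = v"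
    using assms by (auto simp: mod_0_imp_dvd mod_eq_0_iff_dvd mod_eq_dvd_iff[symmetric])
  moreover have "0 \<le> (u - v) mod int n" "0 \<le> (v - u) mod int n" using assms by auto
  ultimately show ?thesis unfolding circle_dist_def min_def by auto
qed

lemma circle_dist_nonneg: "n \<ge> 1 \<Longrightarrow> 0 \<le> circle_dist n u v"
  by (simp add: circle_dist_def)

lemma circle_dist_eq_1:
  assumes n: "n \<ge> 3" and "0 \<le> u" "u < int n" "0 \<le> v" "v < int n"
  shows "circle_dist n u v = 1 \<longleftrightarrow> v = (u + 1) mod int n \<or> v = (u - 1) mod int n"
proof -
  have a: "(v - u) mod int n = 1 \<longleftrightarrow> v = (u + 1) mod int n" if "0 \<le> u" "u < int n" "0 \<le> v" "v < int n" for u v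
  proof -
    have "(v - u) mod int n = 1 \<longleftrightarrow> (v - u) mod int n = 1 mod int n" using n by simp
    also have "\<dots> \<longleftrightarrow> int n dvd (v - u) - 1" by (rule mod_eq_dvd_iff)
    also have "(v - u) - 1 = v - (u + 1)" by simp
    also have "int n dvd v - (u + 1) \<longleftrightarrow> v mod int n = (u + 1) mod int n" by (rule mod_eq_dvd_iff[symmetric])
    finally show ?thesis using that by simp
  qed
  have b: "(u - v) mod int n = 1 \<longleftrightarrow> v = (u - 1) mod int n"
  proof -
    have "(u - v) mod int n = 1 \<longleftrightarrow> (u - v) mod int n = 1 mod int n" using n by simp
    also have "\<dots> \<longleftrightarrow> int n dvd (u - v) - 1" by (rule mod_eq_dvd_iff)
    also have "(u - v) - 1 = (u - 1) - v" by simp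
    also have "int n dvd (u - 1) - v \<longleftrightarrow> (u - 1) mod int n = v mod int n" by (rule mod_eq_dvd_iff[symmetric])
    finally show ?thesis using assms by auto
  qed
  have c: "(u - v) mod int n = 1 \<Longrightarrow> 1 \<le> (v - u) mod int n" "(v - u) mod int n = 1 \<Longrightarrow> 1 \<le> (u - v) mod int n"
  proof -
    have *: "1 \<le> q mod int n" if "(- q) mod int n = 1" for q :: int
    proof -
      have "q mod int n \<noteq> 0" using that by (auto simp: mod_eq_0_iff_dvd zmod_zminus1_eq_if)
      moreover have "0 \<le> q mod int n" using n by simp
      ultimately show ?thesis by linarith
    qed
    show "(u - v) mod int n = 1 \<Longrightarrow> 1 \<le> (v - u) mod int n" using *[of "v - u"] by simp
    show "(v - u) mod int n = 1 \<Longrightarrow> 1 \<le> (u - v) mod int n" using *[of "u - v"] by simp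
  qed
  have "circle_dist n u v = 1 \<longleftrightarrow> (u - v) mod int n = 1 \<or> (v - u) mod int n = 1"
    using c unfolding circle_dist_def min_def by auto
  then show ?thesis using a[OF assms(2-5)] b by auto
qed

text \<open>Nonnegative integers with sum 1: one coordinate is at circular distance 1 and all others
  agree.\<close>

lemma nbr_iff:
  assumes n: "n \<ge> 3" and x: "x \<in> dtorus n" and y: "y \<in> dtorus n"
  shows "nbr n x y \<longleftrightarrow> (\<exists>i. y = shift n x i \<or> y = unshift n x i)"
proof -
  have x': "0 \<le> x $ i" "x $ i < int n" and y': "0 \<le> y $ i" "y $ i < int n" for i
    using x y by (auto simp: dtorus_def)
  let ?c = "\<lambda>i. circle_dist n (x $ i) (y $ i)"
  have c0: "0 \<le> ?c i" for i using n by (simp add: circle_dist_nonneg)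
  have z: "?c i = 0 \<longleftrightarrow> y $ i = x $ i" for i using circle_dist_eq_0[OF x' y'] by auto
  have o: "?c i = 1 \<longleftrightarrow> y $ i = (x $ i + 1) mod int n \<or> y $ i = (x $ i - 1) mod int n" for i
    by (rule circle_dist_eq_1[OF n x' y'])
  have "nbr n x y \<longleftrightarrow> (\<exists>i. ?c i = 1 \<and> (\<forall>j. j \<noteq> i \<longrightarrow> ?c j = 0))"
  proof
    assume "nbr n x y"
    then have s: "(\<Sum>i\<in>UNIV. ?c i) = 1" by (simp add: nbr_def)
    then have "\<exists>i. ?c i \<noteq> 0" by (auto intro: ccontr)
    then obtain i where i: "?c i \<noteq> 0" by blast
    have r: "(\<Sum>i\<in>UNIV. ?c i) = ?c i + (\<Sum>j\<in>UNIV - {i}. ?c j)" by (simp add: sum.remove)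
    have p: "0 \<le> (\<Sum>j\<in>UNIV - {i}. ?c j)" using c0 by (intro sum_nonneg) auto
    have "?c i \<ge> 1" using i c0[of i] by linarith
    then have "?c i = 1" "(\<Sum>j\<in>UNIV - {i}. ?c j) = 0" using r s p by linarith+
    then show "\<exists>i. ?c i = 1 \<and> (\<forall>j. j \<noteq> i \<longrightarrow> ?c j = 0)"
      using c0 by (intro exI[of _ i]) (auto simp: sum_nonneg_eq_0_iff)
  next
    assume "\<exists>i. ?c i = 1 \<and> (\<forall>j. j \<noteq> i \<longrightarrow> ?c j = 0)"
    then obtain i where "?c i = 1" "\<forall>j. j \<noteq> i \<longrightarrow> ?c j = 0" by blast
    then show "nbr n x y" unfolding nbr_def by (simp add: sum.remove[of UNIV i])
  qed
  also have "\<dots> \<longleftrightarrow> (\<exists>i. y = shift n x i \<or> y = unshift n x i)"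
  proof (rule ex_cong1)
    fix i
    have "y = shift n x i \<longleftrightarrow> y $ i = (x $ i + 1) mod int n \<and> (\<forall>j. j \<noteq> i \<longrightarrow> y $ j = x $ j)"
         "y = unshift n x i \<longleftrightarrow> y $ i = (x $ i - 1) mod int n \<and> (\<forall>j. j \<noteq> i \<longrightarrow> y $ j = x $ j)"
      using x' by (auto simp: vec_eq_iff shift_def unshift_def)
    then show "?c i = 1 \<and> (\<forall>j. j \<noteq> i \<longrightarrow> ?c j = 0) \<longleftrightarrow> y = shift n x i \<or> y = unshift n x i"
      using o z by auto
  qed
  finally show ?thesis .
qed

text \<open>From \<open>n = 3\<close> on, the \<open>2 d\<close> forward and backward shifts are
  distinct; for \<open>n = 2\<close> the two shifts in one direction coincide.\<close>

lemma sum_nbr: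
  fixes x :: "int ^ 'd::finite" and f :: "int ^ 'd \<Rightarrow> real"
  assumes n: "n \<ge> 3" and x: "x \<in> dtorus n"
  shows "(\<Sum>y | y \<in> dtorus n \<and> nbr n x y. f y) = (\<Sum>i\<in>UNIV. f (shift n x i) + f (unshift n x i))"
proof -
  have x': "0 \<le> x $ i" "x $ i < int n" for i using x by (auto simp: dtorus_def)
  have ne: "(x $ i + 1) mod int n \<noteq> x $ i" "(x $ i - 1) mod int n \<noteq> x $ i" "(x $ i + 1) mod int n \<noteq> (x $ i - 1) mod int n" for i
  proof -
    have nd: "\<not> int n dvd 1" "\<not> int n dvd 2" using n by (auto dest: zdvd_imp_le)
    have "(x $ i + 1) mod int n \<noteq> x $ i mod int n" using nd by (simp add: mod_eq_dvd_iff)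
    then show "(x $ i + 1) mod int n \<noteq> x $ i" using x' by simp
    have "(x $ i - 1) mod int n \<noteq> x $ i mod int n" using nd by (simp add: mod_eq_dvd_iff)
    then show "(x $ i - 1) mod int n \<noteq> x $ i" using x' by simp
    show "(x $ i + 1) mod int n \<noteq> (x $ i - 1) mod int n" using nd by (simp add: mod_eq_dvd_iff)
  qed
  have sh: "shift n x i $ j = (if j = i then (x $ i + 1) mod int n else x $ j)"
    "unshift n x i $ j = (if j = i then (x $ i - 1) mod int n else x $ j)" for i j
    using x' by (simp_all add: shift_def unshift_def)
  have injS: "inj (shift n x)"
  proof (rule injI)
    fix i k assume "shift n x i = shift n x k"
    then have "shift n x i $ i = shift n x k $ i" by simp
    then show "i = k" using ne(1)[of i] by (auto simp: sh split: if_splits)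
  qed
  have injU: "inj (unshift n x)"
  proof (rule injI)
    fix i k assume "unshift n x i = unshift n x k"
    then have "unshift n x i $ i = unshift n x k $ i" by simp
    then show "i = k" using ne(2)[of i] by (auto simp: sh split: if_splits)
  qed
  have disj: "range (shift n x) \<inter> range (unshift n x) = {}"
  proof (safe, simp)
    fix i k assume "shift n x i = unshift n x k"
    then have "shift n x i $ i = unshift n x k $ i" by simp
    then show False using ne(1)[of i] ne(3)[of i] by (auto simp: sh split: if_splits)
  qed
  have "{y. y \<in> dtorus n \<and> nbr n x y} = range (shift n x) \<union> range (unshift n x)"
  proof -
    have "unshift n x i \<in> dtorus n" for i using n by (simp add: unshift_def dtorus_def)
    then show ?thesis using nbr_iff[OF n x] n by (auto simp: image_iff)
  qed
  then have "(\<Sum>y | y \<in> dtorus n \<and> nbr n x y. f y) = (\<Sum>y\<in>range (shift n x). f y) + (\<Sum>y\<in>range (unshift n x). f y)"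
    using disj by (simp add: sum.union_disjoint)
  then show ?thesis by (simp add: sum.reindex[OF injS] sum.reindex[OF injU] sum.distrib)
qed

text \<open>Every bond is seen from both of its ends.\<close>

lemma sum_nbr_pairs:
  fixes u :: "int ^ 'd::finite \<Rightarrow> real"
  assumes n: "n \<ge> 3"
  shows "(\<Sum>x\<in>dtorus n. u x * (\<Sum>y | y \<in> dtorus n \<and> nbr n x y. u y)) = 2 * nn_sum n u"
proof -
  have n1: "n \<ge> 1" using n by simp
  have "(\<Sum>x\<in>dtorus n. u x * u (unshift n x i)) = (\<Sum>x\<in>dtorus n. u x * u (shift n x i))" for i
  proof -
    have "(\<Sum>x\<in>dtorus n. u x * u (unshift n x i)) = (\<Sum>x\<in>dtorus n. u (shift n x i) * u (unshift n (shift n x i) i))"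
      by (rule sum_shift[OF n1, of "\<lambda>x. u x * u (unshift n x i)", symmetric])
    then show ?thesis using n1 by (simp add: unshift_shift mult.commute)
  qed
  then have un: "(\<Sum>x\<in>dtorus n. \<Sum>i\<in>UNIV. u x * u (unshift n x i)) = nn_sum n u"
    unfolding nn_sum_def bond_sum_def by (subst (1 2) sum.swap) simp
  have "(\<Sum>x\<in>dtorus n. u x * (\<Sum>y | y \<in> dtorus n \<and> nbr n x y. u y))
     = (\<Sum>x\<in>dtorus n. (\<Sum>i\<in>UNIV. u x * u (shift n x i)) + (\<Sum>i\<in>UNIV. u x * u (unshift n x i)))"
    by (intro sum.cong refl) (simp add: sum_nbr[OF n] sum_distrib_left sum.distrib distrib_left)
  then show ?thesis using un by (simp add: sum.distrib nn_sum_def bond_sum_def)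
qed

lemma sum_nbr_bounds:
  assumes n: "n \<ge> 3" and x: "x \<in> dtorus n" and \<eta>: "(\<eta> :: ('d::finite) config) \<in> configs n"
  shows "0 \<le> (\<Sum>y | y \<in> dtorus n \<and> nbr n x y. real (\<eta> y))"
    "(\<Sum>y | y \<in> dtorus n \<and> nbr n x y. real (\<eta> y)) \<le> 2 * real CARD('d)"
    "(\<Sum>y | y \<in> dtorus n \<and> nbr n x y. ctr \<rho> \<eta> y)
       = (\<Sum>y | y \<in> dtorus n \<and> nbr n x y. real (\<eta> y)) - 2 * real CARD('d) * \<rho>"
proof -
  have card: "real (card {y. y \<in> dtorus n \<and> nbr n x y}) = 2 * real CARD('d)"
    using sum_nbr[OF n x, of "\<lambda>_. 1"] by simp
  show "0 \<le> (\<Sum>y | y \<in> dtorus n \<and> nbr n x y. real (\<eta> y))" by (rule sum_nonneg) simp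
  have "(\<Sum>y | y \<in> dtorus n \<and> nbr n x y. real (\<eta> y)) \<le> (\<Sum>y | y \<in> dtorus n \<and> nbr n x y. 1)"
    using configs_values[OF \<eta>] by (intro sum_mono) fastforce
  then show "(\<Sum>y | y \<in> dtorus n \<and> nbr n x y. real (\<eta> y)) \<le> 2 * real CARD('d)" by (simp add: card)
  show "(\<Sum>y | y \<in> dtorus n \<and> nbr n x y. ctr \<rho> \<eta> y)
       = (\<Sum>y | y \<in> dtorus n \<and> nbr n x y. real (\<eta> y)) - 2 * real CARD('d) * \<rho>"
    by (simp add: ctr_def sum_subtractf card)
qed

section \<open>Dirichlet forms of the exclusion and of the reaction\<close>

context
  fixes n :: nat and a b lam \<rho> :: real
  assumes n: "n \<ge> 3" and \<rho>: "0 < \<rho>" "\<rho> < 1" and react: "reaction a b lam \<rho> = 0"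
begin

text \<open>The defect of detailed balance at \<open>x\<close>. The equation for
  \<open>\<rho>\<close> is detailed balance for a site whose neighbours have average
  \<open>\<rho>\<close>, so the defect is linear in the deviation of the neighbour sum. Its sign is
  opposite for occupied and empty sites, which produces the factor
  \<open>ctr \<rho> \<eta> x\<close>.\<close>

lemma rate_flip:
  fixes \<eta> :: "('d::finite) config"
  assumes \<eta>: "\<eta> \<in> configs n" and x: "x \<in> dtorus n"
  shows "pmf (bernoulli_product n \<rho>) (flip_conf \<eta> x) * rate n a b lam x (flip_conf \<eta> x)
       - pmf (bernoulli_product n \<rho>) \<eta> * rate n a b lam x \<eta>
    = pmf (bernoulli_product n \<rho>) \<eta> *
        (lam / (2 * real CARD('d) * \<rho>) * (ctr \<rho> \<eta> x * (\<Sum>y | y \<in> dtorus n \<and> nbr n x y. ctr \<rho> \<eta> y)))"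
proof -
  let ?p = "pmf (bernoulli_product n \<rho>) \<eta>" and ?q = "pmf (bernoulli_product n \<rho>) (flip_conf \<eta> x)"
  define S where "S = (\<Sum>y | y \<in> dtorus n \<and> nbr n x y. real (\<eta> y))"
  define B where "B = lam / (2 * real CARD('d)) * S"
  have "\<not> nbr n x x" by (simp add: nbr_def circle_dist_def)
  then have S': "(\<Sum>y | y \<in> dtorus n \<and> nbr n x y. real (flip_conf \<eta> x y)) = S"
    unfolding S_def by (intro sum.cong refl) (auto simp: flip_conf_def)
  have rt: "rate n a b lam x \<eta> = (a + B) * (1 - real (\<eta> x)) + b * real (\<eta> x)"
    by (simp add: rate_def B_def S_def)
  have rt': "rate n a b lam x (flip_conf \<eta> x) = (a + B) * (1 - real (1 - \<eta> x)) + b * real (1 - \<eta> x)"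
    unfolding rate_def S' B_def by (simp add: flip_conf_def)
  have d: "real CARD('d) > 0" by simp
  have "lam / (2 * real CARD('d) * \<rho>) * (S - 2 * real CARD('d) * \<rho>) = (B - lam * \<rho>) / \<rho>"
    using d \<rho> by (simp add: B_def field_simps)
  then have rhs: "lam / (2 * real CARD('d) * \<rho>) * (ctr \<rho> \<eta> x * (\<Sum>y | y \<in> dtorus n \<and> nbr n x y. ctr \<rho> \<eta> y))
     = ctr \<rho> \<eta> x * ((B - lam * \<rho>) / \<rho>)"
    unfolding sum_nbr_bounds(3)[OF n x \<eta>] S_def[symmetric] by (simp only: mult.left_commute)
  have r: "(a + lam * \<rho>) * (1 - \<rho>) = b * \<rho>" using react by (simp add: reaction_def)
  show ?thesis
  proof (cases "\<eta> x = 1")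
    case True
    then have "?q * \<rho> = ?p * (1 - \<rho>)" using pmf_flip[OF \<rho> \<eta> x] by simp
    then have q: "?q = ?p * ((1 - \<rho>) / \<rho>)" using \<rho> by (simp add: field_simps)
    have "?p * ((1 - \<rho>) / \<rho>) * (a + B) - ?p * b = ?p * (((1 - \<rho>) * (a + B) - b * \<rho>) / \<rho>)"
      using \<rho> by (simp add: field_simps)
    also have "(1 - \<rho>) * (a + B) - b * \<rho> = (1 - \<rho>) * (B - lam * \<rho>)"
      unfolding r[symmetric] by (simp add: algebra_simps)
    finally show ?thesis unfolding rhs rt rt' q using True by (simp add: ctr_def)
  next
    case False
    then have x0: "\<eta> x = 0" using configs_values[OF \<eta> x] by simp
    then have "?q * (1 - \<rho>) = ?p * \<rho>" using pmf_flip[OF \<rho> \<eta> x] by simp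
    then have q: "?q = ?p * (\<rho> / (1 - \<rho>))" using \<rho> by (simp add: field_simps)
    have "?p * (\<rho> / (1 - \<rho>)) * b - ?p * (a + B) = ?p * (b * \<rho> / (1 - \<rho>) - (a + B))"
      by (simp add: algebra_simps)
    also have "b * \<rho> / (1 - \<rho>) = a + lam * \<rho>" unfolding r[symmetric] using \<rho> by simp
    finally show ?thesis unfolding rhs rt rt' q using x0 \<rho> by (simp add: ctr_def)
  qed
qed

text \<open>For a swap \<open>\<sigma>\<close>, \<open>g (g o \<sigma> - g)\<close> is half of
  \<open>(g o \<sigma>)^2 - g^2\<close> minus half of \<open>(g o \<sigma> - g)^2\<close>, and the
  first bracket integrates to 0 by invariance of the measure.\<close>

lemma bexp_L_ex: "bexp n \<rho> (\<lambda>\<eta>. g \<eta> * L_ex n g \<eta>) = - (1 / 2) * swap_energy n \<rho> g"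
proof -
  have n1: "n \<ge> 1" using n by simp
  have "bexp n \<rho> (\<lambda>\<eta>. g \<eta> * (g (swap_conf \<eta> z (shift n z j)) - g \<eta>))
     = - (1 / 2) * bexp n \<rho> (\<lambda>\<eta>. (g (swap_conf \<eta> z (shift n z j)) - g \<eta>)\<^sup>2)" if z: "z \<in> dtorus n" for z j
  proof -
    let ?\<sigma> = "\<lambda>\<eta>. swap_conf \<eta> z (shift n z j)"
    have "bexp n \<rho> (\<lambda>\<eta>. (g (?\<sigma> \<eta>))\<^sup>2) = (\<Sum>\<eta>\<in>configs n. pmf (bernoulli_product n \<rho>) (?\<sigma> \<eta>) * (g (?\<sigma> \<eta>))\<^sup>2)"
      unfolding bexp_def using pmf_swap[OF \<rho> _ z] n1 by (intro sum.cong) auto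
    also have "\<dots> = bexp n \<rho> (\<lambda>\<eta>. (g \<eta>)\<^sup>2)"
      unfolding bexp_def using z n1 by (intro sum_swap_conf) auto
    finally have inv: "bexp n \<rho> (\<lambda>\<eta>. (g (?\<sigma> \<eta>))\<^sup>2) = bexp n \<rho> (\<lambda>\<eta>. (g \<eta>)\<^sup>2)" .
    have "bexp n \<rho> (\<lambda>\<eta>. g \<eta> * (g (?\<sigma> \<eta>) - g \<eta>))
      = bexp n \<rho> (\<lambda>\<eta>. 1 / 2 * ((g (?\<sigma> \<eta>))\<^sup>2 - (g \<eta>)\<^sup>2) - 1 / 2 * (g (?\<sigma> \<eta>) - g \<eta>)\<^sup>2)"
      by (intro bexp_cong) (simp add: power2_eq_square field_simps)
    then show ?thesis unfolding bexp_diff bexp_cmult inv by simp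
  qed
  then have "bond_sum n (\<lambda>z j. bexp n \<rho> (\<lambda>\<eta>. g \<eta> * (g (swap_conf \<eta> z (shift n z j)) - g \<eta>)))
    = - (1 / 2) * swap_energy n \<rho> g"
    unfolding swap_energy_def bond_sum_def sum_distrib_left by (intro sum.cong refl)
  then show ?thesis
    unfolding bexp_bond_sum[symmetric] by (simp add: bond_sum_def L_ex_def sum_distrib_left)
qed

text \<open>The same decomposition as for swaps, except that the first bracket now integrates to the
  defect in \<open>rate_flip\<close>. The factor 1/2 in front of it is cancelled because summing
  over sites counts every bond twice.\<close>

lemma bexp_L_r:
  fixes g :: "('d::finite) config \<Rightarrow> real"
  shows "bexp n \<rho> (\<lambda>\<eta>. g \<eta> * L_r n a b lam g \<eta>)
    = - (1 / 2) * (\<Sum>x\<in>dtorus n. bexp n \<rho> (\<lambda>\<eta>. rate n a b lam x \<eta> * (g (flip_conf \<eta> x) - g \<eta>)\<^sup>2))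
      + lam / (2 * real CARD('d) * \<rho>) * bexp n \<rho> (\<lambda>\<eta>. nn_sum n (ctr \<rho> \<eta>) * (g \<eta>)\<^sup>2)"
proof -
  let ?c = "lam / (2 * real CARD('d) * \<rho>)" and ?T = "dtorus n :: (int ^ 'd) set"
  let ?\<nu> = "pmf (bernoulli_product n \<rho>) :: 'd config \<Rightarrow> real"
  let ?S = "\<lambda>x \<eta>. \<Sum>y | y \<in> dtorus n \<and> nbr n x y. ctr \<rho> \<eta> y"
  have one: "bexp n \<rho> (\<lambda>\<eta>. rate n a b lam x \<eta> * (g \<eta> * (g (flip_conf \<eta> x) - g \<eta>)))
     = - (1 / 2) * bexp n \<rho> (\<lambda>\<eta>. rate n a b lam x \<eta> * (g (flip_conf \<eta> x) - g \<eta>)\<^sup>2)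
       + 1 / 2 * (?c * bexp n \<rho> (\<lambda>\<eta>. ctr \<rho> \<eta> x * ?S x \<eta> * (g \<eta>)\<^sup>2))" if x: "x \<in> ?T" for x
  proof -
    have "bexp n \<rho> (\<lambda>\<eta>. rate n a b lam x \<eta> * (g (flip_conf \<eta> x))\<^sup>2)
      = (\<Sum>\<eta>\<in>configs n. ?\<nu> (flip_conf \<eta> x) * (rate n a b lam x (flip_conf \<eta> x) * (g (flip_conf (flip_conf \<eta> x) x))\<^sup>2))"
      unfolding bexp_def by (rule sum_flip[OF x, symmetric])
    also have "\<dots> = (\<Sum>\<eta>\<in>configs n. ?\<nu> (flip_conf \<eta> x) * rate n a b lam x (flip_conf \<eta> x) * (g \<eta>)\<^sup>2)"
      using x by (intro sum.cong) (auto simp: flip_flip)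
    finally have "bexp n \<rho> (\<lambda>\<eta>. rate n a b lam x \<eta> * (g (flip_conf \<eta> x))\<^sup>2) - bexp n \<rho> (\<lambda>\<eta>. rate n a b lam x \<eta> * (g \<eta>)\<^sup>2)
      = (\<Sum>\<eta>\<in>configs n. (?\<nu> (flip_conf \<eta> x) * rate n a b lam x (flip_conf \<eta> x) - ?\<nu> \<eta> * rate n a b lam x \<eta>) * (g \<eta>)\<^sup>2)"
      by (simp add: bexp_def left_diff_distrib sum_subtractf mult.assoc)
    also have "\<dots> = (\<Sum>\<eta>\<in>configs n. ?c * (?\<nu> \<eta> * (ctr \<rho> \<eta> x * ?S x \<eta> * (g \<eta>)\<^sup>2)))"
      using x by (intro sum.cong refl) (simp add: rate_flip mult_ac)
    also have "\<dots> = ?c * bexp n \<rho> (\<lambda>\<eta>. ctr \<rho> \<eta> x * ?S x \<eta> * (g \<eta>)\<^sup>2)"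
      unfolding bexp_def by (rule sum_distrib_left[symmetric])
    finally have rev: "bexp n \<rho> (\<lambda>\<eta>. rate n a b lam x \<eta> * (g (flip_conf \<eta> x))\<^sup>2) - bexp n \<rho> (\<lambda>\<eta>. rate n a b lam x \<eta> * (g \<eta>)\<^sup>2)
      = ?c * bexp n \<rho> (\<lambda>\<eta>. ctr \<rho> \<eta> x * ?S x \<eta> * (g \<eta>)\<^sup>2)" .
    have "bexp n \<rho> (\<lambda>\<eta>. rate n a b lam x \<eta> * (g \<eta> * (g (flip_conf \<eta> x) - g \<eta>)))
      = bexp n \<rho> (\<lambda>\<eta>. - (1 / 2) * (rate n a b lam x \<eta> * (g (flip_conf \<eta> x) - g \<eta>)\<^sup>2)
          + 1 / 2 * (rate n a b lam x \<eta> * (g (flip_conf \<eta> x))\<^sup>2 - rate n a b lam x \<eta> * (g \<eta>)\<^sup>2))"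
      by (intro bexp_cong) (simp add: power2_eq_square field_simps)
    then show ?thesis unfolding bexp_add bexp_diff bexp_cmult rev by simp
  qed
  have "bexp n \<rho> (\<lambda>\<eta>. g \<eta> * L_r n a b lam g \<eta>)
     = (\<Sum>x\<in>?T. bexp n \<rho> (\<lambda>\<eta>. rate n a b lam x \<eta> * (g \<eta> * (g (flip_conf \<eta> x) - g \<eta>))))"
    unfolding bexp_sum[symmetric] L_r_def by (simp add: sum_distrib_left mult.left_commute)
  also have "\<dots> = - (1 / 2) * (\<Sum>x\<in>?T. bexp n \<rho> (\<lambda>\<eta>. rate n a b lam x \<eta> * (g (flip_conf \<eta> x) - g \<eta>)\<^sup>2))
     + 1 / 2 * (?c * (\<Sum>x\<in>?T. bexp n \<rho> (\<lambda>\<eta>. ctr \<rho> \<eta> x * ?S x \<eta> * (g \<eta>)\<^sup>2)))"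
    by (simp only: sum.distrib sum_distrib_left[symmetric] one cong: sum.cong)
  also have "(\<Sum>x\<in>?T. bexp n \<rho> (\<lambda>\<eta>. ctr \<rho> \<eta> x * ?S x \<eta> * (g \<eta>)\<^sup>2)) = bexp n \<rho> (\<lambda>\<eta>. 2 * (nn_sum n (ctr \<rho> \<eta>) * (g \<eta>)\<^sup>2))"
    unfolding bexp_sum[symmetric] sum_distrib_right[symmetric] sum_nbr_pairs[OF n] by (simp only: mult.assoc)
  finally show ?thesis by (simp add: bexp_cmult)
qed

text \<open>Here \<open>c\<close> is a lower bound for all flip rates, so the reaction provides
  \<open>c / 2\<close> times the flip energy, and the exclusion provides \<open>n^2 / 2\<close>
  times the swap energy. The perturbation enters with factor
  \<open>t = \<bar>lam\<bar> / \<rho>\<close>: \<open>t <= 1\<close> lets the exclusion absorb its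
  swap part \<open>n^2 / 4\<close>, and \<open>20 t <= c\<close> lets the reaction absorb its flip
  part \<open>10 t\<close>.\<close>

lemma generator_form_bound:
  fixes g :: "('d::finite) config \<Rightarrow> real"
  assumes c0: "0 < c" "c \<le> b" "c \<le> a - \<bar>lam\<bar>" and lam: "\<bar>lam\<bar> \<le> \<rho>" "20 * \<bar>lam\<bar> \<le> c * \<rho>"
  shows "bexp n \<rho> (\<lambda>\<eta>. g \<eta> * gen n a b lam g \<eta>)
    \<le> (15 * (\<Sum>k\<in>(dtorus n :: (int ^ 'd) set). green_mult n k) + real n ^ CARD('d) / (real n)\<^sup>2 + 1)
        * bexp n \<rho> (\<lambda>\<eta>. (g \<eta>)\<^sup>2)"
proof -
  let ?d = "real CARD('d)" and ?T = "dtorus n :: (int ^ 'd) set"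
  let ?sw = "swap_energy n \<rho> g" and ?fl = "flip_energy n \<rho> g"
  let ?W = "bexp n \<rho> (\<lambda>\<eta>. nn_sum n (ctr \<rho> \<eta>) * (g \<eta>)\<^sup>2)"
  define E where "E = 15 * (\<Sum>k\<in>?T. green_mult n k) + real n ^ CARD('d) / (real n)\<^sup>2 + 1"
  define M where "M = bexp n \<rho> (\<lambda>\<eta>. (g \<eta>)\<^sup>2)"
  define t where "t = \<bar>lam\<bar> / \<rho>"
  have d: "?d > 0" by simp
  have n1: "n \<ge> 1" and n2: "n \<ge> 2" using n by auto
  have M0: "0 \<le> M" unfolding M_def by (intro bexp_nonneg) simp
  have E0: "0 \<le> E" unfolding E_def using green_mult_bounds(1)[OF n1] by (intro add_nonneg_nonneg mult_nonneg_nonneg sum_nonneg) auto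
  have sw0: "0 \<le> ?sw" unfolding swap_energy_def bond_sum_def by (intro sum_nonneg bexp_nonneg) simp
  have fl0: "0 \<le> ?fl" unfolding flip_energy_def by (intro sum_nonneg bexp_nonneg) simp
  have t: "0 \<le> t" "t \<le> 1" "20 * t \<le> c"
    using lam \<rho> by (simp_all add: t_def divide_le_eq mult.commute)
  have rate: "c \<le> rate n a b lam x \<eta>" if x: "x \<in> ?T" and \<eta>: "\<eta> \<in> configs n" for x \<eta>
  proof (cases "\<eta> x = 1")
    case True then show ?thesis using c0 by (simp add: rate_def)
  next
    case False
    then have x0: "\<eta> x = 0" using configs_values[OF \<eta> x] by simp
    let ?S = "\<Sum>y | y \<in> dtorus n \<and> nbr n x y. real (\<eta> y)"
    have "\<bar>lam / (2 * ?d) * ?S\<bar> = \<bar>lam\<bar> * (?S / (2 * ?d))"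
      using sum_nbr_bounds(1)[OF n x \<eta>] d by (simp add: abs_mult)
    also have "\<dots> \<le> \<bar>lam\<bar> * 1"
      using sum_nbr_bounds(2)[OF n x \<eta>] d by (intro mult_left_mono) (auto simp: divide_le_eq)
    finally have "a - \<bar>lam\<bar> \<le> a + lam / (2 * ?d) * ?S" by linarith
    then show ?thesis using c0 x0 by (simp add: rate_def)
  qed
  have "c * ?fl \<le> (\<Sum>x\<in>?T. bexp n \<rho> (\<lambda>\<eta>. rate n a b lam x \<eta> * (g (flip_conf \<eta> x) - g \<eta>)\<^sup>2))"
    unfolding flip_energy_def sum_distrib_left bexp_cmult[symmetric]
    using rate by (intro sum_mono bexp_mono mult_right_mono) auto
  moreover have "lam / (2 * ?d * \<rho>) * ?W \<le> t * ((real n)\<^sup>2 / 4 * ?sw + 10 * ?fl + E * M)"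
  proof -
    have "lam / (2 * ?d * \<rho>) * ?W \<le> \<bar>lam / (2 * ?d * \<rho>)\<bar> * \<bar>?W\<bar>" by (simp only: abs_mult[symmetric] abs_ge_self)
    also have "\<dots> \<le> \<bar>lam / (2 * ?d * \<rho>)\<bar> * (2 * ?d * ((real n)\<^sup>2 / 4 * ?sw + 10 * ?fl + E * M))"
      unfolding E_def M_def by (intro mult_left_mono bexp_nn_sum_le[OF n2 \<rho>]) simp
    also have "\<bar>lam / (2 * ?d * \<rho>)\<bar> = t / (2 * ?d)"
      using \<rho> by (simp add: t_def abs_mult)
    finally show ?thesis using d by simp
  qed
  moreover have "t * ((real n)\<^sup>2 / 4 * ?sw + 10 * ?fl + E * M) \<le> (real n)\<^sup>2 / 4 * ?sw + c / 2 * ?fl + E * M"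
  proof -
    have "t * ((real n)\<^sup>2 / 4 * ?sw) \<le> 1 * ((real n)\<^sup>2 / 4 * ?sw)" using t sw0 by (intro mult_right_mono) auto
    moreover have "(t * 10) * ?fl \<le> c / 2 * ?fl" using t fl0 by (intro mult_right_mono) auto
    moreover have "t * (E * M) \<le> 1 * (E * M)" using t E0 M0 by (intro mult_right_mono) auto
    ultimately show ?thesis by (simp add: distrib_left mult.assoc)
  qed
  moreover have "bexp n \<rho> (\<lambda>\<eta>. g \<eta> * gen n a b lam g \<eta>)
     = (real n)\<^sup>2 * (- (1 / 2) * ?sw) + bexp n \<rho> (\<lambda>\<eta>. g \<eta> * L_r n a b lam g \<eta>)"
    unfolding bexp_L_ex[symmetric] bexp_cmult[symmetric] bexp_add[symmetric]
    by (simp add: gen_def distrib_left mult.left_commute)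
  moreover have "0 \<le> (real n)\<^sup>2 * ?sw" using sw0 by simp
  ultimately have "bexp n \<rho> (\<lambda>\<eta>. g \<eta> * gen n a b lam g \<eta>) \<le> E * M"
    unfolding bexp_L_r by (simp add: algebra_simps)
  then show ?thesis by (simp only: E_def M_def)
qed

end

section \<open>The superexponential estimate\<close>

text \<open>Hoeffding's lemma for a centred Bernoulli variable; negative \<open>h\<close> reduces to
  positive \<open>h\<close> by exchanging the two outcomes.\<close>

lemma bernoulli_mgf_le:
  fixes p h :: real
  assumes p: "0 < p" "p < 1"
  shows "(1 - p) * exp (- (h * p)) + p * exp (h * (1 - p)) \<le> exp (h\<^sup>2 / 8)"
proof -
  have pos: "(1 - p) * exp (- (h * p)) + p * exp (h * (1 - p)) \<le> exp (h\<^sup>2 / 8)"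
    if p: "0 < p" "p < 1" and h: "0 \<le> h" for p h :: real
  proof -
    have "0 \<le> p * (exp h - 1)" using p h by simp
    then have "0 < 1 + p * (exp h - 1)" by linarith
    then have "exp (- h * p) * (1 + p * (exp h - 1)) = exp (- h * p + ln (1 + p * (exp h - 1)))"
      by (simp only: exp_add exp_ln)
    also have "\<dots> \<le> exp (h\<^sup>2 / 8)"
      using Hoeffdings_lemma_aux[of h p] p h by simp
    finally have le: "exp (- h * p) * (1 + p * (exp h - 1)) \<le> exp (h\<^sup>2 / 8)" .
    have "exp (h * (1 - p)) = exp (- h * p) * exp h" by (simp add: exp_add[symmetric] algebra_simps)
    then have "(1 - p) * exp (- (h * p)) + p * exp (h * (1 - p)) = exp (- h * p) * (1 + p * (exp h - 1))"
      by (simp add: algebra_simps)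
    then show ?thesis using le by simp
  qed
  show ?thesis
  proof (cases "0 \<le> h")
    case True then show ?thesis using pos p by simp
  next
    case False then show ?thesis using pos[of "1 - p" "- h"] p by (simp add: algebra_simps)
  qed
qed

text \<open>Under the product measure the sum over configurations factorises into one-site moment
  generating functions.\<close>

lemma bexp_exp_linear_le:
  fixes h :: "int ^ 'd::finite \<Rightarrow> real"
  assumes \<rho>: "0 < \<rho>" "\<rho> < 1" and h: "\<And>x. x \<in> dtorus n \<Longrightarrow> \<bar>h x\<bar> \<le> m"
  shows "bexp n \<rho> (\<lambda>\<eta>. exp (\<Sum>x\<in>dtorus n. ctr \<rho> \<eta> x * h x)) \<le> exp (real n ^ CARD('d) * m\<^sup>2 / 8)"
proof -
  let ?T = "dtorus n :: (int ^ 'd) set"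
  have "bexp n \<rho> (\<lambda>\<eta>. exp (\<Sum>x\<in>?T. ctr \<rho> \<eta> x * h x))
    = (\<Sum>\<eta>\<in>configs n. \<Prod>x\<in>?T. (if \<eta> x = 1 then \<rho> else 1 - \<rho>) * exp ((real (\<eta> x) - \<rho>) * h x))"
    unfolding bexp_def by (intro sum.cong refl) (simp add: pmf_bernoulli_product[OF \<rho>] exp_sum prod.distrib ctr_def)
  also have "\<dots> = (\<Prod>x\<in>?T. \<Sum>v\<in>{0, 1}. (if v = 1 then \<rho> else 1 - \<rho>) * exp ((real v - \<rho>) * h x))"
    unfolding configs_def by (rule prod_sum_PiE[symmetric]) auto
  also have "\<dots> \<le> (\<Prod>x\<in>?T. exp (m\<^sup>2 / 8))"
  proof (intro prod_mono conjI)
    fix x assume x: "x \<in> ?T"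
    have "(\<Sum>v\<in>{0, 1 :: nat}. (if v = 1 then \<rho> else 1 - \<rho>) * exp ((real v - \<rho>) * h x))
       = (1 - \<rho>) * exp (- (h x * \<rho>)) + \<rho> * exp (h x * (1 - \<rho>))" by (simp add: mult.commute)
    also have "\<dots> \<le> exp ((h x)\<^sup>2 / 8)" by (rule bernoulli_mgf_le[OF \<rho>])
    also have "\<dots> \<le> exp (m\<^sup>2 / 8)"
      using h[OF x] abs_le_square_iff[of "h x" m] by simp
    finally show "(\<Sum>v\<in>{0, 1 :: nat}. (if v = 1 then \<rho> else 1 - \<rho>) * exp ((real v - \<rho>) * h x)) \<le> exp (m\<^sup>2 / 8)" .
    show "0 \<le> (\<Sum>v\<in>{0, 1 :: nat}. (if v = 1 then \<rho> else 1 - \<rho>) * exp ((real v - \<rho>) * h x))"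
      using \<rho> by (intro sum_nonneg) auto
  qed
  also have "\<dots> = exp (real n ^ CARD('d) * m\<^sup>2 / 8)"
    by (simp add: card_dtorus exp_of_nat_mult[symmetric])
  finally show ?thesis .
qed

lemma bexp_exp_abs_linear_le:
  fixes h :: "int ^ 'd::finite \<Rightarrow> real"
  assumes \<rho>: "0 < \<rho>" "\<rho> < 1" and h: "\<And>x. x \<in> dtorus n \<Longrightarrow> \<bar>h x\<bar> \<le> m"
  shows "bexp n \<rho> (\<lambda>\<eta>. exp \<bar>\<Sum>x\<in>dtorus n. ctr \<rho> \<eta> x * h x\<bar>) \<le> 2 * exp (real n ^ CARD('d) * m\<^sup>2 / 8)"
proof -
  have "bexp n \<rho> (\<lambda>\<eta>. exp \<bar>\<Sum>x\<in>dtorus n. ctr \<rho> \<eta> x * h x\<bar>)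
    \<le> bexp n \<rho> (\<lambda>\<eta>. exp (\<Sum>x\<in>dtorus n. ctr \<rho> \<eta> x * h x) + exp (\<Sum>x\<in>dtorus n. ctr \<rho> \<eta> x * - h x))"
    by (intro bexp_mono) (simp add: abs_if sum_negf)
  also have "\<dots> \<le> exp (real n ^ CARD('d) * m\<^sup>2 / 8) + exp (real n ^ CARD('d) * m\<^sup>2 / 8)"
    unfolding bexp_add by (intro add_mono bexp_exp_linear_le[OF \<rho>]) (use h in auto)
  finally show ?thesis by simp
qed

text \<open>The lower bound does not depend on \<open>lam\<close>: \<open>lam_c\<close> has to be
  chosen before \<open>lam\<close>, while smallness is needed relative to the density. It follows
  from \<open>b \<rho> = (a + lam \<rho>) (1 - \<rho>) >= (a / 2) (1 - \<rho>)\<close>.\<close>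

lemma rho_star_props:
  assumes a: "a > 0" and b: "b > 0" and lam: "\<bar>lam\<bar> \<le> a / 2"
  shows "a / (a + 2 * b) \<le> rho_star a b lam" "rho_star a b lam < 1" "reaction a b lam (rho_star a b lam) = 0"
proof -
  have "\<exists>\<rho>\<ge>0. \<rho> \<le> 1 \<and> reaction a b lam \<rho> = 0"
    using a b by (intro IVT2') (auto simp: reaction_def intro!: continuous_intros)
  then obtain \<rho> where \<rho>: "0 \<le> \<rho>" "\<rho> \<le> 1" "reaction a b lam \<rho> = 0" by blast
  have "\<rho> \<noteq> 0" "\<rho> \<noteq> 1" using \<rho>(3) a b by (auto simp: reaction_def)
  with \<rho> have \<rho>': "0 < \<rho> \<and> \<rho> < 1 \<and> reaction a b lam \<rho> = 0" by auto
  have "\<rho>' = \<rho>" if "0 < \<rho>' \<and> \<rho>' < 1 \<and> reaction a b lam \<rho>' = 0" for \<rho>'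
  proof (rule ccontr)
    assume ne: "\<rho>' \<noteq> \<rho>"
    \<comment> \<open>Vieta's relations for two distinct roots of the quadratic. They give
      \<open>lam (1 - \<rho>') (1 - \<rho>) = b > 0\<close> and
      \<open>lam \<rho>' \<rho> = - a < 0\<close>, which force opposite signs of
      \<open>lam\<close>.\<close>
    have "(\<rho>' - \<rho>) * (lam - a - b - lam * (\<rho>' + \<rho>)) = 0"
      using that \<rho>' by (simp add: reaction_def algebra_simps)
    then have s: "lam * (\<rho>' + \<rho>) = lam - a - b" using ne by simp
    have p: "lam * (\<rho>' * \<rho>) = - a"
    proof -
      have "reaction a b lam \<rho> = a + \<rho> * (lam - a - b) - lam * \<rho> * \<rho>"
        by (simp add: reaction_def algebra_simps)
      then show ?thesis unfolding s[symmetric] using \<rho>' by (simp add: algebra_simps)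
    qed
    have "lam * ((1 - \<rho>') * (1 - \<rho>)) = lam - lam * (\<rho>' + \<rho>) + lam * (\<rho>' * \<rho>)"
      by (simp add: algebra_simps)
    also have "\<dots> = b" unfolding s p by simp
    finally have "lam * ((1 - \<rho>') * (1 - \<rho>)) > 0" using b by simp
    moreover have "(1 - \<rho>') * (1 - \<rho>) > 0" using that \<rho>' by simp
    ultimately have "lam > 0" by (rule zero_less_mult_pos2)
    moreover have "0 < \<rho>' * \<rho>" using that \<rho>' by simp
    ultimately have "0 < lam * (\<rho>' * \<rho>)" by (rule mult_pos_pos)
    then show False using p a by linarith
  qed
  then have eq: "rho_star a b lam = \<rho>"
    unfolding rho_star_def using \<rho>' by (intro the_equality)
  have "- lam * \<rho> \<le> a / 2 * 1"
  proof -
    have "- lam * \<rho> \<le> \<bar>lam\<bar> * \<rho>" using \<rho>' by (intro mult_right_mono) auto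
    also have "\<dots> \<le> a / 2 * 1" using lam \<rho>' a by (intro mult_mono) auto
    finally show ?thesis .
  qed
  then have "a / 2 * (1 - \<rho>) \<le> (a + lam * \<rho>) * (1 - \<rho>)" using \<rho>' by (intro mult_right_mono) auto
  also have "\<dots> = b * \<rho>" using \<rho>' by (simp add: reaction_def)
  finally have "a \<le> \<rho> * (a + 2 * b)" by (simp add: algebra_simps)
  then show "a / (a + 2 * b) \<le> rho_star a b lam" unfolding eq using a b by (simp add: divide_le_eq)
  show "rho_star a b lam < 1" "reaction a b lam (rho_star a b lam) = 0" unfolding eq using \<rho>' by auto
qed

text \<open>All grid points lie in the closed unit cube, so compactness gives a bound that is
  uniform in \<open>n\<close>.\<close>

lemma C1_infty_bounded:
  fixes H :: "real \<Rightarrow> real ^ 'd::finite \<Rightarrow> real"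
  assumes H: "C1_infty T H"
  shows "continuous_on {0..T} (\<lambda>s. H s p)"
    and "\<exists>K\<ge>0. \<forall>t\<in>{0..T}. \<forall>n. \<forall>x\<in>dtorus n. \<bar>H t (grid_point n x)\<bar> \<le> K"
proof -
  have c: "continuous_on ({0..T} \<times> UNIV) (\<lambda>(t, x). H t x)"
    using H unfolding C1_infty_def by metis
  show "continuous_on {0..T} (\<lambda>s. H s p)"
  proof -
    have "continuous_on {0..T} (\<lambda>s. (\<lambda>(t, x). H t x) (s, p))"
      by (rule continuous_on_compose2[OF c]) (auto intro!: continuous_intros)
    then show ?thesis by simp
  qed
  have "compact ({0..T} \<times> cbox 0 (1 :: real ^ 'd))" by (intro compact_Times) auto
  moreover have "continuous_on ({0..T} \<times> cbox 0 (1 :: real ^ 'd)) (\<lambda>(t, x). H t x)"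
    by (rule continuous_on_subset[OF c]) auto
  ultimately have "bounded ((\<lambda>(t, x). H t x) ` ({0..T} \<times> cbox 0 (1 :: real ^ 'd)))"
    by (intro compact_imp_bounded compact_continuous_image)
  then obtain K where K: "\<And>t x. t \<in> {0..T} \<Longrightarrow> x \<in> cbox 0 (1 :: real ^ 'd) \<Longrightarrow> \<bar>H t x\<bar> \<le> K"
    unfolding bounded_iff by fastforce
  have gp: "grid_point n x \<in> cbox 0 (1 :: real ^ 'd)" if "x \<in> dtorus n" for n x
  proof -
    have "0 \<le> real_of_int (x $ i) / real n \<and> real_of_int (x $ i) / real n \<le> 1" for i
    proof -
      have "0 \<le> x $ i" "x $ i < int n" using that by (auto simp: dtorus_def)
      then have "0 \<le> real_of_int (x $ i)" "real_of_int (x $ i) \<le> real n" by linarith+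
      then show ?thesis by (auto simp: divide_le_eq_1)
    qed
    then show ?thesis by (simp add: mem_box_cart grid_point_def)
  qed
  show "\<exists>K\<ge>0. \<forall>t\<in>{0..T}. \<forall>n. \<forall>x\<in>dtorus n. \<bar>H t (grid_point n x)\<bar> \<le> K"
    by (rule exI[of _ "max 0 K"]) (use K gp in \<open>auto intro: order_trans[OF K[OF _ gp]]\<close>)
qed

lemma g_dim_ge_1: "n \<ge> 3 \<Longrightarrow> 1 \<le> g_dim d n"
  using ln_ge_1 by (simp add: g_dim_def)

text \<open>The last two summands are each at most the common scale, which raises the 15 coming from
  the trace to 17.\<close>

lemma form_constant_le:
  assumes n: "n \<ge> 3"
  shows "15 * (\<Sum>k\<in>(dtorus n :: (int ^ 'd::finite) set). green_mult n k) + real n ^ CARD('d) / (real n)\<^sup>2 + 1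
    \<le> (17 + 15 * real CARD('d) * 3 ^ (CARD('d) - 1)) * (real n ^ CARD('d) / (real n)\<^sup>2 * g_dim CARD('d) n)"
proof -
  let ?R = "real n ^ CARD('d) / (real n)\<^sup>2" and ?c = "real CARD('d) * 3 ^ (CARD('d) - 1)"
  have d: "CARD('d) \<ge> 1" using zero_less_card_finite[where 'a = 'd] by linarith
  have 1: "1 \<le> ?R * g_dim CARD('d) n" by (rule g_dim_scale_bounds(1)[OF n d])
  have "?R * 1 \<le> ?R * g_dim CARD('d) n" by (intro mult_left_mono g_dim_ge_1[OF n]) simp
  moreover have "15 * (\<Sum>k\<in>(dtorus n :: (int ^ 'd) set). green_mult n k) \<le> 15 * ((1 + ?c / 2) * (?R * g_dim CARD('d) n))"
    using sum_green_mult_le_g_dim[OF n, where 'd = 'd] by simp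
  moreover have "15 * ((1 + ?c / 2) * (?R * g_dim CARD('d) n)) \<le> (15 + 15 * ?c) * (?R * g_dim CARD('d) n)"
  proof -
    have "15 * (1 + ?c / 2) * (?R * g_dim CARD('d) n) \<le> (15 + 15 * ?c) * (?R * g_dim CARD('d) n)"
      using 1 by (intro mult_right_mono) auto
    then show ?thesis by (simp only: mult.assoc)
  qed
  ultimately have "15 * (\<Sum>k\<in>(dtorus n :: (int ^ 'd::finite) set). green_mult n k) + ?R + 1
    \<le> (15 + 15 * ?c) * (?R * g_dim CARD('d) n) + ?R * g_dim CARD('d) n + ?R * g_dim CARD('d) n"
    using 1 by linarith
  also have "\<dots> = (17 + 15 * ?c) * (?R * g_dim CARD('d) n)"
  proof -
    have "(15 + 15 * x) * u + u + u = (17 + 15 * x) * u" for x u :: real by (simp add: algebra_simps)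
    then show ?thesis .
  qed
  finally show ?thesis by (simp only: mult.assoc)
qed

text \<open>With \<open>\<theta> = A r / n^d\<close> the normalisation \<open>1 / r\<close> cancels
  in the exponential moment. What remains is a linear statistic with coefficients of order
  \<open>A / n^d\<close>, whose Hoeffding exponent is of order \<open>A^2 / n^d\<close>, the speed
  of the theorem.\<close>

lemma time_integral_tail_bound:
  fixes H :: "real \<Rightarrow> real ^ 'd::finite \<Rightarrow> real"
  assumes n: "n \<ge> 3" and T: "T > 0" and \<rho>: "0 < \<rho>" "\<rho> < 1" "reaction a b lam \<rho> = 0"
    and c: "0 < c" "c \<le> b" "c \<le> a - \<bar>lam\<bar>" and lam: "\<bar>lam\<bar> \<le> \<rho>" "20 * \<bar>lam\<bar> \<le> c * \<rho>"
    and ml: "markov_law T (configs n) (gen n a b lam) (bernoulli_product n \<rho>) P"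
    and pos: "A > 0" "r > 0"
    and cont: "\<And>p. continuous_on {0..T} (\<lambda>s. H s p)"
    and K: "\<And>t x. t \<in> {0..T} \<Longrightarrow> x \<in> dtorus n \<Longrightarrow> \<bar>H t (grid_point n x)\<bar> \<le> K"
    and E: "15 * (\<Sum>k\<in>(dtorus n :: (int ^ 'd) set). green_mult n k) + real n ^ CARD('d) / (real n)\<^sup>2 + 1 \<le> E"
  shows "measure P {\<eta> \<in> space P. (SUP t\<in>{0..T}. \<bar>LINT s:{0..t}|lborel.
            1 / r * (\<Sum>x\<in>dtorus n. (real (\<eta> s x) - \<rho>) * H s (grid_point n x))\<bar>) > \<epsilon>}
     \<le> exp (- (A * r / real n ^ CARD('d) * \<epsilon>) + E * T + 1 + T\<^sup>2 * K\<^sup>2 * A\<^sup>2 / (4 * real n ^ CARD('d)))"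
proof -
  let ?N = "real n ^ CARD('d)" and ?T = "dtorus n :: (int ^ 'd) set"
  let ?\<nu> = "bernoulli_product n \<rho> :: 'd config pmf"
  define X where "X s \<eta> = 1 / r * (\<Sum>x\<in>?T. (real (\<eta> x) - \<rho>) * H s (grid_point n x))" for s \<eta>
  define \<theta> where "\<theta> = A * r / ?N"
  \<comment> \<open>The factor 2 comes from the squared exponential in the \<open>L2\<close> norm,
    the factor \<open>T\<close> from the Riemann weights.\<close>
  define m where "m = 2 * T * (A / ?N) * K"
  have N: "?N > 0" using n by simp
  have \<theta>: "\<theta> > 0" using N pos by (simp add: \<theta>_def)
  have n1: "n \<ge> 1" using n by simp
  have "0 \<le> (\<Sum>k\<in>?T. green_mult n k)" using green_mult_bounds(1)[OF n1] by (intro sum_nonneg) auto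
  moreover have "0 \<le> ?N / (real n)\<^sup>2" by simp
  ultimately have E0: "0 \<le> E" using E by linarith
  have form: "(\<Sum>\<eta>\<in>configs n. pmf ?\<nu> \<eta> * (g \<eta> * gen n a b lam g \<eta>)) \<le> E * (\<Sum>\<eta>\<in>configs n. pmf ?\<nu> \<eta> * (g \<eta>)\<^sup>2)" for g
  proof -
    have "bexp n \<rho> (\<lambda>\<eta>. g \<eta> * gen n a b lam g \<eta>) \<le> E * bexp n \<rho> (\<lambda>\<eta>. (g \<eta>)\<^sup>2)"
      by (rule order_trans[OF generator_form_bound[OF n \<rho> c lam]])
        (intro mult_right_mono E bexp_nonneg, simp)
    then show ?thesis by (simp only: bexp_def)
  qed
  have mom: "(\<Sum>\<eta>\<in>configs n. pmf ?\<nu> \<eta> * (exp (\<theta> * T * \<bar>X t \<eta>\<bar>))\<^sup>2) \<le> 2 * exp (?N * m\<^sup>2 / 8)"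
    if t: "0 < t" "t \<le> T" for t
  proof -
    let ?h = "\<lambda>x. 2 * T * (A / ?N) * H t (grid_point n x)"
    have "(exp (\<theta> * T * \<bar>X t \<eta>\<bar>))\<^sup>2 = exp \<bar>\<Sum>x\<in>?T. ctr \<rho> \<eta> x * ?h x\<bar>" for \<eta>
    proof -
      have "(\<Sum>x\<in>?T. ctr \<rho> \<eta> x * ?h x) = 2 * T * (A / ?N) * (\<Sum>x\<in>?T. ctr \<rho> \<eta> x * H t (grid_point n x))"
        by (simp add: sum_distrib_left mult_ac)
      also have "\<dots> = 2 * (\<theta> * T * X t \<eta>)"
        using pos by (simp add: X_def \<theta>_def ctr_def)
      finally have "\<bar>\<Sum>x\<in>?T. ctr \<rho> \<eta> x * ?h x\<bar> = 2 * (\<theta> * T * \<bar>X t \<eta>\<bar>)"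
        using \<theta> T by (simp add: abs_mult)
      then show ?thesis by (simp add: exp_double)
    qed
    then have "(\<Sum>\<eta>\<in>configs n. pmf ?\<nu> \<eta> * (exp (\<theta> * T * \<bar>X t \<eta>\<bar>))\<^sup>2)
      = bexp n \<rho> (\<lambda>\<eta>. exp \<bar>\<Sum>x\<in>?T. ctr \<rho> \<eta> x * ?h x\<bar>)" by (simp add: bexp_def)
    also have "\<dots> \<le> 2 * exp (?N * m\<^sup>2 / 8)"
    proof (rule bexp_exp_abs_linear_le[OF \<rho>(1,2)])
      fix x assume x: "x \<in> ?T"
      have "\<bar>?h x\<bar> = 2 * T * (A / ?N) * \<bar>H t (grid_point n x)\<bar>"
        using T pos N by (simp add: abs_mult)
      also have "\<dots> \<le> m" unfolding m_def using K[OF _ x, of t] t T pos N by (intro mult_left_mono) auto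
      finally show "\<bar>?h x\<bar> \<le> m" .
    qed
    finally show ?thesis .
  qed
  have "measure P {\<eta> \<in> space P. (SUP t\<in>{0..T}. \<bar>LINT s:{0..t}|lborel. X s (\<eta> s)\<bar>) > \<epsilon>}
     \<le> exp (- (\<theta> * \<epsilon>)) * (exp (E * T) * sqrt (2 * exp (?N * m\<^sup>2 / 8)))"
  proof (rule markov_law_time_integral_tail[OF ml finite_configs T form E0 _ \<theta> mom])
    show "continuous_on {0..T} (\<lambda>s. X s y)" for y
      unfolding X_def by (intro continuous_intros cont)
  qed auto
  \<comment> \<open>The prefactor 2, due to the two signs of the linear statistic, is at most
    \<open>exp 2\<close>; its root contributes the 1 in the exponent.\<close>
  also have "sqrt (2 * exp (?N * m\<^sup>2 / 8)) \<le> exp (1 + ?N * m\<^sup>2 / 16)"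
  proof (rule real_le_lsqrt)
    have "2 \<le> exp (2 :: real)" using exp_ge_add_one_self[of "2 :: real"] by linarith
    then have "2 * exp (?N * m\<^sup>2 / 8) \<le> exp 2 * exp (?N * m\<^sup>2 / 8)" by (intro mult_right_mono) auto
    also have "\<dots> = (exp (1 + ?N * m\<^sup>2 / 16))\<^sup>2"
      by (simp add: exp_double[symmetric] exp_add[symmetric])
    finally show "2 * exp (?N * m\<^sup>2 / 8) \<le> (exp (1 + ?N * m\<^sup>2 / 16))\<^sup>2" .
  qed auto
  also have "exp (- (\<theta> * \<epsilon>)) * (exp (E * T) * exp (1 + ?N * m\<^sup>2 / 16)) = exp (- (\<theta> * \<epsilon>) + E * T + 1 + ?N * m\<^sup>2 / 16)"
    by (simp only: exp_add mult.assoc)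
  also have "?N * m\<^sup>2 / 16 = T\<^sup>2 * K\<^sup>2 * A\<^sup>2 / (4 * ?N)"
    using N by (simp add: m_def power2_eq_square field_simps)
  finally show ?thesis by (simp add: X_def \<theta>_def)
qed

theorem lemma3p1:
  fixes T a b :: real and a_seq :: "nat \<Rightarrow> real"
  assumes "T > 0" and "a > 0" and "b > 0"
    and "\<forall>n\<ge>1. a_seq n > 0"
    and "much_less (\<lambda>n. real n ^ (CARD('d::finite) - 1) * sqrt (g_dim CARD('d) n)) a_seq"
    and "much_less a_seq (\<lambda>n. real n ^ CARD('d))"
  shows "\<exists>lam_c>0. \<forall>lam\<in>{- lam_c..lam_c}. lam > - a \<longrightarrow>
    (\<forall>P :: nat \<Rightarrow> (real \<Rightarrow> 'd config) measure.
      (\<forall>n\<ge>1. markov_law T (configs n) (gen n a b lam)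
                (bernoulli_product n (rho_star a b lam)) (P n)) \<longrightarrow>
      (\<forall>r :: nat \<Rightarrow> real. (\<forall>n\<ge>1. r n > 0) \<and> much_less a_seq r \<longrightarrow>
        (\<forall>(H :: real \<Rightarrow> real ^ 'd \<Rightarrow> real) \<epsilon>. C1_infty T H \<and> \<epsilon> > 0 \<longrightarrow>
          ((\<lambda>n. ereal (real n ^ CARD('d) / (a_seq n)\<^sup>2) *
             log_ext (measure (P n)
               {\<eta> \<in> space (P n).
                  (SUP t\<in>{0..T}.
                     \<bar>LINT s:{0..t}|lborel.
                        1 / r n * (\<Sum>x\<in>dtorus n.
                          (real (\<eta> s x) - rho_star a b lam) * H s (grid_point n x))\<bar>) > \<epsilon>}))
           \<longlongrightarrow> - \<infinity>) sequentially)))"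
proof -
  let ?N = "\<lambda>n. real n ^ CARD('d)"
  define c where "c = min (a / 2) b"
  define \<rho>0 where "\<rho>0 = a / (a + 2 * b)"
  \<comment> \<open>The bound \<open>a / 2\<close> keeps the flip rates above \<open>c\<close> and
    gives \<open>\<rho>0 <= \<rho>\<close>. The other two are the smallness conditions of
    \<open>generator_form_bound\<close> with the density replaced by this lower bound.\<close>
  define lam_c where "lam_c = min (a / 2) (min \<rho>0 (c * \<rho>0 / 20))"
  have c0: "0 < c" "c \<le> a / 2" "c \<le> b" using assms by (auto simp: c_def)
  have \<rho>0: "0 < \<rho>0" using assms by (simp add: \<rho>0_def)
  have lam_c: "0 < lam_c" using assms c0 \<rho>0 by (simp add: lam_c_def)
  show ?thesis
  proof (intro exI[of _ lam_c] conjI lam_c ballI impI allI)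
    fix lam and P :: "nat \<Rightarrow> (real \<Rightarrow> 'd config) measure" and r :: "nat \<Rightarrow> real"
      and H :: "real \<Rightarrow> real ^ 'd \<Rightarrow> real" and \<epsilon> :: real
    define \<rho> where "\<rho> = rho_star a b lam"
    assume lam: "lam \<in> {- lam_c..lam_c}"
      and P: "\<forall>n\<ge>1. markov_law T (configs n) (gen n a b lam) (bernoulli_product n (rho_star a b lam)) (P n)"
      and r: "(\<forall>n\<ge>1. r n > 0) \<and> much_less a_seq r"
      and H: "C1_infty T H \<and> \<epsilon> > 0"
    have lam': "\<bar>lam\<bar> \<le> a / 2" "\<bar>lam\<bar> \<le> \<rho>0" "20 * \<bar>lam\<bar> \<le> c * \<rho>0"
      using lam by (auto simp: lam_c_def)
    have \<rho>: "\<rho>0 \<le> \<rho>" "\<rho> < 1" "reaction a b lam \<rho> = 0"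
      unfolding \<rho>_def \<rho>0_def by (rule rho_star_props[OF assms(2,3) lam'(1)])+
    have "c * \<rho>0 \<le> c * \<rho>" using c0 \<rho> by simp
    then have lam2: "\<bar>lam\<bar> \<le> \<rho>" "20 * \<bar>lam\<bar> \<le> c * \<rho>" "c \<le> a - \<bar>lam\<bar>"
      using lam' \<rho> c0 by linarith+
    have \<rho>p: "0 < \<rho>" using \<rho> \<rho>0 by simp
    obtain K where K: "\<And>t n x. t \<in> {0..T} \<Longrightarrow> x \<in> dtorus n \<Longrightarrow> \<bar>H t (grid_point n x)\<bar> \<le> K"
      using C1_infty_bounded(2)[of T H] H by blast
    define C where "C = 17 + 15 * real CARD('d) * 3 ^ (CARD('d) - 1)"
    define Q where "Q n = real n ^ CARD('d) / (real n)\<^sup>2 * g_dim CARD('d) n" for n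
    define p where "p n = measure (P n) {\<eta> \<in> space (P n).
                  (SUP t\<in>{0..T}. \<bar>LINT s:{0..t}|lborel. 1 / r n * (\<Sum>x\<in>dtorus n.
                          (real (\<eta> s x) - rho_star a b lam) * H s (grid_point n x))\<bar>) > \<epsilon>}" for n
    have C0: "0 \<le> C" by (simp add: C_def)
    have d: "CARD('d) \<ge> 1" using zero_less_card_finite[where 'a = 'd] by linarith
    have tail: "ereal (?N n / (a_seq n)\<^sup>2) * log_ext (p n)
       \<le> ereal (- (\<epsilon> * (r n / a_seq n)) + (C * T + 1) * (?N n * Q n / (a_seq n)\<^sup>2) + T\<^sup>2 * K\<^sup>2 / 4)"
      if n: "n \<ge> 3" for n
    proof -
      have n1: "n \<ge> 1" using n by simp
      have A: "a_seq n > 0" and rn: "r n > 0" using assms r n1 by auto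
      have N: "?N n > 0" using n by simp
      have s: "?N n / (a_seq n)\<^sup>2 > 0" using A N by simp
      let ?L = "- (a_seq n * r n / ?N n * \<epsilon>) + C * Q n * T + 1 + T\<^sup>2 * K\<^sup>2 * (a_seq n)\<^sup>2 / (4 * ?N n)"
      have "p n \<le> exp ?L"
        unfolding p_def \<rho>_def[symmetric]
      proof (rule time_integral_tail_bound[where c = c, OF n assms(1) \<rho>p \<rho>(2,3) c0(1,3) lam2(3,1,2)])
        show "markov_law T (configs n) (gen n a b lam) (bernoulli_product n \<rho>) (P n)"
          using P n1 by (simp add: \<rho>_def)
        show "continuous_on {0..T} (\<lambda>s. H s q)" for q using C1_infty_bounded(1)[of T H] H by blast
        show "15 * (\<Sum>k\<in>(dtorus n :: (int ^ 'd) set). green_mult n k) + ?N n / (real n)\<^sup>2 + 1 \<le> C * Q n"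
          unfolding C_def Q_def by (rule form_constant_le[OF n])
        show "\<bar>H t (grid_point n x)\<bar> \<le> K" if "t \<in> {0..T}" "x \<in> dtorus n" for t x
          using that by (rule K)
      qed (fact A rn)+
      \<comment> \<open>For vanishing probability the left side is minus infinity; otherwise the
        logarithm is monotone.\<close>
      then have "log_ext (p n) \<le> ereal ?L"
      proof (cases "p n = 0")
        case False
        then have "p n > 0" by (simp add: p_def zero_less_measure_iff)
        then have "ln (p n) \<le> ?L" using \<open>p n \<le> exp ?L\<close> by (metis ln_exp ln_mono)
        then show ?thesis using False by (simp add: log_ext_def)
      qed (simp add: log_ext_def)
      then have "ereal (?N n / (a_seq n)\<^sup>2) * log_ext (p n) \<le> ereal (?N n / (a_seq n)\<^sup>2) * ereal ?L"
        using s by (intro ereal_mult_left_mono) auto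
      also have "\<dots> = ereal (?N n / (a_seq n)\<^sup>2 * ?L)" by simp
      also have "?N n / (a_seq n)\<^sup>2 * ?L
          = - (\<epsilon> * (r n / a_seq n)) + ?N n / (a_seq n)\<^sup>2 * (C * Q n * T + 1) + T\<^sup>2 * K\<^sup>2 / 4"
      proof -
        have "?N n / (a_seq n)\<^sup>2 * (a_seq n * r n / ?N n * \<epsilon>) = \<epsilon> * (r n / a_seq n)"
          using A N by (simp add: power2_eq_square)
        moreover have "?N n / (a_seq n)\<^sup>2 * (T\<^sup>2 * K\<^sup>2 * (a_seq n)\<^sup>2 / (4 * ?N n)) = T\<^sup>2 * K\<^sup>2 / 4"
          using A N by simp
        moreover have "k * (- u + v + 1 + w) = - (k * u) + k * (v + 1) + k * w" for k u v w :: real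
          by (simp add: algebra_simps)
        ultimately show ?thesis by simp
      qed
      \<comment> \<open>Since \<open>Q n\<close> is at least 1, the additive constant joins the
        growth term.\<close>
      also have "?N n / (a_seq n)\<^sup>2 * (C * Q n * T + 1) \<le> ?N n / (a_seq n)\<^sup>2 * ((C * T + 1) * Q n)"
      proof (intro mult_left_mono)
        have "1 \<le> Q n" unfolding Q_def by (rule g_dim_scale_bounds(1)[OF n d])
        then show "C * Q n * T + 1 \<le> (C * T + 1) * Q n" by (simp add: algebra_simps)
      qed (use s in simp)
      finally show ?thesis by (simp add: mult_ac)
    qed
    have "(\<lambda>n. (real n ^ (CARD('d) - 1) * sqrt (g_dim CARD('d) n) / a_seq n)\<^sup>2) \<longlonglongrightarrow> 0\<^sup>2"
      using assms(5) unfolding much_less_def by (intro tendsto_intros)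
    then have lim: "(\<lambda>n. (real n ^ (CARD('d) - 1) * sqrt (g_dim CARD('d) n) / a_seq n)\<^sup>2) \<longlonglongrightarrow> 0" by simp
    \<comment> \<open>The growth term is the square of the ratio that tends to 0 by the lower growth
      condition on \<open>a_seq\<close>.\<close>
    have sq: "\<forall>\<^sub>F n in sequentially. (real n ^ (CARD('d) - 1) * sqrt (g_dim CARD('d) n) / a_seq n)\<^sup>2 = ?N n * Q n / (a_seq n)\<^sup>2"
    proof (rule eventually_sequentiallyI[of 3])
      fix n :: nat assume n: "3 \<le> n"
      have "?N n = real n ^ (CARD('d) - 1) * real n"
        using power_add[of "real n" "CARD('d) - 1" 1] d by simp
      moreover have "0 \<le> g_dim CARD('d) n" using g_dim_ge_1[OF n, of "CARD('d)"] by simp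
      ultimately show "(real n ^ (CARD('d) - 1) * sqrt (g_dim CARD('d) n) / a_seq n)\<^sup>2 = ?N n * Q n / (a_seq n)\<^sup>2"
        using n by (simp add: Q_def power_divide power_mult_distrib) (simp add: power2_eq_square)
    qed
    have small: "(\<lambda>n. (C * T + 1) * (?N n * Q n / (a_seq n)\<^sup>2)) \<longlonglongrightarrow> (C * T + 1) * 0"
      by (intro tendsto_intros Lim_transform_eventually[OF lim sq])
    have "(\<lambda>n. a_seq n / r n) \<longlonglongrightarrow> 0" using r by (simp add: much_less_def)
    have "\<forall>\<^sub>F n in sequentially. ereal (?N n / (a_seq n)\<^sup>2) * log_ext (p n) < ereal z" for z
    proof -
      \<comment> \<open>The level that \<open>r n / a_seq n\<close> must exceed for the divergent
        term to outweigh the two bounded terms and \<open>z\<close>; the maximum with 1 keeps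
        \<open>y\<close> positive, so that \<open>1 / y\<close> is a legitimate threshold for the
        inverse ratio.\<close>
      define y where "y = max 1 ((1 + T\<^sup>2 * K\<^sup>2 / 4 - z) / \<epsilon>)"
      have y: "y > 0" by (simp add: y_def)
      have "\<forall>\<^sub>F n in sequentially. a_seq n / r n < 1 / y"
        using \<open>(\<lambda>n. a_seq n / r n) \<longlonglongrightarrow> 0\<close> y by (intro order_tendstoD) auto
      moreover have "\<forall>\<^sub>F n in sequentially. (C * T + 1) * (?N n * Q n / (a_seq n)\<^sup>2) < 1"
        using small by (intro order_tendstoD) auto
      moreover have "\<forall>\<^sub>F n in sequentially. n \<ge> (3 :: nat)" by (rule eventually_ge_at_top)
      ultimately show ?thesis
      proof eventually_elim
        case (elim n)
        have A: "a_seq n > 0" and rn: "r n > 0" using assms r elim by auto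
        have "y < r n / a_seq n" using elim(1) A rn y by (simp add: field_simps)
        then have "\<epsilon> * y < \<epsilon> * (r n / a_seq n)" using H by (simp only: mult_less_cancel_left_pos)
        moreover have "1 + T\<^sup>2 * K\<^sup>2 / 4 - z \<le> \<epsilon> * y"
        proof -
          have "\<epsilon> * ((1 + T\<^sup>2 * K\<^sup>2 / 4 - z) / \<epsilon>) \<le> \<epsilon> * y"
            unfolding y_def using H by (intro mult_left_mono) auto
          then show ?thesis using H by simp
        qed
        ultimately have "- (\<epsilon> * (r n / a_seq n)) + (C * T + 1) * (?N n * Q n / (a_seq n)\<^sup>2) + T\<^sup>2 * K\<^sup>2 / 4 < z"
          using elim(2) by linarith
        then show ?case using tail[OF elim(3)] by (meson ereal_less_eq less_ereal.simps(1) order.strict_trans1)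
      qed
    qed
    then have "((\<lambda>n. ereal (?N n / (a_seq n)\<^sup>2) * log_ext (p n)) \<longlongrightarrow> - \<infinity>) sequentially"
      by (simp add: tendsto_MInfty)
    then show "((\<lambda>n. ereal (real n ^ CARD('d) / (a_seq n)\<^sup>2) *
             log_ext (measure (P n)
               {\<eta> \<in> space (P n).
                  (SUP t\<in>{0..T}.
                     \<bar>LINT s:{0..t}|lborel.
                        1 / r n * (\<Sum>x\<in>dtorus n.
                          (real (\<eta> s x) - rho_star a b lam) * H s (grid_point n x))\<bar>) > \<epsilon>}))
           \<longlongrightarrow> - \<infinity>) sequentially"
      by (simp only: p_def)
  qed
qed

end
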